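(* Let $\pi\in\mathfrak{X}^2(M)$ be a Poisson structure and $\omega\in\Omega^2(M)$ a closed two-form on a smooth manifold $M$. The following are equivalent: (i) the Dirac structures $\mathrm{Gr}(\pi)$ and $\mathrm{Gr}(\omega)$ concur; (ii) $(\pi,\omega)$ is a $P\Omega$-structure; (iii) $\omega$ is a complementary two-form to $\pi$.
   Context: Let $\mathbb{T}M=TM\oplus T^*M$ with the pairing $\langle u+\xi,v+\eta\rangle=\xi(v)+\eta(u)$, the Dorfman bracket $[u+\xi,v+\eta]=[u,v]+\mathscr{L}_u\eta-\iota_v\mathrm{d}\xi$, and projections $\mathrm{pr}_T,\mathrm{pr}_{T^*}$. A Dirac structure is a vector subbundle $L\subset\mathbb{T}M$ with $L=L^\perp$ and $[\Gamma(L),\Gamma(L)]\subset\Gamma(L)$. Write $\pi^\sharp(\xi)=\iota_\xi\pi$, $\omega^\sharp(u)=\iota_u\omega$, $\mathrm{Gr}(\pi)=\{\pi^\sharp(\xi)+\xi\mid\xi\in T^*M\}$, $\mathrm{Gr}(\omega)=\{u+\omega^\sharp(u)\mid u\in TM\}$; these are Dirac structures when $\pi$ is Poisson and $\omega$ is closed. The cotangent product of $L,R$ is $L\circledast R=\{a+\mathrm{pr}_T(b)\mid (a,b)\in L\times R\text{ in the same fibre},\ \mathrm{pr}_{T^*}(a)=\mathrm{pr}_{T^*}(b)\}$; Dirac structures $L,R$ concur if $L\circledast R$ is a Dirac structure. $(\pi,\omega)$ is a $P\Omega$-structure if the two-form $\omega\pi\omega$ defined by $(\omega\pi\omega)^\sharp=\omega^\sharp\pi^\sharp\omega^\sharp$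 is closed. Let $A=T^*M$ be the Lie algebroid of $\pi$, with anchor $\pi^\sharp$ and Koszul bracket $[\xi,\eta]^\pi=\mathscr{L}_{\pi^\sharp(\xi)}\eta-\iota_{\pi^\sharp(\eta)}\mathrm{d}\xi$. View $\omega$ as a section of $\wedge^2A$. The two-form $\omega$ is complementary to $\pi$ if it is a Poisson bivector in $A$, i.e. its Schouten bracket with itself in $A$ vanishes; this condition reads $\omega^\sharp[u,v]^{\pi^\omega}=[\omega^\sharp(u),\omega^\sharp(v)]^\pi$ for all $u,v\in\mathfrak{X}(M)=\Gamma(A^* )$, where $[u,v]^{\pi^\omega}=\mathscr{L}^A_{\omega^\sharp(u)}v-\iota_{\omega^\sharp(v)}\mathrm{d}_Au$ with $\mathrm{d}_A$, $\mathscr{L}^A$ the differential and Lie derivative of the Lie algebroid $A$. *)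

theory Defs
  imports "HOL-Analysis.Analysis"
begin

section \<open>Smooth maps between normed spaces\<close>

text \<open>
  These notions are only used for open \<open>S\<close> and a finite-dimensional domain, where iterated
  directional derivatives suffice to define the usual classes \<open>C\<^sup>k\<close>.
\<close>

primrec Ck_on :: "nat \<Rightarrow> 'e::real_normed_vector set \<Rightarrow> ('e \<Rightarrow> 'b::real_normed_vector) \<Rightarrow> bool" where
  "Ck_on 0 S f \<longleftrightarrow> continuous_on S f"
| "Ck_on (Suc k) S f \<longleftrightarrow>
     (\<forall>x\<in>S. f differentiable (at x)) \<and> (\<forall>v. Ck_on k S (\<lambda>x. frechet_derivative f (at x) v))"

definition smooth_on :: "'e::real_normed_vector set \<Rightarrow> ('e \<Rightarrow> 'b::real_normed_vector) \<Rightarrow> bool" where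
  "smooth_on S f \<longleftrightarrow> (\<forall>k. Ck_on k S f)"


section \<open>Smooth manifolds\<close>

text \<open>
  A manifold is a Hausdorff second countable type \<open>'a\<close> with a smooth atlas (not necessarily
  maximal) of charts into a finite-dimensional inner product space \<open>'e\<close>. The class
  \<open>euclidean_space\<close> is not used for \<open>'e\<close> because it excludes dimension \<open>0\<close>.
  A chart \<open>(U, \<phi>)\<close> consists of its domain and a map, whose values outside \<open>U\<close> are irrelevant.
\<close>

type_synonym ('a, 'e) chart = "'a set \<times> ('a \<Rightarrow> 'e)"
type_synonym ('a, 'e) atlas = "('a, 'e) chart set"

definition chart_inv :: "('a, 'e) chart \<Rightarrow> 'e \<Rightarrow> 'a" where
  "chart_inv c = inv_into (fst c) (snd c)"

definition smooth_atlas ::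
  "('a::{t2_space,second_countable_topology}, 'e::real_inner) atlas \<Rightarrow> bool" where
  "smooth_atlas A \<longleftrightarrow>
     (\<exists>B :: 'e set. finite B \<and> span B = UNIV) \<and>
     (\<Union>c\<in>A. fst c) = UNIV \<and>
     (\<forall>c\<in>A. open (fst c) \<and> open (snd c ` fst c) \<and>
        homeomorphism (fst c) (snd c ` fst c) (snd c) (chart_inv c)) \<and>
     (\<forall>c\<in>A. \<forall>d\<in>A. smooth_on (snd c ` (fst c \<inter> fst d)) (snd d \<circ> chart_inv c))"


section \<open>Tensor fields\<close>

text \<open>
  For each point \<open>p\<close> a preferred chart \<open>chart_at A p\<close> around \<open>p\<close> is selected, and the tangent space
  at \<open>p\<close> is identified with \<open>'e\<close> by means of it; the cotangent space is then the dual
  \<open>'e \<Rightarrow>\<^sub>L real\<close>. Thus a (not necessarily smooth) vector field is a function \<open>'a \<Rightarrow> 'e\<close>, a one-form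
  is a function \<open>'a \<Rightarrow> 'e \<Rightarrow>\<^sub>L real\<close>, a two-form assigns to \<open>p\<close> the map \<open>\<omega> p\<close> with
  \<open>\<omega> p u v = \<omega>(u, v)\<close>, and similarly a bivector field. As the preferred chart varies with \<open>p\<close>,
  smoothness cannot be read off from these functions directly: it refers to their representatives
  in each fixed chart.

  \<open>to_coords A c p\<close> sends a tangent vector at \<open>p\<close> to its coordinates in the chart \<open>c\<close>, and
  \<open>from_coords A c p\<close> is its inverse.
\<close>

context
  fixes A :: "('a::{t2_space,second_countable_topology}, 'e::real_inner) atlas"
begin

definition chart_at :: "'a \<Rightarrow> ('a, 'e) chart" where
  "chart_at p = (SOME c. c \<in> A \<and> p \<in> fst c)"

definition to_coords :: "('a, 'e) chart \<Rightarrow> 'a \<Rightarrow> 'e \<Rightarrow>\<^sub>L 'e" where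
  "to_coords c p =
     Blinfun (frechet_derivative (snd c \<circ> chart_inv (chart_at p)) (at (snd (chart_at p) p)))"

definition from_coords :: "('a, 'e) chart \<Rightarrow> 'a \<Rightarrow> 'e \<Rightarrow>\<^sub>L 'e" where
  "from_coords c p =
     Blinfun (frechet_derivative (snd (chart_at p) \<circ> chart_inv c) (at (snd c p)))"

definition fun_rep :: "('a, 'e) chart \<Rightarrow> ('a \<Rightarrow> real) \<Rightarrow> 'e \<Rightarrow> real" where
  "fun_rep c f x = f (chart_inv c x)"

definition vector_rep :: "('a, 'e) chart \<Rightarrow> ('a \<Rightarrow> 'e) \<Rightarrow> 'e \<Rightarrow> 'e" where
  "vector_rep c u x = (let p = chart_inv c x in to_coords c p (u p))"

definition form1_rep :: "('a, 'e) chart \<Rightarrow> ('a \<Rightarrow> 'e \<Rightarrow>\<^sub>L real) \<Rightarrow> 'e \<Rightarrow> 'e \<Rightarrow> real" where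
  "form1_rep c \<xi> x v = (let p = chart_inv c x in \<xi> p (from_coords c p v))"

definition form2_rep :: "('a, 'e) chart \<Rightarrow> ('a \<Rightarrow> 'e \<Rightarrow>\<^sub>L 'e \<Rightarrow>\<^sub>L real) \<Rightarrow> 'e \<Rightarrow> 'e \<Rightarrow> 'e \<Rightarrow> real" where
  "form2_rep c \<omega> x v w = (let p = chart_inv c x in \<omega> p (from_coords c p v) (from_coords c p w))"

definition bivector_rep ::
  "('a, 'e) chart \<Rightarrow> ('a \<Rightarrow> ('e \<Rightarrow>\<^sub>L real) \<Rightarrow>\<^sub>L ('e \<Rightarrow>\<^sub>L real) \<Rightarrow>\<^sub>L real) \<Rightarrow>
   'e \<Rightarrow> ('e \<Rightarrow>\<^sub>L real) \<Rightarrow> ('e \<Rightarrow>\<^sub>L real) \<Rightarrow> real" where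
  "bivector_rep c \<pi> x \<alpha> \<beta> =
     (let p = chart_inv c x in \<pi> p (\<alpha> o\<^sub>L to_coords c p) (\<beta> o\<^sub>L to_coords c p))"

definition smooth_fun :: "('a \<Rightarrow> real) \<Rightarrow> bool" where
  "smooth_fun f \<longleftrightarrow> (\<forall>c\<in>A. smooth_on (snd c ` fst c) (fun_rep c f))"

definition vector_field_on :: "'a set \<Rightarrow> ('a \<Rightarrow> 'e) \<Rightarrow> bool" where
  "vector_field_on W u \<longleftrightarrow> (\<forall>c\<in>A. smooth_on (snd c ` (W \<inter> fst c)) (vector_rep c u))"

definition one_form_on :: "'a set \<Rightarrow> ('a \<Rightarrow> 'e \<Rightarrow>\<^sub>L real) \<Rightarrow> bool" where
  "one_form_on W \<xi> \<longleftrightarrow> (\<forall>c\<in>A. \<forall>v. smooth_on (snd c ` (W \<inter> fst c)) (\<lambda>x. form1_rep c \<xi> x v))"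

abbreviation vector_field :: "('a \<Rightarrow> 'e) \<Rightarrow> bool" where
  "vector_field \<equiv> vector_field_on UNIV"

abbreviation one_form :: "('a \<Rightarrow> 'e \<Rightarrow>\<^sub>L real) \<Rightarrow> bool" where
  "one_form \<equiv> one_form_on UNIV"

definition two_form :: "('a \<Rightarrow> 'e \<Rightarrow>\<^sub>L 'e \<Rightarrow>\<^sub>L real) \<Rightarrow> bool" where
  "two_form \<omega> \<longleftrightarrow>
     (\<forall>p u. \<omega> p u u = 0) \<and>
     (\<forall>c\<in>A. \<forall>v w. smooth_on (snd c ` fst c) (\<lambda>x. form2_rep c \<omega> x v w))"

definition bivector_field :: "('a \<Rightarrow> ('e \<Rightarrow>\<^sub>L real) \<Rightarrow>\<^sub>L ('e \<Rightarrow>\<^sub>L real) \<Rightarrow>\<^sub>L real) \<Rightarrow> bool" where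
  "bivector_field \<pi> \<longleftrightarrow>
     (\<forall>p \<alpha>. \<pi> p \<alpha> \<alpha> = 0) \<and>
     (\<forall>c\<in>A. \<forall>\<alpha> \<beta>. smooth_on (snd c ` fst c) (\<lambda>x. bivector_rep c \<pi> x \<alpha> \<beta>))"


section \<open>Cartan calculus\<close>

text \<open>
  The operations are given by their classical coordinate expressions. Since these do not depend on
  the chart, the value at \<open>p\<close> is computed in the preferred chart at \<open>p\<close>, in which the vectors and
  covectors at \<open>p\<close> coincide with their coordinate representatives. \<open>pder p F v\<close> is the derivative
  of a local representative \<open>F\<close> at the coordinates of \<open>p\<close> in the direction \<open>v\<close>.
\<close>

definition pder :: "'a \<Rightarrow> ('e \<Rightarrow> 'b::real_normed_vector) \<Rightarrow> 'e \<Rightarrow> 'b" where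
  "pder p F v = frechet_derivative F (at (snd (chart_at p) p)) v"

definition d_fun :: "('a \<Rightarrow> real) \<Rightarrow> 'a \<Rightarrow> 'e \<Rightarrow>\<^sub>L real" where
  "d_fun f p = Blinfun (\<lambda>v. pder p (fun_rep (chart_at p) f) v)"

definition d_form1 :: "('a \<Rightarrow> 'e \<Rightarrow>\<^sub>L real) \<Rightarrow> 'a \<Rightarrow> 'e \<Rightarrow>\<^sub>L 'e \<Rightarrow>\<^sub>L real" where
  "d_form1 \<xi> p = Blinfun (\<lambda>v. Blinfun (\<lambda>w.
     pder p (\<lambda>x. form1_rep (chart_at p) \<xi> x w) v - pder p (\<lambda>x. form1_rep (chart_at p) \<xi> x v) w))"

definition d_form2 :: "('a \<Rightarrow> 'e \<Rightarrow>\<^sub>L 'e \<Rightarrow>\<^sub>L real) \<Rightarrow> 'a \<Rightarrow> 'e \<Rightarrow> 'e \<Rightarrow> 'e \<Rightarrow> real" where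
  "d_form2 \<omega> p u v w =
     pder p (\<lambda>x. form2_rep (chart_at p) \<omega> x v w) u
   - pder p (\<lambda>x. form2_rep (chart_at p) \<omega> x u w) v
   + pder p (\<lambda>x. form2_rep (chart_at p) \<omega> x u v) w"

definition closed_form :: "('a \<Rightarrow> 'e \<Rightarrow>\<^sub>L 'e \<Rightarrow>\<^sub>L real) \<Rightarrow> bool" where
  "closed_form \<omega> \<longleftrightarrow> (\<forall>p u v w. d_form2 \<omega> p u v w = 0)"

definition lie_bracket :: "('a \<Rightarrow> 'e) \<Rightarrow> ('a \<Rightarrow> 'e) \<Rightarrow> 'a \<Rightarrow> 'e" where
  "lie_bracket u v p =
     pder p (vector_rep (chart_at p) v) (u p) - pder p (vector_rep (chart_at p) u) (v p)"

text \<open>Cartan's formula \<open>\<L>\<^sub>u\<eta> = \<iota>\<^sub>u d\<eta> + d(\<iota>\<^sub>u\<eta>)\<close>.\<close>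

definition lie_deriv :: "('a \<Rightarrow> 'e) \<Rightarrow> ('a \<Rightarrow> 'e \<Rightarrow>\<^sub>L real) \<Rightarrow> 'a \<Rightarrow> 'e \<Rightarrow>\<^sub>L real" where
  "lie_deriv u \<eta> p = d_form1 \<eta> p (u p) + d_fun (\<lambda>q. \<eta> q (u q)) p"


section \<open>Poisson structures\<close>

text \<open>
  A bivector field is Poisson if \<open>{f, g} = \<pi>(df, dg)\<close> satisfies the Jacobi identity; skew-symmetry
  and the Leibniz rule are automatic.
\<close>

definition poisson_bracket ::
  "('a \<Rightarrow> ('e \<Rightarrow>\<^sub>L real) \<Rightarrow>\<^sub>L ('e \<Rightarrow>\<^sub>L real) \<Rightarrow>\<^sub>L real) \<Rightarrow> ('a \<Rightarrow> real) \<Rightarrow> ('a \<Rightarrow> real) \<Rightarrow> 'a \<Rightarrow> real" where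
  "poisson_bracket \<pi> f g p = \<pi> p (d_fun f p) (d_fun g p)"

definition poisson_structure :: "('a \<Rightarrow> ('e \<Rightarrow>\<^sub>L real) \<Rightarrow>\<^sub>L ('e \<Rightarrow>\<^sub>L real) \<Rightarrow>\<^sub>L real) \<Rightarrow> bool" where
  "poisson_structure \<pi> \<longleftrightarrow>
     bivector_field \<pi> \<and>
     (\<forall>f g h. smooth_fun f \<longrightarrow> smooth_fun g \<longrightarrow> smooth_fun h \<longrightarrow>
        (\<forall>p. poisson_bracket \<pi> f (poisson_bracket \<pi> g h) p
           + poisson_bracket \<pi> g (poisson_bracket \<pi> h f) p
           + poisson_bracket \<pi> h (poisson_bracket \<pi> f g) p = 0))"

end

text \<open>
  \<open>bisharp \<pi> p\<close> is \<open>\<pi>\<^sup>\<sharp>\<close> at \<open>p\<close>: the vector \<open>\<iota>\<^sub>\<xi>\<pi> = \<pi>(\<xi>, \<cdot>)\<close> of the bidual, seen as a vector. For a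
  two-form \<open>\<omega>\<close>, the map \<open>\<omega>\<^sup>\<sharp>\<close> at \<open>p\<close> is \<open>\<omega> p\<close> itself.
\<close>

definition bisharp ::
  "('a \<Rightarrow> ('e::real_inner \<Rightarrow>\<^sub>L real) \<Rightarrow>\<^sub>L ('e \<Rightarrow>\<^sub>L real) \<Rightarrow>\<^sub>L real) \<Rightarrow> 'a \<Rightarrow> ('e \<Rightarrow>\<^sub>L real) \<Rightarrow>\<^sub>L 'e" where
  "bisharp \<pi> p = Blinfun (\<lambda>\<xi>. THE v. \<forall>\<eta>. blinfun_apply \<eta> v = \<pi> p \<xi> \<eta>)"


section \<open>Dirac structures\<close>

definition pairing :: "'e::real_inner \<times> ('e \<Rightarrow>\<^sub>L real) \<Rightarrow> 'e \<times> ('e \<Rightarrow>\<^sub>L real) \<Rightarrow> real" where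
  "pairing a b = snd a (fst b) + snd b (fst a)"

definition perp :: "('e::real_inner \<times> ('e \<Rightarrow>\<^sub>L real)) set \<Rightarrow> ('e \<times> ('e \<Rightarrow>\<^sub>L real)) set" where
  "perp S = {a. \<forall>b\<in>S. pairing a b = 0}"

context
  fixes A :: "('a::{t2_space,second_countable_topology}, 'e::real_inner) atlas"
begin

definition section_on :: "'a set \<Rightarrow> ('a \<Rightarrow> 'e \<times> ('e \<Rightarrow>\<^sub>L real)) \<Rightarrow> bool" where
  "section_on W s \<longleftrightarrow> vector_field_on A W (fst \<circ> s) \<and> one_form_on A W (snd \<circ> s)"

definition dorfman ::
  "('a \<Rightarrow> 'e \<times> ('e \<Rightarrow>\<^sub>L real)) \<Rightarrow> ('a \<Rightarrow> 'e \<times> ('e \<Rightarrow>\<^sub>L real)) \<Rightarrow> 'a \<Rightarrow> 'e \<times> ('e \<Rightarrow>\<^sub>L real)" where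
  "dorfman a b p =
     (let u = fst \<circ> a; \<xi> = snd \<circ> a; v = fst \<circ> b; \<eta> = snd \<circ> b
      in (lie_bracket A u v p, lie_deriv A u \<eta> p - d_form1 A \<xi> p (v p)))"

definition sections ::
  "('a \<Rightarrow> ('e \<times> ('e \<Rightarrow>\<^sub>L real)) set) \<Rightarrow> ('a \<Rightarrow> 'e \<times> ('e \<Rightarrow>\<^sub>L real)) set" where
  "sections L = {s. section_on UNIV s \<and> (\<forall>p. s p \<in> L p)}"

text \<open>A subbundle of constant rank, described by smooth local frames.\<close>

definition vector_subbundle :: "('a \<Rightarrow> ('e \<times> ('e \<Rightarrow>\<^sub>L real)) set) \<Rightarrow> bool" where
  "vector_subbundle L \<longleftrightarrow>
     (\<exists>k::nat. \<forall>p. \<exists>W s. open W \<and> p \<in> W \<and> (\<forall>i<k. section_on W (s i)) \<and>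
        (\<forall>q\<in>W. inj_on (\<lambda>i. s i q) {..<k} \<and> independent ((\<lambda>i. s i q) ` {..<k}) \<and>
           span ((\<lambda>i. s i q) ` {..<k}) = L q))"

definition dirac_structure :: "('a \<Rightarrow> ('e \<times> ('e \<Rightarrow>\<^sub>L real)) set) \<Rightarrow> bool" where
  "dirac_structure L \<longleftrightarrow>
     vector_subbundle L \<and> (\<forall>p. L p = perp (L p)) \<and>
     (\<forall>a\<in>sections L. \<forall>b\<in>sections L. dorfman a b \<in> sections L)"

end

definition graph_bivector ::
  "('a \<Rightarrow> ('e::real_inner \<Rightarrow>\<^sub>L real) \<Rightarrow>\<^sub>L ('e \<Rightarrow>\<^sub>L real) \<Rightarrow>\<^sub>L real) \<Rightarrow> 'a \<Rightarrow> ('e \<times> ('e \<Rightarrow>\<^sub>L real)) set" where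
  "graph_bivector \<pi> p = {(bisharp \<pi> p \<xi>, \<xi>) | \<xi>. True}"

definition graph_form ::
  "('a \<Rightarrow> 'e::real_inner \<Rightarrow>\<^sub>L 'e \<Rightarrow>\<^sub>L real) \<Rightarrow> 'a \<Rightarrow> ('e \<times> ('e \<Rightarrow>\<^sub>L real)) set" where
  "graph_form \<omega> p = {(u, \<omega> p u) | u. True}"

definition cotangent_product ::
  "('a \<Rightarrow> ('e::real_inner \<times> ('e \<Rightarrow>\<^sub>L real)) set) \<Rightarrow> ('a \<Rightarrow> ('e \<times> ('e \<Rightarrow>\<^sub>L real)) set) \<Rightarrow>
   'a \<Rightarrow> ('e \<times> ('e \<Rightarrow>\<^sub>L real)) set" where
  "cotangent_product L R p = {a + (fst b, 0) | a b. a \<in> L p \<and> b \<in> R p \<and> snd a = snd b}"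


section \<open>Concurrence, P-Omega structures and complementary two-forms\<close>

definition omega_pi_omega ::
  "('a \<Rightarrow> ('e::real_inner \<Rightarrow>\<^sub>L real) \<Rightarrow>\<^sub>L ('e \<Rightarrow>\<^sub>L real) \<Rightarrow>\<^sub>L real) \<Rightarrow> ('a \<Rightarrow> 'e \<Rightarrow>\<^sub>L 'e \<Rightarrow>\<^sub>L real) \<Rightarrow>
   'a \<Rightarrow> 'e \<Rightarrow>\<^sub>L 'e \<Rightarrow>\<^sub>L real" where
  "omega_pi_omega \<pi> \<omega> p = \<omega> p o\<^sub>L bisharp \<pi> p o\<^sub>L \<omega> p"

context
  fixes A :: "('a::{t2_space,second_countable_topology}, 'e::real_inner) atlas"
begin

text \<open>The notion is meant for Dirac structures \<open>L\<close> and \<open>R\<close>; graphs of Poisson bivectors and of closed two-forms are always such.\<close>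

definition concur ::
  "('a \<Rightarrow> ('e \<times> ('e \<Rightarrow>\<^sub>L real)) set) \<Rightarrow> ('a \<Rightarrow> ('e \<times> ('e \<Rightarrow>\<^sub>L real)) set) \<Rightarrow> bool" where
  "concur L R \<longleftrightarrow> dirac_structure A (cotangent_product L R)"

definition P_Omega_structure ::
  "('a \<Rightarrow> ('e \<Rightarrow>\<^sub>L real) \<Rightarrow>\<^sub>L ('e \<Rightarrow>\<^sub>L real) \<Rightarrow>\<^sub>L real) \<Rightarrow> ('a \<Rightarrow> 'e \<Rightarrow>\<^sub>L 'e \<Rightarrow>\<^sub>L real) \<Rightarrow> bool" where
  "P_Omega_structure \<pi> \<omega> \<longleftrightarrow> closed_form A (omega_pi_omega \<pi> \<omega>)"

definition koszul_bracket ::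
  "('a \<Rightarrow> ('e \<Rightarrow>\<^sub>L real) \<Rightarrow>\<^sub>L ('e \<Rightarrow>\<^sub>L real) \<Rightarrow>\<^sub>L real) \<Rightarrow>
   ('a \<Rightarrow> 'e \<Rightarrow>\<^sub>L real) \<Rightarrow> ('a \<Rightarrow> 'e \<Rightarrow>\<^sub>L real) \<Rightarrow> 'a \<Rightarrow> 'e \<Rightarrow>\<^sub>L real" where
  "koszul_bracket \<pi> \<xi> \<eta> p =
     lie_deriv A (\<lambda>q. bisharp \<pi> q (\<xi> q)) \<eta> p - d_form1 A \<xi> p (bisharp \<pi> p (\<eta> p))"

text \<open>
  The calculus of the Lie algebroid \<open>T\<^sup>*M\<close> of \<open>\<pi>\<close> is that of sections: for a one-form \<open>\<xi>\<close> and a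
  function \<open>f\<close>, \<open>anchor_der \<pi> \<xi> f\<close> is \<open>\<pi>\<^sup>\<sharp>(\<xi>)(f)\<close>; for a vector field \<open>u\<close> (a section of the dual
  bundle) and one-forms \<open>\<xi>\<close>, \<open>\<eta>\<close>, \<open>cot_d \<pi> u \<xi> \<eta>\<close> is the function \<open>(d\<^sub>A u)(\<xi>, \<eta>)\<close> and
  \<open>cot_lie \<pi> \<xi> v \<eta>\<close> is the function \<open>\<langle>\<L>\<^sup>A\<^sub>\<xi> v, \<eta>\<rangle>\<close>. A section of the dual bundle is determined by
  its pairings with all smooth one-forms; in this way \<open>cot_bracket \<pi> \<omega> u v\<close> is the vector field
  \<open>\<L>\<^sup>A v - \<iota> d\<^sub>A u\<close>, with the Lie derivative along \<open>\<omega>\<^sup>\<sharp>(u)\<close> and the contraction with \<open>\<omega>\<^sup>\<sharp>(v)\<close>.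
\<close>

definition anchor_der ::
  "('a \<Rightarrow> ('e \<Rightarrow>\<^sub>L real) \<Rightarrow>\<^sub>L ('e \<Rightarrow>\<^sub>L real) \<Rightarrow>\<^sub>L real) \<Rightarrow>
   ('a \<Rightarrow> 'e \<Rightarrow>\<^sub>L real) \<Rightarrow> ('a \<Rightarrow> real) \<Rightarrow> 'a \<Rightarrow> real" where
  "anchor_der \<pi> \<xi> f p = d_fun A f p (bisharp \<pi> p (\<xi> p))"

definition cot_d ::
  "('a \<Rightarrow> ('e \<Rightarrow>\<^sub>L real) \<Rightarrow>\<^sub>L ('e \<Rightarrow>\<^sub>L real) \<Rightarrow>\<^sub>L real) \<Rightarrow> ('a \<Rightarrow> 'e) \<Rightarrow>
   ('a \<Rightarrow> 'e \<Rightarrow>\<^sub>L real) \<Rightarrow> ('a \<Rightarrow> 'e \<Rightarrow>\<^sub>L real) \<Rightarrow> 'a \<Rightarrow> real" where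
  "cot_d \<pi> u \<xi> \<eta> p =
     anchor_der \<pi> \<xi> (\<lambda>q. \<eta> q (u q)) p - anchor_der \<pi> \<eta> (\<lambda>q. \<xi> q (u q)) p
   - koszul_bracket \<pi> \<xi> \<eta> p (u p)"

definition cot_lie ::
  "('a \<Rightarrow> ('e \<Rightarrow>\<^sub>L real) \<Rightarrow>\<^sub>L ('e \<Rightarrow>\<^sub>L real) \<Rightarrow>\<^sub>L real) \<Rightarrow> ('a \<Rightarrow> 'e \<Rightarrow>\<^sub>L real) \<Rightarrow> ('a \<Rightarrow> 'e) \<Rightarrow>
   ('a \<Rightarrow> 'e \<Rightarrow>\<^sub>L real) \<Rightarrow> 'a \<Rightarrow> real" where
  "cot_lie \<pi> \<xi> v \<eta> p =
     anchor_der \<pi> \<xi> (\<lambda>q. \<eta> q (v q)) p - koszul_bracket \<pi> \<xi> \<eta> p (v p)"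

definition cot_bracket ::
  "('a \<Rightarrow> ('e \<Rightarrow>\<^sub>L real) \<Rightarrow>\<^sub>L ('e \<Rightarrow>\<^sub>L real) \<Rightarrow>\<^sub>L real) \<Rightarrow> ('a \<Rightarrow> 'e \<Rightarrow>\<^sub>L 'e \<Rightarrow>\<^sub>L real) \<Rightarrow>
   ('a \<Rightarrow> 'e) \<Rightarrow> ('a \<Rightarrow> 'e) \<Rightarrow> 'a \<Rightarrow> 'e" where
  "cot_bracket \<pi> \<omega> u v p =
     (THE x. \<forall>\<eta>. one_form A \<eta> \<longrightarrow>
        \<eta> p x = cot_lie \<pi> (\<lambda>q. \<omega> q (u q)) v \<eta> p - cot_d \<pi> u (\<lambda>q. \<omega> q (v q)) \<eta> p)"

text \<open>
  The vanishing of the Schouten bracket of \<open>\<omega>\<close> with itself in the Lie algebroid \<open>T\<^sup>*M\<close>, written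
  as the condition that \<open>\<omega>\<^sup>\<sharp>\<close> maps the bracket induced by \<open>\<omega>\<close> on the dual bundle to the Koszul
  bracket.
\<close>

definition complementary ::
  "('a \<Rightarrow> ('e \<Rightarrow>\<^sub>L real) \<Rightarrow>\<^sub>L ('e \<Rightarrow>\<^sub>L real) \<Rightarrow>\<^sub>L real) \<Rightarrow> ('a \<Rightarrow> 'e \<Rightarrow>\<^sub>L 'e \<Rightarrow>\<^sub>L real) \<Rightarrow> bool" where
  "complementary \<pi> \<omega> \<longleftrightarrow>
     (\<forall>u v. vector_field A u \<longrightarrow> vector_field A v \<longrightarrow>
        (\<forall>p. \<omega> p (cot_bracket \<pi> \<omega> u v p) =
             koszul_bracket \<pi> (\<lambda>q. \<omega> q (u q)) (\<lambda>q. \<omega> q (v q)) p))"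

end

end

theory Submission
  imports Defs
begin

text \<open>
  Write \<open>P = \<pi>\<^sup>\<sharp>\<close> and \<open>\<theta> = \<omega>\<pi>\<omega>\<close>. Each of the three conditions says that \<open>d\<theta> = 0\<close>; for the
  \<open>P\<Omega>\<close>-condition this is the definition.

  The cotangent product of the two graphs is \<open>L = {(u + P\<omega>u, \<omega>u)}\<close>, the image of \<open>TM\<close> under a
  fibrewise injective map \<open>u \<mapsto> s\<^sub>u\<close>. It is a vector bundle with \<open>L\<^sup>\<bottom> = L\<close>, since \<open>P\<close> and \<open>\<omega>\<close> are skew:
  a pair \<open>(w, \<zeta>)\<close> orthogonal to \<open>L\<close> equals \<open>s\<^sub>u\<close> for \<open>u = w - P\<zeta>\<close>. So concurrence is
  involutivity of \<open>L\<close>, which means that \<open>\<langle>[s\<^sub>u, s\<^sub>v], s\<^sub>w\<rangle>\<close> vanishes for all vector fields. This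
  expression is a sum of three parts, according to the number of factors \<open>P\<close>. The part without \<open>P\<close> is
  \<open>d\<omega>(u, v, w) = 0\<close>; the quadratic part is the Jacobiator of \<open>\<pi>\<close> on \<open>\<omega>u\<close>, \<open>\<omega>v\<close>, \<open>\<omega>w\<close>, which vanishes
  as well; and the linear part is \<open>-d\<theta>(u, v, w)\<close> (lemma \<open>dorfman_obstruction\<close>).

  For the third condition, the difference \<open>[\<omega>u, \<omega>v]\<^sup>\<pi> - \<omega>([u, v])\<close>, with the bracket induced by \<open>\<omega>\<close> on
  vector fields, has the same value \<open>-d\<theta>(u, v, w)\<close> on \<open>w\<close> (lemma \<open>complementary_obstruction\<close>).

  Both identities are pointwise, and each side depends only on the first-order jets at \<open>p\<close> of the fields
  involved, so they are verified in the preferred chart at \<open>p\<close>. For closed \<open>\<omega>\<close>, \<open>-d\<theta>(u, v, w)\<close> is the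
  sum of \<open>\<langle>\<omega>w, (D\<^sub>u P)(\<omega>v)\<rangle> + (D\<^sub>x \<omega>)(u, v)\<close>, where \<open>x = P\<omega>w\<close>, over the cyclic permutations of
  \<open>(u, v, w)\<close> (lemma \<open>d_form2_omega_pi_omega\<close>); the derivatives of \<open>u\<close> and \<open>v\<close> cancel in the other two
  expressions, which leaves the same sum.

  Two analytic facts connect these computations with the definitions. The Dorfman bracket of sections
  must again be smooth although its value at \<open>p\<close> is computed in a chart that depends on \<open>p\<close>; this
  follows from the invariance of the bracket and of \<open>d\<close> under coordinate changes, and hence from the symmetry
  of second derivatives. Moreover, Jacobi's identity, involutivity and complementarity quantify over
  global functions and fields, so bump functions are needed to realise given values at a point.
\<close>

section \<open>Finite-dimensional inner product spaces\<close>

text \<open>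
  The model space is only known to be spanned by a finite set, and it may be zero. An orthonormal basis
  stands in for the coordinates of a Euclidean space: it makes linear maps bounded, closed balls
  compact, and it reduces smoothness of vector-valued maps to that of components.
\<close>

locale orthonormal_basis =
  fixes E :: "'e::real_inner set"
  assumes finite_basis: "finite E"
    and orthonormal: "\<And>d e. d \<in> E \<Longrightarrow> e \<in> E \<Longrightarrow> d \<bullet> e = (if d = e then 1 else 0)"
    and span_basis: "span E = UNIV"
begin

lemma expansion: "x = (\<Sum>e\<in>E. (x \<bullet> e) *\<^sub>R e)"
proof -
  have "x \<in> span E" by (simp add: span_basis)
  then show ?thesis
  proof (induction rule: span_induct_alt)
    case base
    then show ?case by simp
  next
    case (step c d y)
    have "(\<Sum>e\<in>E. ((c *\<^sub>R d + y) \<bullet> e) *\<^sub>R e)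
        = c *\<^sub>R (\<Sum>e\<in>E. (d \<bullet> e) *\<^sub>R e) + (\<Sum>e\<in>E. (y \<bullet> e) *\<^sub>R e)"
      by (simp add: inner_add_left scaleR_add_left sum.distrib scaleR_sum_right)
    also have "(\<Sum>e\<in>E. (d \<bullet> e) *\<^sub>R e) = (\<Sum>e\<in>E. if d = e then e else 0)"
      by (rule sum.cong) (auto simp: orthonormal[OF \<open>d \<in> E\<close>])
    also have "\<dots> = d" using \<open>d \<in> E\<close> finite_basis by simp
    finally show ?case using step by simp
  qed
qed

lemma linear_expansion: "linear f \<Longrightarrow> f x = (\<Sum>e\<in>E. (x \<bullet> e) *\<^sub>R f e)"
  by (subst expansion[of x]) (simp add: linear_sum linear_scale)

lemma independent_basis: "independent E"
proof -
  have "f d = 0" if "(\<Sum>e\<in>E. f e *\<^sub>R e) = 0" "d \<in> E" for f d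
  proof -
    have "0 = (\<Sum>e\<in>E. f e *\<^sub>R e) \<bullet> d" using that by simp
    also have "\<dots> = (\<Sum>e\<in>E. if e = d then f d else 0)"
      unfolding inner_sum_left by (rule sum.cong) (auto simp: orthonormal that)
    finally show ?thesis using that finite_basis by simp
  qed
  then show ?thesis using finite_basis by (auto simp: dependent_finite)
qed

lemma bounded_linear_of_linear:
  fixes f :: "'e \<Rightarrow> 'b::real_normed_vector"
  assumes "linear f"
  shows "bounded_linear f"
proof -
  have "f = (\<lambda>x. \<Sum>e\<in>E. (x \<bullet> e) *\<^sub>R f e)"
    using linear_expansion[OF assms] by blast
  moreover have "bounded_linear (\<lambda>x. \<Sum>e\<in>E. (x \<bullet> e) *\<^sub>R f e)"
    by (intro bounded_linear_intros bounded_linear_inner_left)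
  ultimately show ?thesis by metis
qed

lemma covector_expansion: "\<alpha> = (\<Sum>e\<in>E. blinfun_apply \<alpha> e *\<^sub>R blinfun_inner_left e)"
  for \<alpha> :: "'e \<Rightarrow>\<^sub>L real"
proof (rule blinfun_eqI)
  fix x
  have "blinfun_apply \<alpha> x = (\<Sum>e\<in>E. (x \<bullet> e) *\<^sub>R blinfun_apply \<alpha> e)"
    by (rule linear_expansion) (simp add: bounded_linear.linear blinfun.bounded_linear_right)
  then show "blinfun_apply \<alpha> x
      = blinfun_apply (\<Sum>e\<in>E. blinfun_apply \<alpha> e *\<^sub>R blinfun_inner_left e) x"
    by (simp add: blinfun.bilinear_simps blinfun_inner_left.rep_eq mult.commute)
qed

lemma covector_linear_expansion:
  assumes "linear f"
  shows "f \<alpha> = (\<Sum>e\<in>E. blinfun_apply \<alpha> e *\<^sub>R f (blinfun_inner_left e))"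
  by (subst covector_expansion[of \<alpha>]) (simp add: linear_sum[OF assms] linear_scale[OF assms])

lemma covector_functional_representation:
  fixes f :: "('e \<Rightarrow>\<^sub>L real) \<Rightarrow> real"
  assumes "linear f"
  obtains x where "\<And>\<alpha>. blinfun_apply \<alpha> x = f \<alpha>"
proof
  show "blinfun_apply \<alpha> (\<Sum>e\<in>E. f (blinfun_inner_left e) *\<^sub>R e) = f \<alpha>" for \<alpha>
    by (subst covector_linear_expansion[OF assms, of \<alpha>])
      (simp add: blinfun.sum_right blinfun.scaleR_right mult.commute)
qed

lemma covector_separates:
  assumes "\<And>\<alpha> :: 'e \<Rightarrow>\<^sub>L real. blinfun_apply \<alpha> x = blinfun_apply \<alpha> y"
  shows "x = y"
proof -
  have "(x - y) \<bullet> (x - y) = 0"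
    using assms[of "blinfun_inner_left (x - y)"] by (simp add: blinfun_inner_left.rep_eq inner_diff_left)
  then show ?thesis by simp
qed

lemma bounded_linear_of_linear_covector:
  fixes f :: "('e \<Rightarrow>\<^sub>L real) \<Rightarrow> 'b::real_normed_vector"
  assumes "linear f"
  shows "bounded_linear f"
proof -
  have "f = (\<lambda>\<alpha>. \<Sum>e\<in>E. blinfun_apply \<alpha> e *\<^sub>R f (blinfun_inner_left e))"
    using covector_linear_expansion[OF assms] by blast
  moreover have "bounded_linear (\<lambda>\<alpha>. \<Sum>e\<in>E. blinfun_apply \<alpha> e *\<^sub>R f (blinfun_inner_left e))"
    by (intro bounded_linear_intros)
  ultimately show ?thesis by metis
qed

text \<open>
  A closed ball is a closed subset of a box, and a box is compact because it is built from intervals by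
  adding one coordinate at a time.
\<close>

lemma compact_closed_ball: "compact (cball (x::'e) r)"
proof -
  have box: "compact ((\<lambda>a. \<Sum>e\<in>F. a e *\<^sub>R e) ` {a. \<forall>e. \<bar>a e\<bar> \<le> r})" if "F \<subseteq> E" for F
    using finite_subset[OF that finite_basis]
  proof (induction F rule: finite_induct)
    case empty
    have "(\<lambda>a. \<Sum>e\<in>{}. a e *\<^sub>R e) ` {a::'e \<Rightarrow> real. \<forall>e. \<bar>a e\<bar> \<le> r} \<subseteq> {0::'e}" by auto
    then show ?case using finite_imp_compact finite_subset by blast
  next
    case (insert d F)
    let ?C = "(\<lambda>a. \<Sum>e\<in>F. a e *\<^sub>R e) ` {a. \<forall>e. \<bar>a e\<bar> \<le> r}"
    have "compact ((\<lambda>(t, y). t *\<^sub>R d + y) ` (cball 0 r \<times> ?C))"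
      by (intro compact_continuous_image compact_Times insert compact_cball)
        (auto simp: case_prod_beta intro!: continuous_intros)
    moreover have "(\<lambda>(t, y). t *\<^sub>R d + y) ` (cball 0 r \<times> ?C)
        = (\<lambda>a. \<Sum>e\<in>insert d F. a e *\<^sub>R e) ` {a. \<forall>e. \<bar>a e\<bar> \<le> r}"
    proof (intro equalityI subsetI)
      fix z assume "z \<in> (\<lambda>(t, y). t *\<^sub>R d + y) ` (cball 0 r \<times> ?C)"
      then obtain q where q: "q \<in> cball 0 r \<times> ?C" "z = (\<lambda>(t, y). t *\<^sub>R d + y) q" by blast
      obtain t y where "q = (t, y)" by (cases q)
      with q have ty: "t \<in> cball 0 r" "y \<in> ?C" "z = t *\<^sub>R d + y" by simp_all
      then obtain a where "\<forall>e. \<bar>a e\<bar> \<le> r" "y = (\<Sum>e\<in>F. a e *\<^sub>R e)" by blast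
      with ty have a: "\<bar>t\<bar> \<le> r" "\<And>e. \<bar>a e\<bar> \<le> r" "z = t *\<^sub>R d + (\<Sum>e\<in>F. a e *\<^sub>R e)"
        by simp_all
      have "(\<Sum>e\<in>insert d F. (a(d := t)) e *\<^sub>R e) = t *\<^sub>R d + (\<Sum>e\<in>F. a e *\<^sub>R e)"
        using insert by (simp add: sum.insert) (rule sum.cong, auto)
      then show "z \<in> (\<lambda>a. \<Sum>e\<in>insert d F. a e *\<^sub>R e) ` {a. \<forall>e. \<bar>a e\<bar> \<le> r}"
        using a by (intro image_eqI[where x = "a(d := t)"]) auto
    next
      fix z assume "z \<in> (\<lambda>a. \<Sum>e\<in>insert d F. a e *\<^sub>R e) ` {a. \<forall>e. \<bar>a e\<bar> \<le> r}"
      then obtain a where "\<forall>e. \<bar>a e\<bar> \<le> r" "z = (\<Sum>e\<in>insert d F. a e *\<^sub>R e)" by auto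
      then show "z \<in> (\<lambda>(t, y). t *\<^sub>R d + y) ` (cball 0 r \<times> ?C)"
        using insert by (intro image_eqI[where x = "(a d, \<Sum>e\<in>F. a e *\<^sub>R e)"]) auto
    qed
    ultimately show ?case by simp
  qed
  define K where "K = (\<lambda>a. \<Sum>e\<in>E. a e *\<^sub>R e) ` {a. \<forall>e. \<bar>a e\<bar> \<le> r}"
  have "cball 0 r \<subseteq> K"
  proof
    fix y :: 'e assume y: "y \<in> cball 0 r"
    then have r: "0 \<le> r" by (metis mem_cball_0 norm_ge_zero order_trans)
    have "\<bar>if e \<in> E then y \<bullet> e else 0\<bar> \<le> r" for e
    proof (cases "e \<in> E")
      case True
      then have "norm e = 1" by (simp add: norm_eq_sqrt_inner orthonormal)
      then show ?thesis using True y Cauchy_Schwarz_ineq2[of y e] by simp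
    qed (simp add: r)
    moreover have "y = (\<Sum>e\<in>E. (if e \<in> E then y \<bullet> e else 0) *\<^sub>R e)"
      by (subst expansion[of y]) (rule sum.cong, auto)
    ultimately show "y \<in> K"
      unfolding K_def by (intro image_eqI[where x = "\<lambda>e. if e \<in> E then y \<bullet> e else 0"]) auto
  qed
  then have "K \<inter> cball 0 r = cball 0 r" by blast
  moreover have "compact (K \<inter> cball 0 r)"
    unfolding K_def by (intro compact_Int_closed closed_cball box) auto
  ultimately have "compact (cball (0::'e) r)" by (simp only:)
  then have "compact ((+) x ` cball 0 r)" by (rule compact_translation)
  then show ?thesis by (simp add: cball_translation)
qed

end

text \<open>
  Gram-Schmidt orthonormalisation: each further vector is replaced by its component orthogonal to the
  previous ones, unless that component is zero.
\<close>

lemma orthonormal_basis_exists: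
  assumes "finite B" and "span B = (UNIV :: 'e::real_inner set)"
  shows "\<exists>E :: 'e set. orthonormal_basis E"
proof -
  have "\<exists>E::'e set. finite E \<and> (\<forall>d\<in>E. \<forall>e\<in>E. d \<bullet> e = (if d = e then 1 else 0)) \<and> span E = span B"
    using assms(1)
  proof (induction B rule: finite_induct)
    case empty
    then show ?case by (intro exI[of _ "{}"]) auto
  next
    case (insert b B)
    then obtain E :: "'e set" where E: "finite E"
      "\<And>d e. d \<in> E \<Longrightarrow> e \<in> E \<Longrightarrow> d \<bullet> e = (if d = e then 1 else 0)" "span E = span B"
      by blast
    define y where "y = b - (\<Sum>e\<in>E. (b \<bullet> e) *\<^sub>R e)"
    have proj: "(\<Sum>e\<in>E. (b \<bullet> e) *\<^sub>R e) \<in> span E"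
      by (intro span_sum span_scale span_base)
    have y_orth: "y \<bullet> d = 0" if "d \<in> E" for d
    proof -
      have "(\<Sum>e\<in>E. (b \<bullet> e) * (e \<bullet> d)) = (\<Sum>e\<in>E. if e = d then b \<bullet> d else 0)"
        by (rule sum.cong) (auto simp: E(2) that)
      then show ?thesis
        using that E(1) by (simp add: y_def inner_diff_left inner_sum_left)
    qed
    have span_insert_b: "span (insert b E) = span (insert b B)"
      using E(3) by (metis span_insert)
    show ?case
    proof (cases "y = 0")
      case True
      then have "b \<in> span E" using proj by (simp add: y_def)
      then have "span E = span (insert b B)" using span_insert_b by (metis span_redundant)
      then show ?thesis using E by blast
    next
      case False
      define n where "n = y /\<^sub>R norm y"
      have n: "n \<bullet> n = 1" "\<And>d. d \<in> E \<Longrightarrow> n \<bullet> d = 0" "\<And>d. d \<in> E \<Longrightarrow> d \<bullet> n = 0"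
        using False y_orth by (simp_all add: n_def inner_commute dot_square_norm power2_eq_square)
      have "n \<in> span (insert b E)"
        unfolding n_def y_def
        using proj by (intro span_scale span_diff) (auto intro: span_base span_mono[THEN subsetD, rotated])
      moreover have "b \<in> span (insert n E)"
      proof -
        have "b = norm y *\<^sub>R n + (\<Sum>e\<in>E. (b \<bullet> e) *\<^sub>R e)" using False by (simp add: n_def y_def)
        moreover have "(\<Sum>e\<in>E. (b \<bullet> e) *\<^sub>R e) \<in> span (insert n E)"
          using span_mono[of E "insert n E"] proj by blast
        ultimately show ?thesis by (metis span_add span_scale span_base insertI1)
      qed
      ultimately have "span (insert n E) = span (insert b E)"
        by (intro span_eq[THEN iffD2] conjI) (auto intro: span_base)
      \<comment> \<open>Distinct from the previous basis vectors, as it is orthogonal to them and nonzero.\<close>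
      moreover have "n \<notin> E" using n(1,2) by force
      ultimately show ?thesis
        using E n span_insert_b by (intro exI[of _ "insert n E"]) auto
    qed
  qed
  then obtain E :: "'e set" where E: "finite E"
    "\<forall>d\<in>E. \<forall>e\<in>E. d \<bullet> e = (if d = e then 1 else 0)" "span E = span B" by blast
  have "orthonormal_basis E"
    using E(1) E(2)[rule_format] E(3)[unfolded assms(2)] by (rule orthonormal_basis.intro)
  then show ?thesis ..
qed


section \<open>Smooth maps\<close>

lemma frechet_derivative_eq: "(f has_derivative f') (at x) \<Longrightarrow> frechet_derivative f (at x) = f'"
  using frechet_derivative_at by metis

lemma differentiable_frechet:
  "f differentiable (at x) \<Longrightarrow> (f has_derivative frechet_derivative f (at x)) (at x)"
  by (simp add: frechet_derivative_works)

lemma has_derivative_cong_open: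
  assumes "open S" "x \<in> S" "\<And>y. y \<in> S \<Longrightarrow> f y = g y"
  shows "(f has_derivative f') (at x) \<longleftrightarrow> (g has_derivative f') (at x)"
  using has_derivative_transform_within_open[of f f' x UNIV S g]
    has_derivative_transform_within_open[of g f' x UNIV S f] assms by auto

lemma frechet_derivative_cong_open:
  assumes "open S" "x \<in> S" "\<And>y. y \<in> S \<Longrightarrow> f y = g y"
  shows "frechet_derivative f (at x) = frechet_derivative g (at x)"
  using has_derivative_cong_open[OF assms] by (simp add: frechet_derivative_def)

lemma differentiable_cong_open:
  assumes "open S" "x \<in> S" "\<And>y. y \<in> S \<Longrightarrow> f y = g y"
  shows "f differentiable (at x) \<longleftrightarrow> g differentiable (at x)"
  using has_derivative_cong_open[OF assms] by (simp add: differentiable_def)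

lemma Ck_on_cong:
  assumes "open S" "\<And>x. x \<in> S \<Longrightarrow> f x = g x"
  shows "Ck_on k S f \<longleftrightarrow> Ck_on k S g"
  using assms(2)
proof (induction k arbitrary: f g)
  case 0
  then show ?case using continuous_on_cong by simp
next
  case (Suc k)
  have "frechet_derivative f (at x) = frechet_derivative g (at x)" if "x \<in> S" for x
    using frechet_derivative_cong_open[OF assms(1) that, of f g] Suc.prems by blast
  then have "Ck_on k S (\<lambda>x. frechet_derivative f (at x) v)
      \<longleftrightarrow> Ck_on k S (\<lambda>x. frechet_derivative g (at x) v)" for v
    by (intro Suc.IH) simp
  moreover have "f differentiable (at x) \<longleftrightarrow> g differentiable (at x)" if "x \<in> S" for x
    using differentiable_cong_open[OF assms(1) that, of f g] Suc.prems by blast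
  ultimately show ?case by auto
qed

lemma Ck_on_subset: "Ck_on k S f \<Longrightarrow> T \<subseteq> S \<Longrightarrow> Ck_on k T f"
  by (induction k arbitrary: f) (auto intro: continuous_on_subset)

lemma Ck_on_Un:
  "open S \<Longrightarrow> open T \<Longrightarrow> Ck_on k S f \<Longrightarrow> Ck_on k T f \<Longrightarrow> Ck_on k (S \<union> T) f"
  by (induction k arbitrary: f) (auto intro: continuous_on_open_Un)

lemma Ck_on_Suc_D: "Ck_on (Suc k) S f \<Longrightarrow> Ck_on k S f"
proof (induction k arbitrary: f)
  case 0
  then show ?case
    by (auto intro!: differentiable_imp_continuous_on
        simp: differentiable_on_def differentiable_at_withinI)
next
  case (Suc k)
  then show ?case by (metis Ck_on.simps(2))
qed

lemma Ck_on_const: "Ck_on k S (\<lambda>x. c)"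
  by (induction k arbitrary: c) auto

lemma Ck_on_bounded_linear:
  assumes "bounded_linear L" "open S" "Ck_on k S f"
  shows "Ck_on k S (\<lambda>x. L (f x))"
  using assms(3)
proof (induction k arbitrary: f)
  case 0
  then show ?case using assms(1) by (simp add: bounded_linear.continuous_on)
next
  case (Suc k)
  have der: "((\<lambda>x. L (f x)) has_derivative (\<lambda>h. L (frechet_derivative f (at x) h))) (at x)"
    if "x \<in> S" for x
    using Suc.prems that
    by (intro bounded_linear.has_derivative[OF assms(1)] differentiable_frechet) auto
  have "Ck_on k S (\<lambda>x. frechet_derivative (\<lambda>x. L (f x)) (at x) v)" for v
    by (subst Ck_on_cong[OF assms(2), of _ "\<lambda>x. L (frechet_derivative f (at x) v)"])
      (use Suc in \<open>auto simp: frechet_derivative_eq[OF der]\<close>)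
  then show ?case using der by (auto simp: differentiable_def)
qed

lemma Ck_on_add:
  assumes "open S" "Ck_on k S f" "Ck_on k S g"
  shows "Ck_on k S (\<lambda>x. f x + g x)"
  using assms(2,3)
proof (induction k arbitrary: f g)
  case 0
  then show ?case by (simp add: continuous_on_add)
next
  case (Suc k)
  have der: "((\<lambda>x. f x + g x) has_derivative
      (\<lambda>h. frechet_derivative f (at x) h + frechet_derivative g (at x) h)) (at x)"
    if "x \<in> S" for x
    using Suc.prems that by (intro has_derivative_add differentiable_frechet) auto
  have "Ck_on k S (\<lambda>x. frechet_derivative (\<lambda>x. f x + g x) (at x) v)" for v
    by (subst Ck_on_cong[OF assms(1),
          of _ "\<lambda>x. frechet_derivative f (at x) v + frechet_derivative g (at x) v"])
      (use Suc in \<open>auto simp: frechet_derivative_eq[OF der]\<close>)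
  then show ?case using der by (auto simp: differentiable_def)
qed

text \<open>
  Leibniz' rule expresses the derivative of a product by two products of the same kind, each with one
  factor that is a derivative and one undifferentiated factor; the induction therefore uses that
  \<open>C\<^sup>k\<^sup>+\<^sup>1\<close> maps are \<open>C\<^sup>k\<close>.
\<close>

lemma Ck_on_bilinear:
  assumes "bounded_bilinear B" "open S" "Ck_on k S f" "Ck_on k S g"
  shows "Ck_on k S (\<lambda>x. B (f x) (g x))"
  using assms(3,4)
proof (induction k arbitrary: f g)
  case 0
  then show ?case using assms(1) by (simp add: bounded_bilinear.continuous_on)
next
  case (Suc k)
  have der: "((\<lambda>x. B (f x) (g x)) has_derivative
      (\<lambda>h. B (f x) (frechet_derivative g (at x) h) + B (frechet_derivative f (at x) h) (g x))) (at x)"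
    if "x \<in> S" for x
    using Suc.prems that by (intro bounded_bilinear.FDERIV[OF assms(1)] differentiable_frechet) auto
  have "Ck_on k S (\<lambda>x. frechet_derivative (\<lambda>x. B (f x) (g x)) (at x) v)" for v
  proof (subst Ck_on_cong[OF assms(2)])
    show "Ck_on k S (\<lambda>x. B (f x) (frechet_derivative g (at x) v)
        + B (frechet_derivative f (at x) v) (g x))"
      using Suc.prems Ck_on_Suc_D[OF Suc.prems(1)] Ck_on_Suc_D[OF Suc.prems(2)]
      by (intro Ck_on_add Suc.IH assms(2)) auto
  qed (simp add: frechet_derivative_eq[OF der])
  then show ?case using der by (auto simp: differentiable_def)
qed

lemma Ck_on_sum:
  "open S \<Longrightarrow> finite I \<Longrightarrow> (\<And>i. i \<in> I \<Longrightarrow> Ck_on k S (f i)) \<Longrightarrow> Ck_on k S (\<lambda>x. \<Sum>i\<in>I. f i x)"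
  by (induction I rule: infinite_finite_induct) (auto simp: Ck_on_const Ck_on_add)

text \<open>
  The induction hypothesis applies to the directional derivatives of \<open>g\<close> in fixed directions only, so the
  derivative of \<open>g\<close> in the direction that the chain rule supplies is expanded in the basis.
\<close>

lemma (in orthonormal_basis) Ck_on_compose:
  fixes f :: "'b::real_normed_vector \<Rightarrow> 'e"
  assumes "open S" "open T" "f ` S \<subseteq> T" "Ck_on k T g" "Ck_on k S f"
  shows "Ck_on k S (\<lambda>x. g (f x))"
  using assms(4,5)
proof (induction k arbitrary: g)
  case 0
  then show ?case using assms(3) by (auto intro: continuous_on_compose2)
next
  case (Suc k)
  have diff: "f differentiable (at x)" "g differentiable (at (f x))" if "x \<in> S" for x
    using Suc.prems assms(3) that by auto
  have der: "((\<lambda>x. g (f x)) has_derivative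
      (\<lambda>h. frechet_derivative g (at (f x)) (frechet_derivative f (at x) h))) (at x)"
    if "x \<in> S" for x
    by (rule has_derivative_compose[OF diff[OF that, THEN differentiable_frechet]])
  have "Ck_on k S (\<lambda>x. frechet_derivative (\<lambda>x. g (f x)) (at x) v)" for v
  proof (subst Ck_on_cong[OF assms(1)])
    fix x assume "x \<in> S"
    then show "frechet_derivative (\<lambda>x. g (f x)) (at x) v =
      (\<Sum>e\<in>E. (frechet_derivative f (at x) v \<bullet> e) *\<^sub>R frechet_derivative g (at (f x)) e)"
      by (subst frechet_derivative_eq[OF der])
        (auto intro: linear_expansion linear_frechet_derivative diff)
  next
    have "Ck_on k S (\<lambda>x. frechet_derivative g (at (f x)) e)" for e
      using Suc.prems Ck_on_Suc_D[OF Suc.prems(2)] by (intro Suc.IH) auto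
    moreover have "Ck_on k S (\<lambda>x. frechet_derivative f (at x) v \<bullet> e)" for e
      using Suc.prems by (intro Ck_on_bounded_linear[OF bounded_linear_inner_left] assms(1)) auto
    ultimately show "Ck_on k S (\<lambda>x. \<Sum>e\<in>E. (frechet_derivative f (at x) v \<bullet> e) *\<^sub>R
        frechet_derivative g (at (f x)) e)"
      by (intro Ck_on_sum Ck_on_bilinear[OF bounded_bilinear_scaleR] assms(1) finite_basis)
  qed
  then show ?case using der by (auto simp: differentiable_def)
qed

lemma smooth_on_cong:
  "open S \<Longrightarrow> (\<And>x. x \<in> S \<Longrightarrow> f x = g x) \<Longrightarrow> smooth_on S f \<longleftrightarrow> smooth_on S g"
  unfolding smooth_on_def using Ck_on_cong by blast

lemma smooth_on_eqI:
  "open S \<Longrightarrow> smooth_on S g \<Longrightarrow> (\<And>x. x \<in> S \<Longrightarrow> f x = g x) \<Longrightarrow> smooth_on S f"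
  using smooth_on_cong by blast

lemma smooth_on_subset: "smooth_on S f \<Longrightarrow> T \<subseteq> S \<Longrightarrow> smooth_on T f"
  unfolding smooth_on_def using Ck_on_subset by blast

lemma smooth_on_Un:
  "open S \<Longrightarrow> open T \<Longrightarrow> smooth_on S f \<Longrightarrow> smooth_on T f \<Longrightarrow> smooth_on (S \<union> T) f"
  unfolding smooth_on_def using Ck_on_Un by blast

lemma smooth_on_const: "smooth_on S (\<lambda>x. c)"
  by (simp add: smooth_on_def Ck_on_const)

lemma smooth_on_bounded_linear:
  "bounded_linear L \<Longrightarrow> open S \<Longrightarrow> smooth_on S f \<Longrightarrow> smooth_on S (\<lambda>x. L (f x))"
  unfolding smooth_on_def using Ck_on_bounded_linear by blast

lemma smooth_on_add:
  "open S \<Longrightarrow> smooth_on S f \<Longrightarrow> smooth_on S g \<Longrightarrow> smooth_on S (\<lambda>x. f x + g x)"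
  unfolding smooth_on_def using Ck_on_add by blast

lemma smooth_on_bilinear:
  "bounded_bilinear B \<Longrightarrow> open S \<Longrightarrow> smooth_on S f \<Longrightarrow> smooth_on S g
    \<Longrightarrow> smooth_on S (\<lambda>x. B (f x) (g x))"
  unfolding smooth_on_def using Ck_on_bilinear by blast

lemmas smooth_on_scaleR = smooth_on_bilinear[OF bounded_bilinear_scaleR]
lemmas smooth_on_blinfun_apply = smooth_on_bilinear[OF bounded_bilinear_blinfun_apply]

lemma smooth_on_diff:
  fixes f g :: "'a::real_normed_vector \<Rightarrow> 'b::real_normed_vector"
  assumes "open S" "smooth_on S f" "smooth_on S g"
  shows "smooth_on S (\<lambda>x. f x - g x)"
  using smooth_on_add[OF assms(1,2) smooth_on_bounded_linear[OF
        bounded_linear_minus[OF bounded_linear_ident] assms(1,3)]] by simp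

lemma smooth_on_sum:
  "open S \<Longrightarrow> finite I \<Longrightarrow> (\<And>i. i \<in> I \<Longrightarrow> smooth_on S (f i)) \<Longrightarrow> smooth_on S (\<lambda>x. \<Sum>i\<in>I. f i x)"
  unfolding smooth_on_def using Ck_on_sum by blast

lemma smooth_on_ident: "smooth_on S (\<lambda>x. x)"
proof -
  have "Ck_on k S (\<lambda>x. x)" for k
    by (cases k) (auto simp: Ck_on_const frechet_derivative_ident)
  then show ?thesis by (simp add: smooth_on_def)
qed

lemma (in orthonormal_basis) smooth_on_compose:
  fixes f :: "'b::real_normed_vector \<Rightarrow> 'e"
  assumes "open S" "open T" "f ` S \<subseteq> T" "smooth_on T g" "smooth_on S f"
  shows "smooth_on S (\<lambda>x. g (f x))"
  using assms Ck_on_compose unfolding smooth_on_def by blast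

lemma smooth_on_differentiable: "smooth_on S f \<Longrightarrow> x \<in> S \<Longrightarrow> f differentiable (at x)"
  unfolding smooth_on_def by (metis Ck_on.simps(2))

lemma smooth_on_has_derivative:
  "smooth_on S f \<Longrightarrow> x \<in> S \<Longrightarrow> (f has_derivative frechet_derivative f (at x)) (at x)"
  using smooth_on_differentiable differentiable_frechet by blast

lemma smooth_on_frechet_const: "smooth_on S f \<Longrightarrow> smooth_on S (\<lambda>x. frechet_derivative f (at x) v)"
  unfolding smooth_on_def by (metis Ck_on.simps(2))

lemma (in orthonormal_basis) smooth_on_frechet_derivative:
  fixes f :: "'e \<Rightarrow> 'b::real_normed_vector"
  assumes "open S" "smooth_on S f" "smooth_on S g"
  shows "smooth_on S (\<lambda>x. frechet_derivative f (at x) (g x))"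
proof (subst smooth_on_cong[OF assms(1)])
  fix x assume "x \<in> S"
  then show "frechet_derivative f (at x) (g x)
      = (\<Sum>e\<in>E. (g x \<bullet> e) *\<^sub>R frechet_derivative f (at x) e)"
    using smooth_on_differentiable[OF assms(2)] by (intro linear_expansion linear_frechet_derivative)
next
  show "smooth_on S (\<lambda>x. \<Sum>e\<in>E. (g x \<bullet> e) *\<^sub>R frechet_derivative f (at x) e)"
    using assms
    by (intro smooth_on_sum smooth_on_scaleR smooth_on_frechet_const finite_basis
        smooth_on_bounded_linear[OF bounded_linear_inner_left])
qed

section \<open>Symmetry of second derivatives\<close>

lemma has_real_derivative_along_line:
  fixes f :: "'e::real_normed_vector \<Rightarrow> real"
  assumes "f differentiable (at (x + t *\<^sub>R u))"
  shows "((\<lambda>a. f (x + a *\<^sub>R u)) has_real_derivative frechet_derivative f (at (x + t *\<^sub>R u)) u) (at t)"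
proof -
  have "((\<lambda>a. x + a *\<^sub>R u) has_derivative (\<lambda>a. a *\<^sub>R u)) (at t)"
    by (auto intro!: derivative_eq_intros)
  from has_derivative_compose[OF this differentiable_frechet[OF assms]]
  show ?thesis
    using linear_scale[OF linear_frechet_derivative[OF assms]]
    by (simp add: has_field_derivative_def mult_commute_abs)
qed

text \<open>
  The second difference of \<open>f\<close> over the parallelogram spanned by \<open>s u\<close> and \<open>s v\<close> is \<open>s\<^sup>2\<close> times the mixed
  derivative at some nearby point, by two applications of the mean value theorem.
\<close>

lemma second_difference_approx:
  fixes f :: "'e::real_normed_vector \<Rightarrow> real" and u v :: 'e
  assumes S: "open S" "x \<in> S" and f: "smooth_on S f" and e: "e > 0"
  defines "L \<equiv> \<lambda>y. frechet_derivative (\<lambda>y. frechet_derivative f (at y) u) (at y) v"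
  shows "\<exists>d>0. \<forall>s. 0 < s \<longrightarrow> s < d \<longrightarrow>
    \<bar>f (x + s *\<^sub>R u + s *\<^sub>R v) - f (x + s *\<^sub>R u) - f (x + s *\<^sub>R v) + f x - s\<^sup>2 * L x\<bar> < e * s\<^sup>2"
proof -
  have "continuous_on S L"
    using smooth_on_frechet_const[OF smooth_on_frechet_const[OF f]]
    unfolding L_def smooth_on_def by (metis Ck_on.simps(1))
  then have "isCont L x" using S by (simp add: continuous_on_eq_continuous_at)
  then obtain d1 where d1: "d1 > 0" "\<And>y. dist y x < d1 \<Longrightarrow> dist (L y) (L x) < e"
    using e unfolding continuous_at_eps_delta by blast
  obtain d2 where d2: "d2 > 0" "ball x d2 \<subseteq> S" using S openE by blast
  define n where "n = norm u + norm v + 1"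
  have n: "n > 0" by (simp add: n_def add_nonneg_pos)
  \<comment> \<open>Small enough that the parallelogram stays where \<open>f\<close> is smooth and its mixed derivative varies by less than \<open>e\<close>.\<close>
  define d where "d = min d1 d2 / n"
  have "d > 0" using d1 d2 n by (simp add: d_def)
  moreover have "\<bar>f (x + s *\<^sub>R u + s *\<^sub>R v) - f (x + s *\<^sub>R u) - f (x + s *\<^sub>R v) + f x - s\<^sup>2 * L x\<bar>
      < e * s\<^sup>2" if s: "0 < s" "s < d" for s
  proof -
    have near: "dist (x + a *\<^sub>R u + b *\<^sub>R v) x < min d1 d2" if "0 \<le> a" "a \<le> s" "0 \<le> b" "b \<le> s" for a b
    proof -
      have "norm (a *\<^sub>R u + b *\<^sub>R v) \<le> a * norm u + b * norm v"
        using that by (metis abs_of_nonneg norm_scaleR norm_triangle_ineq)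
      also have "\<dots> \<le> s * norm u + s * norm v"
        using that by (intro add_mono mult_right_mono) auto
      also have "\<dots> < s * n" using s by (simp add: n_def algebra_simps)
      also have "\<dots> < d * n" using s n by simp
      also have "\<dots> = min d1 d2" using n by (simp add: d_def)
      finally show ?thesis by (simp add: dist_norm add.assoc)
    qed
    then have inS: "x + a *\<^sub>R u + b *\<^sub>R v \<in> S" if "0 \<le> a" "a \<le> s" "0 \<le> b" "b \<le> s" for a b
      using d2(2) that by (metis dist_commute mem_ball min_less_iff_conj subsetD)
    let ?g = "\<lambda>a. f (x + s *\<^sub>R v + a *\<^sub>R u) - f (x + a *\<^sub>R u)"
    let ?g' = "\<lambda>a. frechet_derivative f (at (x + s *\<^sub>R v + a *\<^sub>R u)) u
                 - frechet_derivative f (at (x + a *\<^sub>R u)) u"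
    have "(?g has_real_derivative ?g' a) (at a)" if "0 \<le> a" "a \<le> s" for a
      using inS[of a s] inS[of a 0] that s
      by (intro DERIV_diff has_real_derivative_along_line smooth_on_differentiable[OF f])
        (simp_all add: add_ac)
    \<comment> \<open>The mean value theorem in the direction \<open>u\<close>.\<close>
    from MVT2[OF \<open>0 < s\<close> this] obtain a where a: "0 < a" "a < s" "?g s - ?g 0 = s * ?g' a"
      by auto
    let ?h = "\<lambda>b. frechet_derivative f (at (x + a *\<^sub>R u + b *\<^sub>R v)) u"
    have "(?h has_real_derivative L (x + a *\<^sub>R u + b *\<^sub>R v)) (at b)" if "0 \<le> b" "b \<le> s" for b
      unfolding L_def
      using inS[of a b] that a
      by (intro has_real_derivative_along_line smooth_on_differentiable[OF smooth_on_frechet_const[OF f]])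
        simp_all
    \<comment> \<open>The mean value theorem for the derivative along \<open>u\<close>, now in the direction \<open>v\<close>.\<close>
    from MVT2[OF \<open>0 < s\<close> this] obtain b where b: "0 < b" "b < s"
      "?h s - ?h 0 = s * L (x + a *\<^sub>R u + b *\<^sub>R v)" by auto
    have eq: "f (x + s *\<^sub>R u + s *\<^sub>R v) - f (x + s *\<^sub>R u) - f (x + s *\<^sub>R v) + f x
        = s\<^sup>2 * L (x + a *\<^sub>R u + b *\<^sub>R v)"
      using a(3) b(3) by (simp add: add_ac power2_eq_square)
    have "\<bar>L (x + a *\<^sub>R u + b *\<^sub>R v) - L x\<bar> < e"
      using d1(2)[of "x + a *\<^sub>R u + b *\<^sub>R v"] near[of a b] a b by (simp add: dist_real_def)
    then have "s\<^sup>2 * \<bar>L (x + a *\<^sub>R u + b *\<^sub>R v) - L x\<bar> < s\<^sup>2 * e" using s by simp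
    then show ?thesis
      unfolding eq right_diff_distrib[symmetric] abs_mult by (simp add: mult.commute)
  qed
  ultimately show ?thesis by blast
qed

text \<open>
  The second difference is symmetric in \<open>u\<close> and \<open>v\<close>, hence so is its limit after division by \<open>s\<^sup>2\<close>.
\<close>

lemma second_derivative_symmetric_real:
  fixes f :: "'e::real_normed_vector \<Rightarrow> real"
  assumes S: "open S" "x \<in> S" and f: "smooth_on S f"
  shows "frechet_derivative (\<lambda>y. frechet_derivative f (at y) u) (at x) v
       = frechet_derivative (\<lambda>y. frechet_derivative f (at y) v) (at x) u" (is "?L = ?R")
proof (rule ccontr)
  assume "?L \<noteq> ?R"
  then have e: "\<bar>?L - ?R\<bar> / 2 > 0" (is "?e > 0") by simp
  obtain d1 where d1: "d1 > 0" "\<And>s. 0 < s \<Longrightarrow> s < d1 \<Longrightarrow>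
    \<bar>f (x + s *\<^sub>R u + s *\<^sub>R v) - f (x + s *\<^sub>R u) - f (x + s *\<^sub>R v) + f x - s\<^sup>2 * ?L\<bar> < ?e * s\<^sup>2"
    using second_difference_approx[OF S f e, of u v] by auto
  obtain d2 where d2: "d2 > 0" "\<And>s. 0 < s \<Longrightarrow> s < d2 \<Longrightarrow>
    \<bar>f (x + s *\<^sub>R v + s *\<^sub>R u) - f (x + s *\<^sub>R v) - f (x + s *\<^sub>R u) + f x - s\<^sup>2 * ?R\<bar> < ?e * s\<^sup>2"
    using second_difference_approx[OF S f e, of v u] by auto
  define s where "s = min d1 d2 / 2"
  have s: "0 < s" "s < d1" "s < d2" using d1(1) d2(1) by (auto simp: s_def min_def)
  have "\<bar>s\<^sup>2 * ?L - s\<^sup>2 * ?R\<bar> < 2 * (?e * s\<^sup>2)"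
    using d1(2)[OF s(1,2)] d2(2)[OF s(1,3)] by (simp add: add_ac abs_if split: if_splits)
  then have "s\<^sup>2 * \<bar>?L - ?R\<bar> < s\<^sup>2 * \<bar>?L - ?R\<bar>"
    by (simp add: abs_mult right_diff_distrib[symmetric] mult.commute)
  then show False by simp
qed

lemma frechet_derivative_inner:
  fixes f :: "'a::real_normed_vector \<Rightarrow> 'e::real_inner"
  assumes "f differentiable (at x)"
  shows "frechet_derivative (\<lambda>y. f y \<bullet> e) (at x) v = frechet_derivative f (at x) v \<bullet> e"
  by (rule frechet_derivative_eq[THEN fun_cong, OF bounded_linear.has_derivative[OF
        bounded_linear_inner_left differentiable_frechet[OF assms]]])

lemma second_derivative_symmetric:
  fixes f :: "'a::real_normed_vector \<Rightarrow> 'e::real_inner"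
  assumes S: "open S" "x \<in> S" and f: "smooth_on S f"
  shows "frechet_derivative (\<lambda>y. frechet_derivative f (at y) u) (at x) v
       = frechet_derivative (\<lambda>y. frechet_derivative f (at y) v) (at x) u" (is "?L = ?R")
proof -
  have swap: "frechet_derivative (\<lambda>y. frechet_derivative f (at y) u) (at x) v \<bullet> e
      = frechet_derivative (\<lambda>y. frechet_derivative (\<lambda>y. f y \<bullet> e) (at y) u) (at x) v" for e u v
  proof -
    have "frechet_derivative (\<lambda>y. frechet_derivative (\<lambda>y. f y \<bullet> e) (at y) u) (at x)
        = frechet_derivative (\<lambda>y. frechet_derivative f (at y) u \<bullet> e) (at x)"
      by (rule frechet_derivative_cong_open[OF S])
        (simp add: frechet_derivative_inner smooth_on_differentiable[OF f])
    then show ?thesis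
      by (simp add: frechet_derivative_inner S smooth_on_differentiable[OF smooth_on_frechet_const[OF f]])
  qed
  have "smooth_on S (\<lambda>y. f y \<bullet> e)" for e
    by (rule smooth_on_bounded_linear[OF bounded_linear_inner_left S(1) f])
  then have "?L \<bullet> e = ?R \<bullet> e" for e
    unfolding swap by (rule second_derivative_symmetric_real[OF S])
  then have "(?L - ?R) \<bullet> (?L - ?R) = 0" by (simp add: inner_diff_left)
  then show ?thesis by simp
qed


section \<open>Smooth bump functions\<close>

text \<open>
  This makes the composition lemmas available for real-valued inner maps.
\<close>

interpretation real_basis: orthonormal_basis "{1::real}"
  by unfold_locales (auto simp: span_singleton)

text \<open>
  The case \<open>n = 0\<close> is the standard smooth function that is flat at \<open>0\<close>. The powers of the inverse are
  included because the derivatives of these functions are combinations of functions of the same family.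
\<close>

definition flat_exp :: "nat \<Rightarrow> real \<Rightarrow> real" where
  "flat_exp n t = (if t > 0 then exp (- inverse t) * inverse t ^ n else 0)"

lemma flat_exp_tendsto_0: "(flat_exp n \<longlongrightarrow> 0) (at_right 0)"
proof -
  have "((\<lambda>y::real. y ^ n / exp y) \<longlongrightarrow> 0) at_top" by (rule tendsto_power_div_exp_0)
  then have "((\<lambda>t::real. inverse t ^ n / exp (inverse t)) \<longlongrightarrow> 0) (at_right 0)"
    by (rule filterlim_compose[OF _ filterlim_inverse_at_top_right])
  moreover have "\<forall>\<^sub>F t in at_right (0::real). inverse t ^ n / exp (inverse t) = flat_exp n t"
    by (rule eventually_mono[OF eventually_at_right_less])
      (simp add: flat_exp_def exp_minus divide_inverse mult.commute)
  ultimately show ?thesis by (rule Lim_transform_eventually)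
qed

lemma flat_exp_has_derivative:
  "(flat_exp n has_real_derivative flat_exp (n + 2) t - of_nat n * flat_exp (n + 1) t) (at t)"
proof (cases t "0::real" rule: linorder_cases)
  case less
  have "((\<lambda>t. 0) has_real_derivative 0) (at t)" by simp
  then have "(flat_exp n has_real_derivative 0) (at t)"
    by (rule has_field_derivative_transform_within_open[where S = "{..<0}"])
      (use less in \<open>auto simp: flat_exp_def\<close>)
  then show ?thesis using less by (simp add: flat_exp_def)
next
  case equal
  have "((\<lambda>h. flat_exp n h / h) \<longlongrightarrow> 0) (at_right 0)"
  proof (rule Lim_transform_eventually[OF flat_exp_tendsto_0[of "Suc n"]])
    show "\<forall>\<^sub>F t in at_right 0. flat_exp (Suc n) t = flat_exp n t / t"
      by (rule eventually_mono[OF eventually_at_right_less]) (auto simp: flat_exp_def divide_inverse)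
  qed
  moreover have "((\<lambda>h. flat_exp n h / h) \<longlongrightarrow> 0) (at_left 0)"
  proof (rule Lim_transform_eventually[OF tendsto_const])
    show "\<forall>\<^sub>F t in at_left 0. 0 = flat_exp n t / t"
      by (simp add: eventually_at_filter flat_exp_def)
  qed
  ultimately have "((\<lambda>h. flat_exp n h / h) \<longlongrightarrow> 0) (at 0)"
    using filterlim_split_at by blast
  then show ?thesis using equal by (simp add: DERIV_def flat_exp_def)
next
  case greater
  have "((\<lambda>t. exp (- inverse t) * inverse t ^ n) has_real_derivative
      flat_exp (n + 2) t - of_nat n * flat_exp (n + 1) t) (at t)"
  proof -
    have "(inverse has_real_derivative - (inverse t * inverse t)) (at t)"
      using DERIV_inverse[of t UNIV] greater by simp
    note inv = this
    have "((\<lambda>t. exp (- inverse t)) has_real_derivative exp (- inverse t) * (inverse t * inverse t)) (at t)"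
      using DERIV_fun_exp[OF DERIV_minus[OF inv]] by simp
    moreover have "((\<lambda>t. inverse t ^ n) has_real_derivative - of_nat n * inverse t ^ (n + 1)) (at t)"
      by (rule DERIV_cong[OF DERIV_power[OF inv]], cases n) (simp_all add: algebra_simps)
    ultimately have "((\<lambda>t. exp (- inverse t) * inverse t ^ n) has_real_derivative
        exp (- inverse t) * (inverse t * inverse t) * inverse t ^ n
        + (- of_nat n * inverse t ^ (n + 1)) * exp (- inverse t)) (at t)"
      by (rule DERIV_mult)
    then show ?thesis
      by (rule DERIV_cong) (simp add: flat_exp_def greater algebra_simps)
  qed
  then show ?thesis
    by (rule has_field_derivative_transform_within_open[where S = "{0<..}"])
      (use greater in \<open>auto simp: flat_exp_def\<close>)
qed

lemma smooth_on_flat_exp: "smooth_on UNIV (flat_exp n)"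
proof -
  have "Ck_on k UNIV (flat_exp n)" for k
  proof (induction k arbitrary: n)
    case 0
    show ?case
      using flat_exp_has_derivative[of n] by (auto intro!: DERIV_isCont simp: continuous_on_eq_continuous_at)
  next
    case (Suc k)
    have "frechet_derivative (flat_exp n) (at t) v
        = v *\<^sub>R (flat_exp (n + 2) t + (- real n) *\<^sub>R flat_exp (n + 1) t)" for t v
      using flat_exp_has_derivative[of n t]
      by (simp add: has_field_derivative_def frechet_derivative_eq mult.commute)
    moreover have "flat_exp n differentiable (at t)" for t
      using flat_exp_has_derivative[of n t] by (auto simp: has_field_derivative_def differentiable_def)
    moreover have "Ck_on k UNIV (\<lambda>t. v *\<^sub>R (flat_exp (n + 2) t + (- real n) *\<^sub>R flat_exp (n + 1) t))" for v
      by (intro Ck_on_bounded_linear[OF bounded_linear_scaleR_right] Ck_on_add Suc.IH open_UNIV)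
    ultimately show ?case by simp
  qed
  then show ?thesis by (simp add: smooth_on_def)
qed

text \<open>
  The function is the flat exponential of \<open>r\<^sup>2 - |x - x0|\<^sup>2\<close>, normalised at the centre, where it has a
  critical point. The critical point is what later
  keeps the cutoff from contributing to second derivatives.
\<close>

lemma bump_function_exists:
  fixes x0 :: "'e::real_inner"
  assumes "r > 0"
  shows "\<exists>\<beta>::'e \<Rightarrow> real. smooth_on UNIV \<beta> \<and> \<beta> x0 = 1 \<and> (\<forall>x. x \<notin> cball x0 r \<longrightarrow> \<beta> x = 0) \<and>
    (\<forall>v. frechet_derivative \<beta> (at x0) v = 0)"
proof -
  define q where "q = (\<lambda>x. r\<^sup>2 - (x - x0) \<bullet> (x - x0))"
  define \<beta> where "\<beta> = (\<lambda>x. inverse (flat_exp 0 (r\<^sup>2)) *\<^sub>R flat_exp 0 (q x))"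
  have "smooth_on UNIV q"
    unfolding q_def
    by (intro smooth_on_diff smooth_on_const smooth_on_ident smooth_on_bilinear[OF bounded_bilinear_inner])
      auto
  then have "smooth_on UNIV (\<lambda>x. flat_exp 0 (q x))"
    by (intro real_basis.smooth_on_compose[OF _ _ _ smooth_on_flat_exp]) auto
  then have "smooth_on UNIV \<beta>"
    unfolding \<beta>_def by (intro smooth_on_bounded_linear[OF bounded_linear_scaleR_right]) auto
  moreover have "\<beta> x0 = 1" using assms by (simp add: \<beta>_def q_def flat_exp_def)
  moreover have "\<beta> x = 0" if "x \<notin> cball x0 r" for x
  proof -
    have "r < norm (x - x0)" using that by (simp add: dist_norm norm_minus_commute)
    then have "r\<^sup>2 < (norm (x - x0))\<^sup>2" using assms by (intro power_strict_mono) auto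
    then show ?thesis by (simp add: \<beta>_def q_def flat_exp_def dot_square_norm)
  qed
  moreover have "frechet_derivative \<beta> (at x0) v = 0" for v
  proof -
    have "(q has_derivative (\<lambda>h. 0)) (at x0)"
      unfolding q_def by (auto intro!: derivative_eq_intros)
    moreover have "(flat_exp 0 has_derivative frechet_derivative (flat_exp 0) (at (q x0))) (at (q x0))"
      by (rule smooth_on_has_derivative[OF smooth_on_flat_exp]) simp
    ultimately have "((\<lambda>x. flat_exp 0 (q x)) has_derivative
        (\<lambda>h. frechet_derivative (flat_exp 0) (at (q x0)) 0)) (at x0)"
      by (rule has_derivative_compose)
    moreover have "frechet_derivative (flat_exp 0) (at (q x0)) 0 = 0"
      by (intro linear_0 linear_frechet_derivative smooth_on_differentiable[OF smooth_on_flat_exp]) simp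
    ultimately have "((\<lambda>x. flat_exp 0 (q x)) has_derivative (\<lambda>h. 0)) (at x0)" by simp
    from has_derivative_scaleR_right[OF this, of "inverse (flat_exp 0 (r\<^sup>2))"]
    show ?thesis by (simp add: \<beta>_def frechet_derivative_eq)
  qed
  ultimately show ?thesis by blast
qed

section \<open>Smooth families of linear maps\<close>

text \<open>
  The transpose of \<open>g\<close>, as a bounded linear map between dual spaces.
\<close>

definition pullback :: "('e::real_normed_vector \<Rightarrow>\<^sub>L 'f::real_normed_vector) \<Rightarrow>
    ('f \<Rightarrow>\<^sub>L real) \<Rightarrow>\<^sub>L ('e \<Rightarrow>\<^sub>L real)" where
  "pullback g = Blinfun (\<lambda>\<alpha>. \<alpha> o\<^sub>L g)"

lemma pullback_apply [simp]: "blinfun_apply (pullback g) \<alpha> = \<alpha> o\<^sub>L g"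
  unfolding pullback_def
  by (subst bounded_linear_Blinfun_apply)
    (rule bounded_bilinear.bounded_linear_left[OF bounded_bilinear_blinfun_compose], rule refl)

lemma blinfun_compose_id_right [simp]: "\<alpha> o\<^sub>L id_blinfun = \<alpha>"
  by (rule blinfun_eqI) simp

lemma linear_blinfun: "linear (blinfun_apply f)"
  by (simp add: bounded_linear.linear blinfun.bounded_linear_right)

lemma bounded_linear_rank_one: "bounded_linear (\<lambda>b. blinfun_scaleR_left b o\<^sub>L \<alpha>)"
  by (intro bounded_linear_compose[OF bounded_bilinear.bounded_linear_left[OF
          bounded_bilinear_blinfun_compose] bounded_linear_blinfun_scaleR_left])

context orthonormal_basis
begin

text \<open>
  A family of operators is smooth in the operator norm once it is smooth at each fixed argument. The tensor
  fields are given by such pointwise conditions, whereas the product rule for operator-valued maps needs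
  the norm version.
\<close>

lemma smooth_on_blinfun:
  fixes F :: "'x::real_normed_vector \<Rightarrow> 'e \<Rightarrow>\<^sub>L 'b::real_normed_vector"
  assumes "open S" "\<And>v. smooth_on S (\<lambda>x. F x v)"
  shows "smooth_on S F"
proof -
  have "F x = (\<Sum>e\<in>E. blinfun_scaleR_left (F x e) o\<^sub>L blinfun_inner_left e)" for x
  proof (rule blinfun_eqI)
    fix v
    show "F x v = (\<Sum>e\<in>E. blinfun_scaleR_left (F x e) o\<^sub>L blinfun_inner_left e) v"
      by (subst linear_expansion[OF linear_blinfun, of "F x" v])
        (simp add: blinfun.sum_left blinfun_inner_left.rep_eq)
  qed
  then have "F = (\<lambda>x. \<Sum>e\<in>E. blinfun_scaleR_left (F x e) o\<^sub>L blinfun_inner_left e)" by blast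
  moreover have "smooth_on S (\<lambda>x. \<Sum>e\<in>E. blinfun_scaleR_left (F x e) o\<^sub>L blinfun_inner_left e)"
    by (intro smooth_on_sum assms finite_basis smooth_on_bounded_linear[OF bounded_linear_rank_one])
  ultimately show ?thesis by simp
qed

text \<open>
  The same for operators on the dual space, with the dual basis in place of the basis.
\<close>

lemma smooth_on_blinfun_covector:
  fixes F :: "'x::real_normed_vector \<Rightarrow> ('e \<Rightarrow>\<^sub>L real) \<Rightarrow>\<^sub>L 'b::real_normed_vector"
  assumes "open S" "\<And>\<alpha>. smooth_on S (\<lambda>x. F x \<alpha>)"
  shows "smooth_on S F"
proof -
  define ev :: "'e \<Rightarrow> ('e \<Rightarrow>\<^sub>L real) \<Rightarrow>\<^sub>L real" where "ev = (\<lambda>e. Blinfun (\<lambda>\<alpha>. blinfun_apply \<alpha> e))"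
  have ev: "blinfun_apply (ev e) \<alpha> = blinfun_apply \<alpha> e" for e \<alpha>
    unfolding ev_def by (simp add: bounded_linear_Blinfun_apply blinfun.bounded_linear_left)
  have "F x = (\<Sum>e\<in>E. blinfun_scaleR_left (F x (blinfun_inner_left e)) o\<^sub>L ev e)" for x
  proof (rule blinfun_eqI)
    fix \<alpha>
    show "F x \<alpha> = (\<Sum>e\<in>E. blinfun_scaleR_left (F x (blinfun_inner_left e)) o\<^sub>L ev e) \<alpha>"
      by (subst covector_linear_expansion[OF linear_blinfun, of "F x" \<alpha>])
        (simp add: blinfun.sum_left ev)
  qed
  then have "F = (\<lambda>x. \<Sum>e\<in>E. blinfun_scaleR_left (F x (blinfun_inner_left e)) o\<^sub>L ev e)" by blast
  moreover have "smooth_on S (\<lambda>x. \<Sum>e\<in>E. blinfun_scaleR_left (F x (blinfun_inner_left e)) o\<^sub>L ev e)"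
    by (intro smooth_on_sum assms finite_basis smooth_on_bounded_linear[OF bounded_linear_rank_one])
  ultimately show ?thesis by simp
qed

lemma smooth_on_inner_components:
  fixes f :: "'x::real_normed_vector \<Rightarrow> 'e"
  assumes "open S" "\<And>\<alpha> :: 'e \<Rightarrow>\<^sub>L real. smooth_on S (\<lambda>x. \<alpha> (f x))"
  shows "smooth_on S f"
proof -
  have "f = (\<lambda>x. \<Sum>e\<in>E. (f x \<bullet> e) *\<^sub>R e)" using expansion by blast
  moreover have "smooth_on S (\<lambda>x. \<Sum>e\<in>E. (f x \<bullet> e) *\<^sub>R e)"
    using assms(2)[of "blinfun_inner_left _"]
    by (intro smooth_on_sum smooth_on_scaleR assms smooth_on_const finite_basis)
      (simp add: blinfun_inner_left.rep_eq)
  ultimately show ?thesis by simp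
qed

end

lemma frechet_derivative_blinfun_apply:
  assumes "F differentiable (at x)" "G differentiable (at x)"
  shows "frechet_derivative (\<lambda>y. blinfun_apply (F y) (G y)) (at x) h
    = blinfun_apply (F x) (frechet_derivative G (at x) h)
      + blinfun_apply (frechet_derivative F (at x) h) (G x)"
  by (rule frechet_derivative_eq[THEN fun_cong, OF bounded_bilinear.FDERIV[OF
        bounded_bilinear_blinfun_apply assms[THEN differentiable_frechet]]])

lemma frechet_derivative_blinfun_apply_const:
  assumes "F differentiable (at x)"
  shows "frechet_derivative (\<lambda>y. blinfun_apply (F y) v) (at x) h
    = blinfun_apply (frechet_derivative F (at x) h) v"
  using frechet_derivative_blinfun_apply[OF assms differentiable_const[of v]]
  by (simp add: blinfun.bilinear_simps)


section \<open>Charts and coordinate changes\<close>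

text \<open>
  The orthonormal basis is an auxiliary choice, on which none of the notions for the atlas depend.
\<close>

locale smooth_manifold = orthonormal_basis E
  for E :: "'e::real_inner set" +
  fixes A :: "('a::{t2_space,second_countable_topology}, 'e) atlas"
  assumes atlas: "smooth_atlas A"
begin

abbreviation overlap :: "('a, 'e) chart \<Rightarrow> ('a, 'e) chart \<Rightarrow> 'e set" where
  "overlap c d \<equiv> snd c ` (fst c \<inter> fst d)"

abbreviation transition :: "('a, 'e) chart \<Rightarrow> ('a, 'e) chart \<Rightarrow> 'e \<Rightarrow> 'e" where
  "transition c d \<equiv> snd d \<circ> chart_inv c"

text \<open>
  The Jacobian is kept as an operator-valued function on the chart image, so that it can be differentiated
  again; the coordinate maps of the preferred charts are instances of it.
\<close>

definition jacobian :: "('a, 'e) chart \<Rightarrow> ('a, 'e) chart \<Rightarrow> 'e \<Rightarrow> 'e \<Rightarrow>\<^sub>L 'e" where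
  "jacobian c d x = Blinfun (frechet_derivative (transition c d) (at x))"

lemma chart_at_mem: "chart_at A p \<in> A" "p \<in> fst (chart_at A p)"
proof -
  have "\<exists>c. c \<in> A \<and> p \<in> fst c" using atlas unfolding smooth_atlas_def by blast
  from someI_ex[OF this] show "chart_at A p \<in> A" "p \<in> fst (chart_at A p)"
    unfolding chart_at_def by auto
qed

lemma chart_homeomorphism:
  "c \<in> A \<Longrightarrow> homeomorphism (fst c) (snd c ` fst c) (snd c) (chart_inv c)"
  using atlas unfolding smooth_atlas_def by blast

lemma chart_open: "c \<in> A \<Longrightarrow> open (fst c)" "c \<in> A \<Longrightarrow> open (snd c ` fst c)"
  using atlas unfolding smooth_atlas_def by blast+

lemma chart_inv_chart: "c \<in> A \<Longrightarrow> p \<in> fst c \<Longrightarrow> chart_inv c (snd c p) = p"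
  using chart_homeomorphism by (simp add: homeomorphism_def)

lemma open_chart_image:
  assumes "c \<in> A" "open W"
  shows "open (snd c ` (W \<inter> fst c))"
proof -
  have "openin (top_of_set (fst c)) (W \<inter> fst c)"
    using assms by (metis inf_commute openin_open_Int)
  then have "openin (top_of_set (snd c ` fst c)) (snd c ` (W \<inter> fst c))"
    by (rule homeomorphism_imp_open_map[OF chart_homeomorphism[OF assms(1)]])
  then show ?thesis using chart_open[OF assms(1)] openin_open_trans by blast
qed

lemma open_overlap: "c \<in> A \<Longrightarrow> d \<in> A \<Longrightarrow> open (overlap c d)"
  using open_chart_image[of c "fst d"] chart_open by (simp add: inf_commute)

lemma smooth_transition: "c \<in> A \<Longrightarrow> d \<in> A \<Longrightarrow> smooth_on (overlap c d) (transition c d)"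
  using atlas unfolding smooth_atlas_def by blast

lemma transition_image: "c \<in> A \<Longrightarrow> d \<in> A \<Longrightarrow> transition c d ` overlap c d \<subseteq> overlap d c"
  by (auto simp: chart_inv_chart)

lemma transition_has_derivative:
  assumes "c \<in> A" "d \<in> A" "p \<in> fst c" "p \<in> fst d"
  shows "(transition c d has_derivative blinfun_apply (jacobian c d (snd c p))) (at (snd c p))"
proof -
  have *: "(transition c d has_derivative frechet_derivative (transition c d) (at (snd c p))) (at (snd c p))"
    using assms by (intro smooth_on_has_derivative[OF smooth_transition]) auto
  then have "blinfun_apply (jacobian c d (snd c p)) = frechet_derivative (transition c d) (at (snd c p))"
    unfolding jacobian_def by (intro bounded_linear_Blinfun_apply has_derivative_bounded_linear)
  with * show ?thesis by simp
qed

lemma jacobian_apply: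
  assumes "c \<in> A" "d \<in> A" "x \<in> overlap c d"
  shows "blinfun_apply (jacobian c d x) = frechet_derivative (transition c d) (at x)"
  using assms(3) frechet_derivative_eq[OF transition_has_derivative[OF assms(1,2)]] by force

lemma jacobian_chain:
  assumes "c \<in> A" "d \<in> A" "e \<in> A" "p \<in> fst c" "p \<in> fst d" "p \<in> fst e"
  shows "jacobian d e (snd d p) o\<^sub>L jacobian c d (snd c p) = jacobian c e (snd c p)"
proof -
  have at: "transition c d (snd c p) = snd d p" using assms by (simp add: chart_inv_chart)
  have "((\<lambda>x. transition d e (transition c d x)) has_derivative
      (\<lambda>h. jacobian d e (snd d p) (jacobian c d (snd c p) h))) (at (snd c p))"
    using has_derivative_compose[OF transition_has_derivative[OF assms(1,2,4,5)],
        unfolded at, OF transition_has_derivative[OF assms(2,3,5,6)]] .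
  moreover have "(transition c e has_derivative D) (at (snd c p)) \<longleftrightarrow>
      ((\<lambda>x. transition d e (transition c d x)) has_derivative D) (at (snd c p))" for D
  proof (rule has_derivative_cong_open)
    show "open (snd c ` ((fst d \<inter> fst e) \<inter> fst c))"
      by (intro open_chart_image open_Int chart_open assms)
    show "snd c p \<in> snd c ` ((fst d \<inter> fst e) \<inter> fst c)" using assms by auto
  qed (use assms in \<open>auto simp: chart_inv_chart\<close>)
  ultimately have "blinfun_apply (jacobian c e (snd c p))
      = (\<lambda>h. jacobian d e (snd d p) (jacobian c d (snd c p) h))"
    using transition_has_derivative[OF assms(1,3,4,6)] has_derivative_unique by blast
  then show ?thesis by (intro blinfun_eqI) simp
qed

lemma jacobian_self:
  assumes "c \<in> A" "p \<in> fst c"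
  shows "jacobian c c (snd c p) = id_blinfun"
proof -
  have "(transition c c has_derivative (\<lambda>h. h)) (at (snd c p)) \<longleftrightarrow>
      ((\<lambda>x. x) has_derivative (\<lambda>h. h)) (at (snd c p))"
    using assms by (intro has_derivative_cong_open[OF chart_open(2)[OF assms(1)]])
      (auto simp: chart_inv_chart)
  then have "blinfun_apply (jacobian c c (snd c p)) = (\<lambda>h. h)"
    using transition_has_derivative[OF assms(1,1,2,2)] has_derivative_unique has_derivative_ident
    by blast
  then show ?thesis by (intro blinfun_eqI) simp
qed

lemma smooth_jacobian:
  assumes "c \<in> A" "d \<in> A"
  shows "smooth_on (overlap c d) (jacobian c d)"
proof (rule smooth_on_blinfun[OF open_overlap[OF assms]])
  fix v
  show "smooth_on (overlap c d) (\<lambda>x. jacobian c d x v)"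
    using smooth_on_frechet_const[OF smooth_transition[OF assms]]
    by (subst smooth_on_cong[OF open_overlap[OF assms]]) (auto simp: jacobian_apply[OF assms])
qed

text \<open>
  This is the only place where second derivatives of coordinate changes are compared; it makes the Lie
  bracket and the exterior derivative independent of the chart.
\<close>

lemma jacobian_derivative_symmetric:
  assumes "c \<in> A" "d \<in> A" "x \<in> overlap c d"
  shows "blinfun_apply (frechet_derivative (jacobian c d) (at x) h) k
       = blinfun_apply (frechet_derivative (jacobian c d) (at x) k) h"
proof -
  note O = open_overlap[OF assms(1,2)]
  have "blinfun_apply (frechet_derivative (jacobian c d) (at x) h) k
      = frechet_derivative (\<lambda>y. frechet_derivative (transition c d) (at y) k) (at x) h" for h k
  proof -
    have "blinfun_apply (frechet_derivative (jacobian c d) (at x) h) k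
        = frechet_derivative (\<lambda>y. jacobian c d y k) (at x) h"
      using smooth_on_differentiable[OF smooth_jacobian assms(3)] assms
      by (simp add: frechet_derivative_blinfun_apply_const)
    also have "frechet_derivative (\<lambda>y. jacobian c d y k) (at x)
        = frechet_derivative (\<lambda>y. frechet_derivative (transition c d) (at y) k) (at x)"
      by (rule frechet_derivative_cong_open[OF O assms(3)]) (simp add: jacobian_apply assms)
    finally show ?thesis .
  qed
  then show ?thesis
    using second_derivative_symmetric[OF O assms(3) smooth_transition[OF assms(1,2)]] by simp
qed


section \<open>Coordinate representatives\<close>

lemma to_coords_jacobian: "to_coords A c p = jacobian (chart_at A p) c (snd (chart_at A p) p)"
  by (simp add: to_coords_def jacobian_def)

lemma from_coords_jacobian: "from_coords A c p = jacobian c (chart_at A p) (snd c p)"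
  by (simp add: from_coords_def jacobian_def)

lemma to_from_coords:
  "c \<in> A \<Longrightarrow> d \<in> A \<Longrightarrow> p \<in> fst c \<Longrightarrow> p \<in> fst d \<Longrightarrow>
    to_coords A d p o\<^sub>L from_coords A c p = jacobian c d (snd c p)"
  by (simp add: to_coords_jacobian from_coords_jacobian jacobian_chain chart_at_mem)

lemma to_from_coords_apply:
  "c \<in> A \<Longrightarrow> p \<in> fst c \<Longrightarrow> to_coords A c p (from_coords A c p v) = v"
  using to_from_coords[of c c p] jacobian_self[of c p]
  by (metis blinfun_apply_blinfun_compose blinfun_apply_id_blinfun)

lemma from_to_coords:
  "c \<in> A \<Longrightarrow> p \<in> fst c \<Longrightarrow> from_coords A c p o\<^sub>L to_coords A c p = id_blinfun"
  by (simp add: to_coords_jacobian from_coords_jacobian jacobian_chain chart_at_mem jacobian_self)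

lemma from_to_coords_apply:
  "c \<in> A \<Longrightarrow> p \<in> fst c \<Longrightarrow> from_coords A c p (to_coords A c p v) = v"
  using from_to_coords[of c p] by (metis blinfun_apply_blinfun_compose blinfun_apply_id_blinfun)

lemma coords_chart_at [simp]:
  "to_coords A (chart_at A p) p = id_blinfun" "from_coords A (chart_at A p) p = id_blinfun"
  by (simp_all add: to_coords_jacobian from_coords_jacobian jacobian_self chart_at_mem)

text \<open>
  The coordinate expressions of a one-form, of the map \<open>\<omega>\<^sup>\<sharp> : TM \<rightarrow> T\<^sup>*M\<close> of a two-form and of the map
  \<open>\<pi>\<^sup>\<sharp> : T\<^sup>*M \<rightarrow> TM\<close> of a bivector field, as operator-valued functions on the image of the chart. (The name
  of the second one follows the usual musical notation for lowering indices.) Contractions of fields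
  then become applications of operators, to which the product rule applies.
\<close>

definition covector_rep :: "('a, 'e) chart \<Rightarrow> ('a \<Rightarrow> 'e \<Rightarrow>\<^sub>L real) \<Rightarrow> 'e \<Rightarrow> 'e \<Rightarrow>\<^sub>L real" where
  "covector_rep c \<xi> x = \<xi> (chart_inv c x) o\<^sub>L from_coords A c (chart_inv c x)"

definition flat_rep :: "('a, 'e) chart \<Rightarrow> ('a \<Rightarrow> 'e \<Rightarrow>\<^sub>L 'e \<Rightarrow>\<^sub>L real) \<Rightarrow> 'e \<Rightarrow> 'e \<Rightarrow>\<^sub>L 'e \<Rightarrow>\<^sub>L real" where
  "flat_rep c \<omega> x = pullback (from_coords A c (chart_inv c x)) o\<^sub>L \<omega> (chart_inv c x)
     o\<^sub>L from_coords A c (chart_inv c x)"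

definition sharp_rep :: "('a, 'e) chart \<Rightarrow> ('a \<Rightarrow> ('e \<Rightarrow>\<^sub>L real) \<Rightarrow>\<^sub>L ('e \<Rightarrow>\<^sub>L real) \<Rightarrow>\<^sub>L real) \<Rightarrow>
    'e \<Rightarrow> ('e \<Rightarrow>\<^sub>L real) \<Rightarrow>\<^sub>L 'e" where
  "sharp_rep c \<pi> x = to_coords A c (chart_inv c x) o\<^sub>L bisharp \<pi> (chart_inv c x)
     o\<^sub>L pullback (to_coords A c (chart_inv c x))"

lemma form1_rep_eq: "form1_rep A c \<xi> x v = covector_rep c \<xi> x v"
  by (simp add: form1_rep_def covector_rep_def Let_def)

lemma form2_rep_eq: "form2_rep A c \<omega> x v w = flat_rep c \<omega> x v w"
  by (simp add: form2_rep_def flat_rep_def Let_def)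

text \<open>
  By finite dimension every functional on covectors is evaluation at a unique vector.
\<close>

lemma bisharp_apply: "blinfun_apply \<eta> (bisharp \<pi> p \<xi>) = \<pi> p \<xi> \<eta>"
  for \<pi> :: "'a \<Rightarrow> ('e \<Rightarrow>\<^sub>L real) \<Rightarrow>\<^sub>L ('e \<Rightarrow>\<^sub>L real) \<Rightarrow>\<^sub>L real"
proof -
  define S where "S = (\<lambda>\<xi>. \<Sum>e\<in>E. \<pi> p \<xi> (blinfun_inner_left e) *\<^sub>R e)"
  have S: "blinfun_apply \<eta> (S \<xi>) = \<pi> p \<xi> \<eta>" for \<xi> \<eta>
    by (subst covector_linear_expansion[OF linear_blinfun, of "\<pi> p \<xi>" \<eta>])
      (simp add: S_def blinfun.sum_right blinfun.scaleR_right mult.commute)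
  have "(THE v. \<forall>\<eta>. blinfun_apply \<eta> v = \<pi> p \<xi> \<eta>) = S \<xi>" for \<xi>
  proof (rule the_equality)
    fix v assume v: "\<forall>\<eta>. blinfun_apply \<eta> v = \<pi> p \<xi> \<eta>"
    show "v = S \<xi>" by (rule covector_separates) (simp add: S v)
  qed (simp add: S)
  then have "bisharp \<pi> p = Blinfun S" by (simp add: bisharp_def)
  moreover have "bounded_linear S"
    by (intro bounded_linear_of_linear_covector linearI)
      (simp_all add: S_def blinfun.add_left blinfun.add_right blinfun.scaleR_left blinfun.scaleR_right
        scaleR_add_left sum.distrib scaleR_sum_right)
  ultimately show ?thesis using S by (simp add: bounded_linear_Blinfun_apply)
qed

lemma sharp_rep_apply: "blinfun_apply \<beta> (sharp_rep c \<pi> x \<alpha>) = bivector_rep A c \<pi> x \<alpha> \<beta>"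
proof -
  have "\<beta> (sharp_rep c \<pi> x \<alpha>) = (\<beta> o\<^sub>L to_coords A c (chart_inv c x))
      (bisharp \<pi> (chart_inv c x) (\<alpha> o\<^sub>L to_coords A c (chart_inv c x)))"
    by (simp add: sharp_rep_def)
  then show ?thesis by (simp only: bisharp_apply bivector_rep_def Let_def)
qed

lemma rep_chart_at:
  defines "x \<equiv> \<lambda>p. snd (chart_at A p) p"
  shows "vector_rep A (chart_at A p) u (x p) = u p"
    "covector_rep (chart_at A p) \<xi> (x p) = \<xi> p"
    "flat_rep (chart_at A p) \<omega> (x p) = \<omega> p"
    "sharp_rep (chart_at A p) \<pi> (x p) = bisharp \<pi> p"
  by (auto simp: x_def vector_rep_def covector_rep_def flat_rep_def sharp_rep_def Let_def
      chart_inv_chart chart_at_mem intro!: blinfun_eqI)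

lemma rep_contract:
  assumes "c \<in> A" "x \<in> snd c ` fst c"
  shows "covector_rep c \<xi> x (vector_rep A c u x) = fun_rep c (\<lambda>q. \<xi> q (u q)) x"
    "flat_rep c \<omega> x (vector_rep A c u x) = covector_rep c (\<lambda>q. \<omega> q (u q)) x"
    "sharp_rep c \<pi> x (covector_rep c \<xi> x) = vector_rep A c (\<lambda>q. bisharp \<pi> q (\<xi> q)) x"
proof -
  obtain p where p: "p \<in> fst c" "x = snd c p" using assms by auto
  show "covector_rep c \<xi> x (vector_rep A c u x) = fun_rep c (\<lambda>q. \<xi> q (u q)) x"
    "flat_rep c \<omega> x (vector_rep A c u x) = covector_rep c (\<lambda>q. \<omega> q (u q)) x"
    using assms p
    by (auto simp: covector_rep_def vector_rep_def flat_rep_def fun_rep_def Let_def chart_inv_chart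
        from_to_coords_apply intro!: blinfun_eqI)
  have "(\<xi> p o\<^sub>L from_coords A c p) o\<^sub>L to_coords A c p = \<xi> p"
    using assms p by (intro blinfun_eqI) (simp add: from_to_coords_apply)
  then show "sharp_rep c \<pi> x (covector_rep c \<xi> x) = vector_rep A c (\<lambda>q. bisharp \<pi> q (\<xi> q)) x"
    using assms p by (simp add: covector_rep_def vector_rep_def sharp_rep_def Let_def chart_inv_chart)
qed

lemma one_form_on_iff:
  assumes "open W"
  shows "one_form_on A W \<xi> \<longleftrightarrow> (\<forall>c\<in>A. smooth_on (snd c ` (W \<inter> fst c)) (covector_rep c \<xi>))"
  unfolding one_form_on_def form1_rep_eq
  using smooth_on_blinfun[OF open_chart_image[OF _ assms]]
    smooth_on_bounded_linear[OF blinfun.bounded_linear_left open_chart_image[OF _ assms]] by blast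

lemma smooth_covector_rep: "one_form A \<xi> \<Longrightarrow> c \<in> A \<Longrightarrow> smooth_on (snd c ` fst c) (covector_rep c \<xi>)"
  using one_form_on_iff[of UNIV \<xi>] by simp

lemma smooth_vector_rep: "vector_field A u \<Longrightarrow> c \<in> A \<Longrightarrow> smooth_on (snd c ` fst c) (vector_rep A c u)"
  unfolding vector_field_on_def by simp

lemma smooth_flat_rep:
  assumes "two_form A \<omega>" "c \<in> A"
  shows "smooth_on (snd c ` fst c) (flat_rep c \<omega>)"
  using assms unfolding two_form_def form2_rep_eq
  by (intro smooth_on_blinfun chart_open) auto

lemma smooth_sharp_rep:
  assumes "bivector_field A \<pi>" "c \<in> A"
  shows "smooth_on (snd c ` fst c) (sharp_rep c \<pi>)"
  using assms unfolding bivector_field_def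
  by (intro smooth_on_blinfun_covector smooth_on_inner_components chart_open)
    (auto simp: sharp_rep_apply)

lemma smooth_fun_contract:
  assumes "one_form A \<xi>" "vector_field A u"
  shows "smooth_fun A (\<lambda>q. \<xi> q (u q))"
  unfolding smooth_fun_def
proof
  fix c assume c: "c \<in> A"
  have "smooth_on (snd c ` fst c) (\<lambda>x. covector_rep c \<xi> x (vector_rep A c u x))"
    by (intro smooth_on_blinfun_apply chart_open smooth_covector_rep smooth_vector_rep assms c)
  then show "smooth_on (snd c ` fst c) (fun_rep c (\<lambda>q. \<xi> q (u q)))"
    by (subst (asm) smooth_on_cong[OF chart_open(2)[OF c]]) (simp_all add: rep_contract c)
qed

lemma one_form_flat_on:
  assumes "two_form A \<omega>" "open W" "vector_field_on A W u"
  shows "one_form_on A W (\<lambda>q. \<omega> q (u q))"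
  unfolding one_form_on_iff[OF assms(2)]
proof
  fix c assume c: "c \<in> A"
  have "smooth_on (snd c ` (W \<inter> fst c)) (\<lambda>x. flat_rep c \<omega> x (vector_rep A c u x))"
    using assms c
    by (intro smooth_on_blinfun_apply open_chart_image smooth_on_subset[OF smooth_flat_rep])
      (auto simp: vector_field_on_def)
  then show "smooth_on (snd c ` (W \<inter> fst c)) (covector_rep c (\<lambda>q. \<omega> q (u q)))"
    by (subst (asm) smooth_on_cong[OF open_chart_image[OF c assms(2)]])
      (auto simp: rep_contract[OF c] simp del: image_iff)
qed

lemma vector_field_sharp_on:
  assumes "bivector_field A \<pi>" "open W" "one_form_on A W \<xi>"
  shows "vector_field_on A W (\<lambda>q. bisharp \<pi> q (\<xi> q))"
  unfolding vector_field_on_def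
proof
  fix c assume c: "c \<in> A"
  have "smooth_on (snd c ` (W \<inter> fst c)) (\<lambda>x. sharp_rep c \<pi> x (covector_rep c \<xi> x))"
    using assms c
    by (intro smooth_on_blinfun_apply open_chart_image smooth_on_subset[OF smooth_sharp_rep])
      (auto simp: one_form_on_iff)
  then show "smooth_on (snd c ` (W \<inter> fst c)) (vector_rep A c (\<lambda>q. bisharp \<pi> q (\<xi> q)))"
    by (subst (asm) smooth_on_cong[OF open_chart_image[OF c assms(2)]])
      (auto simp: rep_contract[OF c] simp del: image_iff)
qed


section \<open>Coordinate invariance of the Cartan calculus\<close>

lemma vector_rep_change:
  assumes "c \<in> A" "d \<in> A" "x \<in> overlap c d"
  shows "vector_rep A d u (transition c d x) = jacobian c d x (vector_rep A c u x)"
proof -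
  obtain p where p: "p \<in> fst c" "p \<in> fst d" "x = snd c p" using assms by auto
  have "to_coords A d p = jacobian c d x o\<^sub>L to_coords A c p"
    using assms p by (simp add: to_coords_jacobian jacobian_chain chart_at_mem)
  then show ?thesis using assms p by (simp add: vector_rep_def Let_def chart_inv_chart)
qed

lemma covector_rep_change:
  assumes "c \<in> A" "d \<in> A" "x \<in> overlap c d"
  shows "covector_rep c \<xi> x = covector_rep d \<xi> (transition c d x) o\<^sub>L jacobian c d x"
proof -
  obtain p where p: "p \<in> fst c" "p \<in> fst d" "x = snd c p" using assms by auto
  have "from_coords A c p = from_coords A d p o\<^sub>L jacobian c d x"
    using assms p by (simp add: from_coords_jacobian jacobian_chain chart_at_mem)
  then show ?thesis
    using assms p by (intro blinfun_eqI) (simp add: covector_rep_def chart_inv_chart)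
qed

text \<open>
  Differentiating the transformation law produces, besides the transformed derivative, a term with
  the second derivative of the coordinate change. It is symmetric in \<open>h\<close> and the vector, and so cancels
  from the Lie bracket; likewise for one-forms and \<open>d\<close> below.
\<close>

lemma vector_rep_derivative_change:
  assumes cd: "c \<in> A" "d \<in> A" "x \<in> overlap c d" and u: "vector_field A u"
  shows "frechet_derivative (vector_rep A d u) (at (transition c d x)) (jacobian c d x h)
    = jacobian c d x (frechet_derivative (vector_rep A c u) (at x) h)
      + frechet_derivative (jacobian c d) (at x) h (vector_rep A c u x)"
proof -
  have y: "transition c d x \<in> snd d ` fst d" using transition_image[OF cd(1,2)] cd(3) by blast
  have "(transition c d has_derivative jacobian c d x) (at x)"
    using smooth_on_has_derivative[OF smooth_transition[OF cd(1,2)] cd(3)] jacobian_apply[OF cd] by simp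
  from has_derivative_compose[OF this smooth_on_has_derivative[OF smooth_vector_rep[OF u cd(2)] y]]
  have "frechet_derivative (vector_rep A d u) (at (transition c d x)) (jacobian c d x h)
    = frechet_derivative (\<lambda>x. vector_rep A d u (transition c d x)) (at x) h"
    by (subst frechet_derivative_eq) simp_all
  also have "\<dots> = frechet_derivative (\<lambda>x. jacobian c d x (vector_rep A c u x)) (at x) h"
    using vector_rep_change[OF cd(1,2)]
    by (subst frechet_derivative_cong_open[OF open_overlap[OF cd(1,2)] cd(3)]) auto
  also have "\<dots> = jacobian c d x (frechet_derivative (vector_rep A c u) (at x) h)
      + frechet_derivative (jacobian c d) (at x) h (vector_rep A c u x)"
    using cd(3)
    by (intro frechet_derivative_blinfun_apply smooth_on_differentiable[OF smooth_jacobian[OF cd(1,2)]]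
        smooth_on_differentiable[OF smooth_vector_rep[OF u cd(1)]]) auto
  finally show ?thesis .
qed

lemma covector_rep_derivative_change:
  assumes cd: "c \<in> A" "d \<in> A" "x \<in> overlap c d" and \<xi>: "one_form A \<xi>"
  shows "frechet_derivative (covector_rep c \<xi>) (at x) h w
    = frechet_derivative (covector_rep d \<xi>) (at (transition c d x)) (jacobian c d x h) (jacobian c d x w)
      + covector_rep d \<xi> (transition c d x) (frechet_derivative (jacobian c d) (at x) h w)"
proof -
  have y: "transition c d x \<in> snd d ` fst d" using transition_image[OF cd(1,2)] cd(3) by blast
  have "(transition c d has_derivative jacobian c d x) (at x)"
    using smooth_on_has_derivative[OF smooth_transition[OF cd(1,2)] cd(3)] jacobian_apply[OF cd] by simp
  from has_derivative_compose[OF this smooth_on_has_derivative[OF smooth_covector_rep[OF \<xi> cd(2)] y]]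
  have D: "((\<lambda>x. covector_rep d \<xi> (transition c d x)) has_derivative
      (\<lambda>h. frechet_derivative (covector_rep d \<xi>) (at (transition c d x)) (jacobian c d x h))) (at x)" .
  have "frechet_derivative (covector_rep c \<xi>) (at x) h
      = frechet_derivative (\<lambda>x. covector_rep d \<xi> (transition c d x) o\<^sub>L jacobian c d x) (at x) h"
    using covector_rep_change[OF cd(1,2)]
    by (subst frechet_derivative_cong_open[OF open_overlap[OF cd(1,2)] cd(3)]) auto
  also have "\<dots> = (covector_rep d \<xi> (transition c d x) o\<^sub>L frechet_derivative (jacobian c d) (at x) h)
      + (frechet_derivative (covector_rep d \<xi>) (at (transition c d x)) (jacobian c d x h) o\<^sub>L jacobian c d x)"
    by (rule frechet_derivative_eq[THEN fun_cong, OF bounded_bilinear.FDERIV[OF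
          bounded_bilinear_blinfun_compose D
          smooth_on_has_derivative[OF smooth_jacobian[OF cd(1,2)] cd(3)]]])
  finally show ?thesis by (simp add: blinfun.add_left)
qed

text \<open>
  The derivatives at \<open>p\<close> of the coordinate expressions in the preferred chart at \<open>p\<close>. The first argument
  of each of them after the point is the direction of differentiation.
\<close>

abbreviation dvec where
  "dvec u p \<equiv> pder A p (vector_rep A (chart_at A p) u)"

abbreviation dcov where
  "dcov \<xi> p \<equiv> pder A p (covector_rep (chart_at A p) \<xi>)"

abbreviation dflat where
  "dflat \<omega> p \<equiv> pder A p (flat_rep (chart_at A p) \<omega>)"

abbreviation dsharp where
  "dsharp \<pi> p \<equiv> pder A p (sharp_rep (chart_at A p) \<pi>)"

lemma chart_point: "snd (chart_at A p) p \<in> snd (chart_at A p) ` fst (chart_at A p)"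
  using chart_at_mem by blast

lemma chart_at_differentiable:
  "smooth_on (snd (chart_at A p) ` fst (chart_at A p)) F \<Longrightarrow> F differentiable (at (snd (chart_at A p) p))"
  by (rule smooth_on_differentiable[OF _ chart_point])

lemma linear_pder: "smooth_on (snd (chart_at A p) ` fst (chart_at A p)) F \<Longrightarrow> linear (pder A p F)"
  unfolding pder_def by (intro linear_frechet_derivative chart_at_differentiable)

lemmas linear_dcov = linear_pder[OF smooth_covector_rep[OF _ chart_at_mem(1)]]
lemmas linear_dflat = linear_pder[OF smooth_flat_rep[OF _ chart_at_mem(1)]]
lemmas linear_dsharp = linear_pder[OF smooth_sharp_rep[OF _ chart_at_mem(1)]]

lemma pder_cong:
  assumes "\<And>x. x \<in> snd (chart_at A p) ` fst (chart_at A p) \<Longrightarrow> F x = G x"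
  shows "pder A p F = pder A p G"
  unfolding pder_def
  by (rule frechet_derivative_cong_open[OF chart_open(2)[OF chart_at_mem(1)] chart_point assms])

lemma pder_blinfun_apply:
  assumes "smooth_on (snd (chart_at A p) ` fst (chart_at A p)) F"
    and "smooth_on (snd (chart_at A p) ` fst (chart_at A p)) G"
  shows "pder A p (\<lambda>x. blinfun_apply (F x) (G x)) h
    = blinfun_apply (F (snd (chart_at A p) p)) (pder A p G h)
      + blinfun_apply (pder A p F h) (G (snd (chart_at A p) p))"
  unfolding pder_def
  by (intro frechet_derivative_blinfun_apply chart_at_differentiable assms)

lemma pder_blinfun_apply_const:
  assumes "smooth_on (snd (chart_at A p) ` fst (chart_at A p)) F"
  shows "pder A p (\<lambda>x. blinfun_apply (F x) v) h = blinfun_apply (pder A p F h) v"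
  unfolding pder_def
  by (intro frechet_derivative_blinfun_apply_const chart_at_differentiable assms)

lemma d_form1_apply:
  assumes "one_form A \<xi>"
  shows "d_form1 A \<xi> p a b = dcov \<xi> p a b - dcov \<xi> p b a"
proof -
  have pd: "pder A p (\<lambda>x. form1_rep A (chart_at A p) \<xi> x w) v = dcov \<xi> p v w" for v w
    unfolding form1_rep_eq
    by (rule pder_blinfun_apply_const[OF smooth_covector_rep[OF assms chart_at_mem(1)]])
  note lin = linear_add[OF linear_dcov[OF assms]] linear_scale[OF linear_dcov[OF assms]]
  define F where "F = (\<lambda>v. Blinfun (\<lambda>w. dcov \<xi> p v w - dcov \<xi> p w v))"
  have F: "F v w = dcov \<xi> p v w - dcov \<xi> p w v" for v w
    unfolding F_def
    by (subst bounded_linear_Blinfun_apply, intro bounded_linear_of_linear linearI)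
      (simp_all add: lin blinfun.bilinear_simps algebra_simps)
  have "linear F"
    by (intro linearI blinfun_eqI) (simp_all add: F lin blinfun.bilinear_simps algebra_simps)
  then show ?thesis
    unfolding d_form1_def pd F_def[symmetric]
    by (simp add: bounded_linear_Blinfun_apply bounded_linear_of_linear F)
qed

lemma d_fun_apply:
  assumes "smooth_fun A f"
  shows "d_fun A f p v = pder A p (fun_rep (chart_at A p) f) v"
proof -
  have "linear (pder A p (fun_rep (chart_at A p) f))"
    using assms chart_at_mem(1) unfolding smooth_fun_def by (intro linear_pder) blast
  then show ?thesis
    unfolding d_fun_def by (simp add: bounded_linear_Blinfun_apply bounded_linear_of_linear)
qed

lemma lie_bracket_coords:
  assumes c: "c \<in> A" "p \<in> fst c" and uv: "vector_field A u" "vector_field A v"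
  shows "to_coords A c p (lie_bracket A u v p)
    = frechet_derivative (vector_rep A c v) (at (snd c p)) (vector_rep A c u (snd c p))
    - frechet_derivative (vector_rep A c u) (at (snd c p)) (vector_rep A c v (snd c p))"
proof -
  define d where "d = chart_at A p"
  define x where "x = snd c p"
  have d: "d \<in> A" "p \<in> fst d" by (simp_all add: d_def chart_at_mem)
  have x: "x \<in> overlap c d" using c d by (auto simp: x_def)
  have y: "transition c d x = snd d p" using c by (simp add: x_def chart_inv_chart)
  have at_p: "w p = jacobian c d x (vector_rep A c w x)" for w
    using vector_rep_change[OF c(1) d(1) x, of w] rep_chart_at(1)[of p w] y by (simp add: d_def)
  have der: "dvec w p (jacobian c d x h) = jacobian c d x (frechet_derivative (vector_rep A c w) (at x) h)
      + frechet_derivative (jacobian c d) (at x) h (vector_rep A c w x)" if "vector_field A w" for w h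
    using vector_rep_derivative_change[OF c(1) d(1) x that, of h] y by (simp add: pder_def d_def)
  have "lie_bracket A u v p = dvec v p (jacobian c d x (vector_rep A c u x))
      - dvec u p (jacobian c d x (vector_rep A c v x))"
    unfolding lie_bracket_def using at_p by metis
  also have "\<dots> = jacobian c d x (frechet_derivative (vector_rep A c v) (at x) (vector_rep A c u x)
      - frechet_derivative (vector_rep A c u) (at x) (vector_rep A c v x))"
    using jacobian_derivative_symmetric[OF c(1) d(1) x]
    by (simp add: der uv blinfun.diff_right)
  finally show ?thesis
    using to_from_coords_apply[OF c] by (simp add: from_coords_jacobian d_def x_def)
qed

lemma d_form1_coords:
  assumes c: "c \<in> A" "p \<in> fst c" and \<xi>: "one_form A \<xi>"
  shows "d_form1 A \<xi> p (from_coords A c p a) (from_coords A c p b)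
    = frechet_derivative (covector_rep c \<xi>) (at (snd c p)) a b
    - frechet_derivative (covector_rep c \<xi>) (at (snd c p)) b a"
proof -
  define d where "d = chart_at A p"
  define x where "x = snd c p"
  have d: "d \<in> A" "p \<in> fst d" by (simp_all add: d_def chart_at_mem)
  have x: "x \<in> overlap c d" using c d by (auto simp: x_def)
  have y: "transition c d x = snd d p" using c by (simp add: x_def chart_inv_chart)
  have J: "from_coords A c p = jacobian c d x" by (simp add: from_coords_jacobian x_def d_def)
  show ?thesis
    unfolding x_def[symmetric] d_form1_apply[OF \<xi>] J
      covector_rep_derivative_change[OF c(1) d(1) x \<xi>] y
    using jacobian_derivative_symmetric[OF c(1) d(1) x, of a b] by (simp add: pder_def d_def)
qed

lemma d_fun_coords:
  assumes c: "c \<in> A" "p \<in> fst c" and f: "smooth_fun A f"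
  shows "d_fun A f p (from_coords A c p a) = frechet_derivative (fun_rep c f) (at (snd c p)) a"
proof -
  define d where "d = chart_at A p"
  define x where "x = snd c p"
  have d: "d \<in> A" "p \<in> fst d" by (simp_all add: d_def chart_at_mem)
  have x: "x \<in> overlap c d" using c d by (auto simp: x_def)
  have y: "transition c d x = snd d p" using c by (simp add: x_def chart_inv_chart)
  have J: "from_coords A c p = jacobian c d x" by (simp add: from_coords_jacobian x_def d_def)
  have "(fun_rep d f has_derivative frechet_derivative (fun_rep d f) (at (snd d p))) (at (snd d p))"
    using f d unfolding smooth_fun_def by (intro smooth_on_has_derivative[of "snd d ` fst d"]) auto
  moreover have "(transition c d has_derivative jacobian c d x) (at x)"
    unfolding x_def by (rule transition_has_derivative[OF c(1) d(1) c(2) d(2)])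
  ultimately have "((\<lambda>x. fun_rep d f (transition c d x)) has_derivative
      (\<lambda>a. frechet_derivative (fun_rep d f) (at (snd d p)) (jacobian c d x a))) (at x)"
    using has_derivative_compose[of "transition c d"] y by metis
  moreover have "frechet_derivative (fun_rep c f) (at x)
      = frechet_derivative (\<lambda>x. fun_rep d f (transition c d x)) (at x)"
    by (rule frechet_derivative_cong_open[OF open_overlap[OF c(1) d(1)] x])
      (use c d in \<open>auto simp: fun_rep_def chart_inv_chart\<close>)
  ultimately show ?thesis
    by (simp add: d_fun_apply[OF f] J frechet_derivative_eq pder_def flip: x_def d_def)
qed

lemma vector_field_lie_bracket:
  assumes "vector_field A u" "vector_field A v"
  shows "vector_field A (lie_bracket A u v)"
  unfolding vector_field_on_def
proof
  fix c assume c: "c \<in> A"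
  have "vector_rep A c (lie_bracket A u v) x
      = frechet_derivative (vector_rep A c v) (at x) (vector_rep A c u x)
      - frechet_derivative (vector_rep A c u) (at x) (vector_rep A c v x)"
    if x: "x \<in> snd c ` fst c" for x
  proof -
    obtain p where "p \<in> fst c" "x = snd c p" using x by auto
    then show ?thesis
      using lie_bracket_coords[OF c _ assms] by (simp add: vector_rep_def[of A c "lie_bracket A u v"] chart_inv_chart c)
  qed
  then show "smooth_on (snd c ` (UNIV \<inter> fst c)) (vector_rep A c (lie_bracket A u v))"
    using assms c
    by (simp add: smooth_on_cong[OF chart_open(2)[OF c]] smooth_on_diff smooth_on_frechet_derivative
        chart_open smooth_vector_rep)
qed

lemma one_form_d_fun:
  assumes "smooth_fun A f"
  shows "one_form A (d_fun A f)"
  unfolding one_form_on_def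
proof (intro ballI allI)
  fix c v assume c: "c \<in> A"
  have "form1_rep A c (d_fun A f) x v = frechet_derivative (fun_rep c f) (at x) v"
    if x: "x \<in> snd c ` fst c" for x
    using x d_fun_coords[OF c _ assms] by (auto simp: form1_rep_def Let_def chart_inv_chart c)
  then show "smooth_on (snd c ` (UNIV \<inter> fst c)) (\<lambda>x. form1_rep A c (d_fun A f) x v)"
    using assms c unfolding smooth_fun_def
    by (simp add: smooth_on_cong[OF chart_open(2)[OF c]] smooth_on_frechet_const)
qed

lemma one_form_contract_d_form1:
  assumes "one_form A \<xi>" "vector_field A u"
  shows "one_form A (\<lambda>p. d_form1 A \<xi> p (u p))"
  unfolding one_form_on_def
proof (intro ballI allI)
  fix c v assume c: "c \<in> A"
  have "form1_rep A c (\<lambda>p. d_form1 A \<xi> p (u p)) x v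
      = frechet_derivative (covector_rep c \<xi>) (at x) (vector_rep A c u x) v
      - frechet_derivative (covector_rep c \<xi>) (at x) v (vector_rep A c u x)"
    if x: "x \<in> snd c ` fst c" for x
  proof -
    obtain p where p: "p \<in> fst c" "x = snd c p" using x by auto
    then have "u p = from_coords A c p (vector_rep A c u x)"
      by (simp add: vector_rep_def Let_def chart_inv_chart c from_to_coords_apply)
    then show ?thesis
      using p d_form1_coords[OF c _ assms(1), of p "vector_rep A c u x" v]
      by (simp add: form1_rep_def Let_def chart_inv_chart c)
  qed
  moreover have "smooth_on (snd c ` fst c) (\<lambda>x. frechet_derivative (covector_rep c \<xi>) (at x) (vector_rep A c u x) v
      - frechet_derivative (covector_rep c \<xi>) (at x) v (vector_rep A c u x))"
    by (intro smooth_on_diff smooth_on_blinfun_apply smooth_on_const smooth_on_frechet_derivative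
        smooth_on_frechet_const chart_open smooth_covector_rep smooth_vector_rep assms c)
  ultimately show "smooth_on (snd c ` (UNIV \<inter> fst c)) (\<lambda>x. form1_rep A c (\<lambda>p. d_form1 A \<xi> p (u p)) x v)"
    by (simp only: Int_UNIV_left) (rule smooth_on_eqI[OF chart_open(2)[OF c]])
qed

lemma one_form_add:
  "open W \<Longrightarrow> one_form_on A W \<xi> \<Longrightarrow> one_form_on A W \<eta> \<Longrightarrow> one_form_on A W (\<lambda>p. \<xi> p + \<eta> p)"
  unfolding one_form_on_def form1_rep_def Let_def
  by (simp add: blinfun.add_left smooth_on_add open_chart_image)

lemma one_form_diff:
  "open W \<Longrightarrow> one_form_on A W \<xi> \<Longrightarrow> one_form_on A W \<eta> \<Longrightarrow> one_form_on A W (\<lambda>p. \<xi> p - \<eta> p)"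
  unfolding one_form_on_def form1_rep_def Let_def
  by (simp add: blinfun.diff_left smooth_on_diff open_chart_image)

lemma vector_field_add:
  "open W \<Longrightarrow> vector_field_on A W u \<Longrightarrow> vector_field_on A W v \<Longrightarrow> vector_field_on A W (\<lambda>p. u p + v p)"
  unfolding vector_field_on_def vector_rep_def Let_def
  by (simp add: blinfun.add_right smooth_on_add open_chart_image)

lemma vector_field_diff:
  "open W \<Longrightarrow> vector_field_on A W u \<Longrightarrow> vector_field_on A W v \<Longrightarrow> vector_field_on A W (\<lambda>p. u p - v p)"
  unfolding vector_field_on_def vector_rep_def Let_def
  by (simp add: blinfun.diff_right smooth_on_diff open_chart_image)

text \<open>
  The Dorfman bracket is assembled from the Lie bracket, \<open>d\<close> of one-forms and of functions, and contractions;
  each of these preserves smoothness by its coordinate expression in an arbitrary chart.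
\<close>

lemma section_dorfman:
  assumes "section_on A UNIV a" "section_on A UNIV b"
  shows "section_on A UNIV (dorfman A a b)"
proof -
  have u: "vector_field A (fst \<circ> a)" "vector_field A (fst \<circ> b)"
    and \<xi>: "one_form A (snd \<circ> a)" "one_form A (snd \<circ> b)"
    using assms by (simp_all add: section_on_def)
  have "fst \<circ> dorfman A a b = lie_bracket A (fst \<circ> a) (fst \<circ> b)"
    by (auto simp: dorfman_def Let_def)
  moreover have "snd \<circ> dorfman A a b = (\<lambda>p. (d_form1 A (snd \<circ> b) p ((fst \<circ> a) p)
      + d_fun A (\<lambda>q. (snd \<circ> b) q ((fst \<circ> a) q)) p) - d_form1 A (snd \<circ> a) p ((fst \<circ> b) p))"
    by (auto simp: dorfman_def lie_deriv_def Let_def)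
  ultimately show ?thesis
    unfolding section_on_def
    by (simp only:) (intro conjI vector_field_lie_bracket one_form_diff one_form_add
        one_form_contract_d_form1 one_form_d_fun smooth_fun_contract u \<xi> open_UNIV)
qed


section \<open>First-order jets\<close>

lemma dcov_flat:
  assumes "two_form A \<omega>" "vector_field A u"
  shows "dcov (\<lambda>q. \<omega> q (u q)) p h = \<omega> p (dvec u p h) + dflat \<omega> p h (u p)"
proof -
  have "dcov (\<lambda>q. \<omega> q (u q)) p = pder A p (\<lambda>x. flat_rep (chart_at A p) \<omega> x (vector_rep A (chart_at A p) u x))"
    by (rule pder_cong) (simp add: rep_contract chart_at_mem)
  then show ?thesis
    by (simp add: pder_blinfun_apply assms smooth_flat_rep smooth_vector_rep chart_at_mem rep_chart_at)
qed

lemma dvec_sharp: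
  assumes "bivector_field A \<pi>" "one_form A \<xi>"
  shows "dvec (\<lambda>q. bisharp \<pi> q (\<xi> q)) p h = bisharp \<pi> p (dcov \<xi> p h) + dsharp \<pi> p h (\<xi> p)"
proof -
  have "dvec (\<lambda>q. bisharp \<pi> q (\<xi> q)) p
      = pder A p (\<lambda>x. sharp_rep (chart_at A p) \<pi> x (covector_rep (chart_at A p) \<xi> x))"
    by (rule pder_cong) (simp add: rep_contract chart_at_mem)
  then show ?thesis
    by (simp add: pder_blinfun_apply assms smooth_sharp_rep smooth_covector_rep chart_at_mem rep_chart_at)
qed

lemma dvec_add:
  assumes "vector_field A u" "vector_field A v"
  shows "dvec (\<lambda>q. u q + v q) p h = dvec u p h + dvec v p h"
proof -
  have "dvec (\<lambda>q. u q + v q) p = pder A p (\<lambda>x. vector_rep A (chart_at A p) u x + vector_rep A (chart_at A p) v x)"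
    by (rule pder_cong) (simp add: vector_rep_def Let_def blinfun.add_right)
  moreover have "pder A p (\<lambda>x. vector_rep A (chart_at A p) u x + vector_rep A (chart_at A p) v x) h
      = dvec u p h + dvec v p h"
    unfolding pder_def
    by (rule frechet_derivative_eq[THEN fun_cong, OF has_derivative_add])
      (intro differentiable_frechet chart_at_differentiable smooth_vector_rep assms chart_at_mem)+
  ultimately show ?thesis by simp
qed

lemma d_fun_contract:
  assumes "one_form A \<xi>" "vector_field A u"
  shows "d_fun A (\<lambda>q. \<xi> q (u q)) p h = \<xi> p (dvec u p h) + dcov \<xi> p h (u p)"
proof -
  have "pder A p (fun_rep (chart_at A p) (\<lambda>q. \<xi> q (u q)))
      = pder A p (\<lambda>x. covector_rep (chart_at A p) \<xi> x (vector_rep A (chart_at A p) u x))"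
    by (rule pder_cong) (simp add: rep_contract chart_at_mem)
  then show ?thesis
    by (simp add: d_fun_apply smooth_fun_contract pder_blinfun_apply assms smooth_covector_rep
        smooth_vector_rep chart_at_mem rep_chart_at)
qed

text \<open>
  The derivative of \<open>\<eta>\<close> along \<open>z\<close> in Cartan's formula occurs in both summands with opposite signs.
\<close>

lemma lie_deriv_apply:
  assumes "vector_field A u" "one_form A \<eta>"
  shows "lie_deriv A u \<eta> p z = dcov \<eta> p (u p) z + \<eta> p (dvec u p z)"
  by (simp add: lie_deriv_def blinfun.add_left d_form1_apply d_fun_contract assms)

lemma bisharp_skew:
  assumes "bivector_field A \<pi>"
  shows "blinfun_apply \<alpha> (bisharp \<pi> p \<beta>) = - blinfun_apply \<beta> (bisharp \<pi> p \<alpha>)"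
proof -
  have "\<pi> p (\<alpha> + \<beta>) (\<alpha> + \<beta>) = 0" "\<pi> p \<alpha> \<alpha> = 0" "\<pi> p \<beta> \<beta> = 0"
    using assms by (simp_all add: bivector_field_def)
  then show ?thesis by (simp add: bisharp_apply blinfun.add_left blinfun.add_right)
qed

lemma two_form_skew:
  assumes "two_form A \<omega>"
  shows "\<omega> p u v = - \<omega> p v u"
proof -
  have "\<omega> p (u + v) (u + v) = 0" "\<omega> p u u = 0" "\<omega> p v v = 0"
    using assms by (simp_all add: two_form_def)
  then show ?thesis by (simp add: blinfun.add_left blinfun.add_right)
qed

lemma pder_skew:
  assumes "smooth_on (snd (chart_at A p) ` fst (chart_at A p)) F" "\<And>x. (F x :: real) = - G x"
  shows "pder A p F h = - pder A p G h"
proof -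
  have "G = (\<lambda>x. - F x)" using assms(2) by simp
  then have "pder A p G h = - pder A p F h"
    unfolding pder_def
    using frechet_derivative_eq[OF has_derivative_minus[OF differentiable_frechet[OF
            chart_at_differentiable[OF assms(1)]]]] by simp
  then show ?thesis by simp
qed

lemma dflat_skew:
  assumes "two_form A \<omega>"
  shows "dflat \<omega> p h u v = - dflat \<omega> p h v u"
proof -
  have sm: "smooth_on (snd (chart_at A p) ` fst (chart_at A p)) (flat_rep (chart_at A p) \<omega>)"
    by (rule smooth_flat_rep[OF assms chart_at_mem(1)])
  have sm2: "smooth_on (snd (chart_at A p) ` fst (chart_at A p)) (\<lambda>x. flat_rep (chart_at A p) \<omega> x v)" for v
    by (intro smooth_on_blinfun_apply sm smooth_on_const chart_open chart_at_mem)
  have "dflat \<omega> p h u v = pder A p (\<lambda>x. flat_rep (chart_at A p) \<omega> x u v) h" for u v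
    by (simp add: pder_blinfun_apply_const sm sm2)
  moreover have "pder A p (\<lambda>x. flat_rep (chart_at A p) \<omega> x u v) h
      = - pder A p (\<lambda>x. flat_rep (chart_at A p) \<omega> x v u) h"
    by (rule pder_skew)
      (intro smooth_on_blinfun_apply sm2 smooth_on_const chart_open chart_at_mem,
        simp add: flat_rep_def, rule two_form_skew[OF assms])
  ultimately show ?thesis by simp
qed

lemma pder_covector:
  assumes "smooth_on (snd (chart_at A p) ` fst (chart_at A p)) G"
  shows "pder A p (\<lambda>x. blinfun_apply \<beta> (G x)) h = blinfun_apply \<beta> (pder A p G h)"
  unfolding pder_def
  by (rule frechet_derivative_eq[THEN fun_cong, OF bounded_linear.has_derivative[OF
        blinfun.bounded_linear_right differentiable_frechet[OF chart_at_differentiable[OF assms]]]])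

lemma dsharp_skew:
  assumes "bivector_field A \<pi>"
  shows "blinfun_apply \<beta> (dsharp \<pi> p h \<alpha>) = - blinfun_apply \<alpha> (dsharp \<pi> p h \<beta>)"
proof -
  have sm: "smooth_on (snd (chart_at A p) ` fst (chart_at A p)) (sharp_rep (chart_at A p) \<pi>)"
    by (rule smooth_sharp_rep[OF assms chart_at_mem(1)])
  have sm2: "smooth_on (snd (chart_at A p) ` fst (chart_at A p)) (\<lambda>x. sharp_rep (chart_at A p) \<pi> x \<alpha>)" for \<alpha>
    by (intro smooth_on_blinfun_apply sm smooth_on_const chart_open chart_at_mem)
  have "blinfun_apply \<beta> (dsharp \<pi> p h \<alpha>) = pder A p (\<lambda>x. \<beta> (sharp_rep (chart_at A p) \<pi> x \<alpha>)) h"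
    for \<alpha> \<beta> :: "'e \<Rightarrow>\<^sub>L real"
    by (simp add: pder_blinfun_apply_const sm sm2 pder_covector)
  moreover have "pder A p (\<lambda>x. \<beta> (sharp_rep (chart_at A p) \<pi> x \<alpha>)) h
      = - pder A p (\<lambda>x. \<alpha> (sharp_rep (chart_at A p) \<pi> x \<beta>)) h"
  proof (rule pder_skew)
    fix x
    show "\<beta> (sharp_rep (chart_at A p) \<pi> x \<alpha>) = - \<alpha> (sharp_rep (chart_at A p) \<pi> x \<beta>)"
      unfolding sharp_rep_apply bivector_rep_def Let_def bisharp_apply[symmetric]
      by (rule bisharp_skew[OF assms])
  qed (intro smooth_on_blinfun_apply sm2 smooth_on_const chart_open chart_at_mem)
  ultimately show ?thesis by (simp only:)
qed

lemma d_form2_apply: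
  assumes "smooth_on (snd (chart_at A p) ` fst (chart_at A p)) (flat_rep (chart_at A p) \<omega>)"
  shows "d_form2 A \<omega> p u v w = dflat \<omega> p u v w - dflat \<omega> p v u w + dflat \<omega> p w u v"
proof -
  have sm2: "smooth_on (snd (chart_at A p) ` fst (chart_at A p)) (\<lambda>x. flat_rep (chart_at A p) \<omega> x v)" for v
    by (intro smooth_on_blinfun_apply assms smooth_on_const chart_open chart_at_mem)
  show ?thesis
    by (simp add: d_form2_def form2_rep_eq pder_blinfun_apply_const sm2 assms)
qed

text \<open>
  Makes \<open>\<omega>\<pi>\<omega>\<close> accessible to the product rule.
\<close>

lemma flat_rep_omega_pi_omega:
  assumes "c \<in> A" "x \<in> snd c ` fst c"
  shows "flat_rep c (omega_pi_omega \<pi> \<omega>) x = flat_rep c \<omega> x o\<^sub>L sharp_rep c \<pi> x o\<^sub>L flat_rep c \<omega> x"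
proof -
  obtain p where p: "p \<in> fst c" "x = snd c p" using assms by auto
  have "(\<alpha> o\<^sub>L from_coords A c p) o\<^sub>L to_coords A c p = \<alpha>" for \<alpha> :: "'e \<Rightarrow>\<^sub>L real"
    using assms p by (intro blinfun_eqI) (simp add: from_to_coords_apply)
  then show ?thesis
    using assms p
    by (intro blinfun_eqI)
      (simp add: flat_rep_def sharp_rep_def omega_pi_omega_def chart_inv_chart from_to_coords_apply)
qed

text \<open>
  The product rule gives, for each of the three directions, one term with a derivative of \<open>P\<close> and two
  terms with a derivative of \<open>\<omega>\<close>. The latter are collected by their argument \<open>P\<omega>w\<close>, \<open>P\<omega>v\<close> or \<open>P\<omega>u\<close>; since
  \<open>\<omega>\<close> is closed, each pair equals a single derivative of \<open>\<omega>\<close> in the direction of that argument.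
\<close>

lemma d_form2_omega_pi_omega:
  assumes \<pi>: "bivector_field A \<pi>" and \<omega>: "two_form A \<omega>" and closed: "closed_form A \<omega>"
  defines "P \<equiv> bisharp \<pi>"
  shows "d_form2 A (omega_pi_omega \<pi> \<omega>) p u v w =
    - (\<omega> p w (dsharp \<pi> p u (\<omega> p v)) + \<omega> p u (dsharp \<pi> p v (\<omega> p w)) + \<omega> p v (dsharp \<pi> p w (\<omega> p u))
      + dflat \<omega> p (P p (\<omega> p u)) v w + dflat \<omega> p (P p (\<omega> p v)) w u + dflat \<omega> p (P p (\<omega> p w)) u v)"
proof -
  let ?c = "chart_at A p" and ?U = "snd (chart_at A p) ` fst (chart_at A p)"
  let ?\<theta> = "omega_pi_omega \<pi> \<omega>"
  have sm: "smooth_on ?U (flat_rep ?c \<omega>)" "smooth_on ?U (sharp_rep ?c \<pi>)" "open ?U"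
    by (intro smooth_flat_rep smooth_sharp_rep chart_open chart_at_mem \<pi> \<omega>)+
  have sm\<theta>a: "smooth_on ?U (\<lambda>x. flat_rep ?c \<omega> x o\<^sub>L sharp_rep ?c \<pi> x o\<^sub>L flat_rep ?c \<omega> x)"
    by (intro smooth_on_bilinear[OF bounded_bilinear_blinfun_compose] sm)
  then have sm\<theta>: "smooth_on ?U (flat_rep ?c ?\<theta>)"
    by (subst smooth_on_cong[OF sm(3)]) (auto simp: flat_rep_omega_pi_omega[OF chart_at_mem(1)] simp del: image_iff)
  have d\<theta>: "dflat ?\<theta> p h a b = \<omega> p (P p (dflat \<omega> p h a)) b + \<omega> p (dsharp \<pi> p h (\<omega> p a)) b
      + dflat \<omega> p h (P p (\<omega> p a)) b" for h a b
  proof -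
    have "dflat ?\<theta> p h a = pder A p (\<lambda>x. flat_rep ?c ?\<theta> x a) h"
      by (simp add: pder_blinfun_apply_const sm\<theta>)
    also have "\<dots> = pder A p (\<lambda>x. flat_rep ?c \<omega> x (sharp_rep ?c \<pi> x (flat_rep ?c \<omega> x a))) h"
      by (subst pder_cong[of p _ "\<lambda>x. flat_rep ?c \<omega> x (sharp_rep ?c \<pi> x (flat_rep ?c \<omega> x a))"])
        (simp_all add: flat_rep_omega_pi_omega[OF chart_at_mem(1)] del: image_iff)
    also have "\<dots> = \<omega> p (P p (dflat \<omega> p h a)) + \<omega> p (dsharp \<pi> p h (\<omega> p a)) + dflat \<omega> p h (P p (\<omega> p a))"
      by (simp add: pder_blinfun_apply pder_blinfun_apply_const sm smooth_on_blinfun_apply smooth_on_const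
          rep_chart_at blinfun.add_right P_def pder_def[of _ _ "\<lambda>x. a"])
    finally show ?thesis by (simp add: blinfun.add_left)
  qed
  have cl: "dflat \<omega> p a b c - dflat \<omega> p b a c + dflat \<omega> p c a b = 0" for a b c
    using closed d_form2_apply[OF sm(1)] by (simp add: closed_form_def)
  have sk: "\<omega> p (P p (dflat \<omega> p h a)) b = dflat \<omega> p h a (P p (\<omega> p b))" for h a b
    using two_form_skew[OF \<omega>, of p "P p (dflat \<omega> p h a)" b] bisharp_skew[OF \<pi>, of "\<omega> p b" p "dflat \<omega> p h a"]
    by (simp add: P_def)
  have sk2: "\<omega> p (dsharp \<pi> p h (\<omega> p a)) b = - \<omega> p b (dsharp \<pi> p h (\<omega> p a))" for h a b
    by (rule two_form_skew[OF \<omega>])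
  have sk3: "\<omega> p b (dsharp \<pi> p h (\<omega> p a)) = - \<omega> p a (dsharp \<pi> p h (\<omega> p b))" for h a b
    by (rule dsharp_skew[OF \<pi>])
  show ?thesis
    unfolding d_form2_apply[OF sm\<theta>] d\<theta> sk sk2
    using cl[of u v "P p (\<omega> p w)"] cl[of u w "P p (\<omega> p v)"] cl[of v w "P p (\<omega> p u)"]
      dflat_skew[OF \<omega>, of p u "P p (\<omega> p v)" w] dflat_skew[OF \<omega>, of p v "P p (\<omega> p u)" w]
      dflat_skew[OF \<omega>, of p w "P p (\<omega> p u)" v] dflat_skew[OF \<omega>, of p "P p (\<omega> p v)" w u]
      sk3[of w v u]
    by linarith
qed


section \<open>Global fields with prescribed values\<close>

text \<open>
  Extension by zero: a compact subset of a chart domain is closed in \<open>M\<close> by the Hausdorff property, so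
  its complement is an open set on which the function vanishes, and this set together with the chart domain covers \<open>M\<close>.
\<close>

lemma smooth_on_extend_zero:
  assumes c: "c \<in> A" and d: "d \<in> A" and K: "compact K" "K \<subseteq> snd c ` fst c"
    and H: "smooth_on (overlap d c) H"
    and zero: "\<And>x. x \<in> snd d ` fst d \<Longrightarrow> chart_inv d x \<notin> chart_inv c ` K \<Longrightarrow> H x = 0"
  shows "smooth_on (snd d ` fst d) H"
proof -
  have "continuous_on K (chart_inv c)"
    using chart_homeomorphism[OF c] K(2) unfolding homeomorphism_def by (metis continuous_on_subset)
  then have "closed (chart_inv c ` K)"
    using K(1) compact_continuous_image compact_imp_closed by blast
  then have N: "open (snd d ` (- chart_inv c ` K \<inter> fst d))"
    using open_chart_image[OF d] by blast
  have "smooth_on (snd d ` (- chart_inv c ` K \<inter> fst d)) H"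
    by (rule smooth_on_eqI[OF N smooth_on_const[of _ 0]]) (auto simp: chart_inv_chart[OF d] intro!: zero)
  then have "smooth_on (overlap d c \<union> snd d ` (- chart_inv c ` K \<inter> fst d)) H"
    by (rule smooth_on_Un[OF open_overlap[OF d c] N H])
  moreover have "chart_inv c ` K \<subseteq> fst c"
    using K(2) by (auto simp: chart_inv_chart[OF c] dest!: subsetD)
  then have "fst d = fst d \<inter> fst c \<union> (- chart_inv c ` K \<inter> fst d)" by blast
  then have "overlap d c \<union> snd d ` (- chart_inv c ` K \<inter> fst d) = snd d ` fst d"
    by (metis image_Un)
  ultimately show ?thesis by simp
qed

lemma cutoff_exists:
  obtains \<beta> K where "smooth_on UNIV \<beta>" "\<beta> (snd (chart_at A p) p) = (1::real)" "compact K"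
    "K \<subseteq> snd (chart_at A p) ` fst (chart_at A p)" "\<And>x. x \<notin> K \<Longrightarrow> \<beta> x = 0"
    "\<And>v. frechet_derivative \<beta> (at (snd (chart_at A p) p)) v = 0"
proof -
  obtain r where r: "r > 0" "cball (snd (chart_at A p) p) r \<subseteq> snd (chart_at A p) ` fst (chart_at A p)"
    using chart_open(2)[OF chart_at_mem(1)] chart_point open_contains_cball by meson
  from bump_function_exists[OF r(1), of "snd (chart_at A p) p"] obtain \<beta> where "smooth_on UNIV \<beta>"
    "\<beta> (snd (chart_at A p) p) = (1::real)" "\<forall>x. x \<notin> cball (snd (chart_at A p) p) r \<longrightarrow> \<beta> x = 0"
    "\<forall>v. frechet_derivative \<beta> (at (snd (chart_at A p) p)) v = 0" by blast
  then show ?thesis using that[OF _ _ compact_closed_ball r(2)] by blast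
qed

lemma smooth_on_transition:
  assumes "c \<in> A" "d \<in> A" "smooth_on (overlap d c) F"
  shows "smooth_on (overlap c d) (\<lambda>x. F (transition c d x))"
  by (rule smooth_on_compose[OF open_overlap open_overlap transition_image assms(3) smooth_transition])
    (use assms in auto)

lemma chart_inv_notin:
  assumes "c \<in> A" "p \<in> fst c" "p \<notin> chart_inv c ` K"
  shows "snd c p \<notin> K"
  using assms chart_inv_chart by (metis image_eqI)

lemma vector_field_on_chart_frame:
  assumes c: "c \<in> A"
  shows "vector_field_on A (fst c) (\<lambda>q. from_coords A c q v)"
  unfolding vector_field_on_def
proof
  fix d assume d: "d \<in> A"
  have "smooth_on (overlap d c) (\<lambda>x. jacobian c d (transition d c x) v)"
    by (rule smooth_on_transition[OF d c])
      (intro smooth_on_blinfun_apply smooth_jacobian smooth_on_const open_overlap c d)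
  moreover have "vector_rep A d (\<lambda>q. from_coords A c q v) x = jacobian c d (transition d c x) v"
    if "x \<in> overlap d c" for x
  proof -
    obtain q where q: "q \<in> fst c" "q \<in> fst d" "x = snd d q" using \<open>x \<in> overlap d c\<close> by auto
    show ?thesis using q to_from_coords[OF c d q(1,2), symmetric]
      by (simp add: vector_rep_def Let_def chart_inv_chart d)
  qed
  ultimately have "smooth_on (overlap d c) (vector_rep A d (\<lambda>q. from_coords A c q v))"
    by (rule smooth_on_eqI[OF open_overlap[OF d c]])
  then show "smooth_on (snd d ` (fst c \<inter> fst d)) (vector_rep A d (\<lambda>q. from_coords A c q v))"
    by (simp add: inf_commute)
qed

lemma vector_field_exists: "\<exists>u. vector_field A u \<and> u p = v"
proof -
  obtain \<beta> K where \<beta>: "smooth_on UNIV \<beta>" "\<beta> (snd (chart_at A p) p) = (1::real)" and K: "compact K"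
    "K \<subseteq> snd (chart_at A p) ` fst (chart_at A p)" and \<beta>0: "\<And>x. x \<notin> K \<Longrightarrow> \<beta> x = 0"
    by (rule cutoff_exists[of p]) blast
  define c where "c = chart_at A p"
  have c: "c \<in> A" "p \<in> fst c" by (simp_all add: c_def chart_at_mem)
  define u where "u = (\<lambda>q. if q \<in> fst c then \<beta> (snd c q) *\<^sub>R from_coords A c q v else 0)"
  have "vector_field A u"
    unfolding vector_field_on_def
  proof
    fix d assume d: "d \<in> A"
    have rep: "vector_rep A d u x = \<beta> (transition d c x) *\<^sub>R vector_rep A d (\<lambda>q. from_coords A c q v) x"
      if "x \<in> overlap d c" for x
      using that by (auto simp: u_def vector_rep_def Let_def chart_inv_chart d blinfun.scaleR_right)
    have "smooth_on (overlap d c) (vector_rep A d u)"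
    proof (rule smooth_on_eqI[OF open_overlap[OF d c(1)] _ rep])
      show "smooth_on (overlap d c) (\<lambda>x. \<beta> (transition d c x) *\<^sub>R vector_rep A d (\<lambda>q. from_coords A c q v) x)"
        using vector_field_on_chart_frame[OF c(1), of v] d
        by (intro smooth_on_scaleR open_overlap c(1) d smooth_on_transition[OF d c(1)]
            smooth_on_subset[OF \<beta>(1)]) (auto simp: vector_field_on_def inf_commute)
    qed
    then show "smooth_on (snd d ` (UNIV \<inter> fst d)) (vector_rep A d u)"
      unfolding Int_UNIV_left
      by (rule smooth_on_extend_zero[OF c(1) d K(1) K(2)[folded c_def]])
        (use \<beta>0 chart_inv_notin[OF c(1)] in \<open>auto simp: u_def vector_rep_def Let_def chart_inv_chart d\<close>)
  qed
  moreover have "u p = v" using c \<beta>(2) by (simp add: u_def c_def)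
  ultimately show ?thesis by blast
qed

lemma one_form_exists: "\<exists>\<xi>. one_form A \<xi> \<and> \<xi> p = \<alpha>"
proof -
  obtain \<beta> K where \<beta>: "smooth_on UNIV \<beta>" "\<beta> (snd (chart_at A p) p) = (1::real)" and K: "compact K"
    "K \<subseteq> snd (chart_at A p) ` fst (chart_at A p)" and \<beta>0: "\<And>x. x \<notin> K \<Longrightarrow> \<beta> x = 0"
    by (rule cutoff_exists[of p]) blast
  define c where "c = chart_at A p"
  have c: "c \<in> A" "p \<in> fst c" by (simp_all add: c_def chart_at_mem)
  define \<xi> where "\<xi> = (\<lambda>q. if q \<in> fst c then \<beta> (snd c q) *\<^sub>R (\<alpha> o\<^sub>L to_coords A c q) else 0)"
  have "one_form A \<xi>"
    unfolding one_form_on_def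
  proof (intro ballI allI)
    fix d w assume d: "d \<in> A"
    have rep: "form1_rep A d \<xi> x w = \<beta> (transition d c x) *\<^sub>R \<alpha> (jacobian d c x w)"
      if "x \<in> overlap d c" for x
    proof -
      obtain q where q: "q \<in> fst c" "q \<in> fst d" "x = snd d q" using \<open>x \<in> overlap d c\<close> by auto
      show ?thesis using q to_from_coords[OF d c(1) q(2,1), symmetric]
        by (simp add: \<xi>_def form1_rep_def Let_def chart_inv_chart d blinfun.scaleR_left)
    qed
    have "smooth_on (overlap d c) (\<lambda>x. form1_rep A d \<xi> x w)"
    proof (rule smooth_on_eqI[OF open_overlap[OF d c(1)] _ rep])
      show "smooth_on (overlap d c) (\<lambda>x. \<beta> (transition d c x) *\<^sub>R \<alpha> (jacobian d c x w))"
        by (intro smooth_on_scaleR open_overlap c(1) d smooth_on_transition[OF d c(1)]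
            smooth_on_blinfun_apply smooth_on_const smooth_jacobian smooth_on_subset[OF \<beta>(1)]) auto
    qed
    then show "smooth_on (snd d ` (UNIV \<inter> fst d)) (\<lambda>x. form1_rep A d \<xi> x w)"
      unfolding Int_UNIV_left
      by (rule smooth_on_extend_zero[OF c(1) d K(1) K(2)[folded c_def]])
        (use \<beta>0 chart_inv_notin[OF c(1)] in \<open>auto simp: \<xi>_def form1_rep_def Let_def chart_inv_chart d\<close>)
  qed
  moreover have "\<xi> p = \<alpha>" using c \<beta>(2) by (simp add: \<xi>_def c_def)
  ultimately show ?thesis by blast
qed

text \<open>
  The function is \<open>\<beta>(x) \<alpha>(x - x0)\<close> in the chart. Its second derivative at \<open>x0\<close> is the symmetric product of
  \<open>d\<beta>\<close> and \<open>\<alpha>\<close>, which is zero because \<open>\<beta>\<close> has a critical point there. Without second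
  derivatives, Jacobi's identity for such functions only involves the bivector field.
\<close>

lemma function_exists:
  "\<exists>f. smooth_fun A f \<and> d_fun A f p = \<alpha> \<and> (\<forall>h. dcov (d_fun A f) p h = 0)"
proof -
  define c where "c = chart_at A p"
  have c: "c \<in> A" "p \<in> fst c" by (simp_all add: c_def chart_at_mem)
  define x0 where "x0 = snd c p"
  obtain \<beta> K where \<beta>: "smooth_on UNIV \<beta>" "\<beta> x0 = (1::real)" and K: "compact K"
    "K \<subseteq> snd c ` fst c" and \<beta>0: "\<And>x. x \<notin> K \<Longrightarrow> \<beta> x = 0"
    and d\<beta>: "\<And>v. frechet_derivative \<beta> (at x0) v = 0"
    using cutoff_exists[of p] unfolding c_def[symmetric] x0_def[symmetric] by metis
  define F where "F = (\<lambda>y. \<beta> y *\<^sub>R \<alpha> (y - x0))"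
  have F: "smooth_on UNIV F"
    unfolding F_def
    by (intro smooth_on_scaleR smooth_on_blinfun_apply smooth_on_const smooth_on_diff smooth_on_ident
        \<beta> open_UNIV)
  define f where "f = (\<lambda>q. if q \<in> fst c then F (snd c q) else 0)"
  have f: "smooth_fun A f"
    unfolding smooth_fun_def
  proof
    fix d assume d: "d \<in> A"
    have "smooth_on (overlap d c) (fun_rep d f)"
    proof (rule smooth_on_eqI[OF open_overlap[OF d c(1)]])
      show "smooth_on (overlap d c) (\<lambda>x. F (transition d c x))"
        by (rule smooth_on_transition[OF d c(1) smooth_on_subset[OF F]]) simp
    qed (auto simp: f_def fun_rep_def chart_inv_chart d)
    then show "smooth_on (snd d ` fst d) (fun_rep d f)"
      by (rule smooth_on_extend_zero[OF c(1) d K])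
        (use \<beta>0 chart_inv_notin[OF c(1)] in \<open>auto simp: f_def F_def fun_rep_def chart_inv_chart d\<close>)
  qed
  have \<beta>_der: "(\<beta> has_derivative frechet_derivative \<beta> (at y)) (at y)" for y
    by (rule smooth_on_has_derivative[OF \<beta>(1)]) simp
  have F_der: "frechet_derivative F (at y) z = \<beta> y * \<alpha> z + frechet_derivative \<beta> (at y) z * \<alpha> (y - x0)" for y z
  proof -
    have "(F has_derivative (\<lambda>z. \<beta> y *\<^sub>R \<alpha> z + frechet_derivative \<beta> (at y) z *\<^sub>R \<alpha> (y - x0))) (at y)"
      unfolding F_def by (intro has_derivative_scaleR \<beta>_der) (auto intro!: derivative_eq_intros)
    then show ?thesis by (simp add: frechet_derivative_eq)
  qed
  have f_der: "frechet_derivative (fun_rep c f) (at y) = frechet_derivative F (at y)"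
    if "y \<in> snd c ` fst c" for y
    using chart_open(2)[OF c(1)] that
    by (rule frechet_derivative_cong_open) (auto simp: f_def fun_rep_def chart_inv_chart c(1))
  have x0: "x0 \<in> snd c ` fst c" using c by (simp add: x0_def)
  have "d_fun A f p v = \<alpha> v" for v
    using f_der[OF x0] by (simp add: d_fun_apply[OF f] pder_def F_der d\<beta> \<beta> flip: c_def x0_def)
  then have "d_fun A f p = \<alpha>" by (rule blinfun_eqI)
  moreover have "dcov (d_fun A f) p h = 0" for h
  proof (rule blinfun_eqI)
    fix z
    have "dcov (d_fun A f) p h z = pder A p (\<lambda>x. covector_rep c (d_fun A f) x z) h"
      by (simp add: pder_blinfun_apply_const smooth_covector_rep one_form_d_fun f chart_at_mem c_def)
    also have "pder A p (\<lambda>x. covector_rep c (d_fun A f) x z)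
        = pder A p (\<lambda>x. \<beta> x * \<alpha> z + frechet_derivative \<beta> (at x) z * \<alpha> (x - x0))"
    proof (rule pder_cong, unfold c_def[symmetric])
      fix x assume x: "x \<in> snd c ` fst c"
      then obtain q where q: "q \<in> fst c" "x = snd c q" by auto
      show "covector_rep c (d_fun A f) x z = \<beta> x * \<alpha> z + frechet_derivative \<beta> (at x) z * \<alpha> (x - x0)"
        using d_fun_coords[OF c(1) q(1) f, of z] f_der[OF x] q
        by (simp add: covector_rep_def chart_inv_chart c(1) F_der)
    qed
    also have "\<dots> h = 0"
    proof -
      have "((\<lambda>x. frechet_derivative \<beta> (at x) z) has_derivative
          frechet_derivative (\<lambda>x. frechet_derivative \<beta> (at x) z) (at x0)) (at x0)"
        by (rule smooth_on_has_derivative[OF smooth_on_frechet_const[OF \<beta>(1)]]) simp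
      \<comment> \<open>Every term contains \<open>d\<beta>\<close> at \<open>x0\<close> or the factor \<open>\<alpha>(x0 - x0)\<close>.\<close>
      then have "((\<lambda>x. \<beta> x * \<alpha> z + frechet_derivative \<beta> (at x) z * \<alpha> (x - x0)) has_derivative
          (\<lambda>h. 0)) (at x0)"
        by (auto intro!: derivative_eq_intros \<beta>_der simp: d\<beta>)
      then show ?thesis by (simp add: pder_def frechet_derivative_eq flip: c_def x0_def)
    qed
    finally show "dcov (d_fun A f) p h z = blinfun_apply 0 z" by simp
  qed
  ultimately show ?thesis using f by blast
qed


section \<open>The Jacobi identity in coordinates\<close>

text \<open>
  Since the differentials of the functions with \<open>df = \<alpha>\<close>, \<open>dg = \<beta>\<close>, \<open>dk = \<gamma>\<close> at \<open>p\<close> have vanishing first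
  derivatives there, only \<open>P\<close> is differentiated in \<open>{f, {g, k}}\<close>.
\<close>

lemma jacobi_dsharp:
  assumes \<pi>: "poisson_structure A \<pi>"
  shows "blinfun_apply \<gamma> (dsharp \<pi> p (bisharp \<pi> p \<alpha>) \<beta>)
    + blinfun_apply \<alpha> (dsharp \<pi> p (bisharp \<pi> p \<beta>) \<gamma>)
    + blinfun_apply \<beta> (dsharp \<pi> p (bisharp \<pi> p \<gamma>) \<alpha>) = 0"
proof -
  have bi: "bivector_field A \<pi>" using \<pi> by (simp add: poisson_structure_def)
  obtain f where f: "smooth_fun A f" "d_fun A f p = \<alpha>" "\<And>h. dcov (d_fun A f) p h = 0"
    using function_exists by blast
  obtain g where g: "smooth_fun A g" "d_fun A g p = \<beta>" "\<And>h. dcov (d_fun A g) p h = 0"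
    using function_exists by blast
  obtain k where k: "smooth_fun A k" "d_fun A k p = \<gamma>" "\<And>h. dcov (d_fun A k) p h = 0"
    using function_exists by blast
  have "poisson_bracket A \<pi> f (poisson_bracket A \<pi> g k) p
      = d_fun A k p (dsharp \<pi> p (bisharp \<pi> p (d_fun A f p)) (d_fun A g p))"
    if g: "smooth_fun A g" "\<And>h. dcov (d_fun A g) p h = 0"
      and k: "smooth_fun A k" "\<And>h. dcov (d_fun A k) p h = 0" for f g k
  proof -
    have "poisson_bracket A \<pi> g k = (\<lambda>q. d_fun A k q (bisharp \<pi> q (d_fun A g q)))"
      by (simp add: poisson_bracket_def[abs_def] bisharp_apply)
    moreover have "vector_field A (\<lambda>q. bisharp \<pi> q (d_fun A g q))"
      by (rule vector_field_sharp_on[OF bi open_UNIV one_form_d_fun[OF g(1)]])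
    ultimately have "d_fun A (poisson_bracket A \<pi> g k) p h = d_fun A k p (dsharp \<pi> p h (d_fun A g p))" for h
      by (simp add: d_fun_contract one_form_d_fun g k dvec_sharp bi)
    then show ?thesis
      by (simp add: poisson_bracket_def[of A \<pi> f] flip: bisharp_apply)
  qed
  note br = this
  have "poisson_bracket A \<pi> f (poisson_bracket A \<pi> g k) p
      + poisson_bracket A \<pi> g (poisson_bracket A \<pi> k f) p
      + poisson_bracket A \<pi> k (poisson_bracket A \<pi> f g) p = 0"
    using \<pi> f(1) g(1) k(1) unfolding poisson_structure_def by blast
  then show ?thesis
    by (simp only: br[OF g(1,3) k(1,3)] br[OF k(1,3) f(1,3)] br[OF f(1,3) g(1,3)] f(2) g(2) k(2))
qed

end

section \<open>The cotangent product of the two graphs\<close>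

text \<open>
  The section of the cotangent product of the two graphs determined by the vector field \<open>u\<close>; for a
  constant \<open>u\<close> its value at a point is the element of the fibre determined by that vector.
\<close>

definition graph_product ::
  "('a \<Rightarrow> ('e::real_inner \<Rightarrow>\<^sub>L real) \<Rightarrow>\<^sub>L ('e \<Rightarrow>\<^sub>L real) \<Rightarrow>\<^sub>L real) \<Rightarrow> ('a \<Rightarrow> 'e \<Rightarrow>\<^sub>L 'e \<Rightarrow>\<^sub>L real) \<Rightarrow>
    ('a \<Rightarrow> 'e) \<Rightarrow> 'a \<Rightarrow> 'e \<times> ('e \<Rightarrow>\<^sub>L real)" where
  "graph_product \<pi> \<omega> u q = (u q + bisharp \<pi> q (\<omega> q (u q)), \<omega> q (u q))"

lemma cotangent_product_graphs:
  "cotangent_product (graph_bivector \<pi>) (graph_form \<omega>) p = range (\<lambda>w. graph_product \<pi> \<omega> (\<lambda>_. w) p)"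
proof (intro equalityI subsetI)
  fix z assume "z \<in> cotangent_product (graph_bivector \<pi>) (graph_form \<omega>) p"
  then obtain \<xi> w where "z = (bisharp \<pi> p \<xi>, \<xi>) + (w, 0)" "\<xi> = \<omega> p w"
    by (auto simp: cotangent_product_def graph_bivector_def graph_form_def)
  then have "z = graph_product \<pi> \<omega> (\<lambda>_. w) p" by (simp add: graph_product_def add.commute)
  then show "z \<in> range (\<lambda>w. graph_product \<pi> \<omega> (\<lambda>_. w) p)" by blast
next
  fix z assume "z \<in> range (\<lambda>w. graph_product \<pi> \<omega> (\<lambda>_. w) p)"
  then obtain w where "z = graph_product \<pi> \<omega> (\<lambda>_. w) p" by blast
  then have "z = (bisharp \<pi> p (\<omega> p w), \<omega> p w) + (fst (w, \<omega> p w), 0)"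
    by (simp add: graph_product_def add.commute)
  then show "z \<in> cotangent_product (graph_bivector \<pi>) (graph_form \<omega>) p"
    unfolding cotangent_product_def graph_bivector_def graph_form_def by force
qed

context smooth_manifold
begin

context
  fixes \<pi> :: "'a \<Rightarrow> ('e \<Rightarrow>\<^sub>L real) \<Rightarrow>\<^sub>L ('e \<Rightarrow>\<^sub>L real) \<Rightarrow>\<^sub>L real" and \<omega> :: "'a \<Rightarrow> 'e \<Rightarrow>\<^sub>L 'e \<Rightarrow>\<^sub>L real"
  assumes bivector: "bivector_field A \<pi>" and two_form: "two_form A \<omega>"
begin

abbreviation L where
  "L \<equiv> cotangent_product (graph_bivector \<pi>) (graph_form \<omega>)"

text \<open>
  The product is isotropic because \<open>\<pi>\<close> and \<open>\<omega>\<close> are skew. Conversely, orthogonality of \<open>(w, \<zeta>)\<close> to all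
  elements says \<open>\<zeta> = \<omega>(w - P\<zeta>)\<close>, so that \<open>(w, \<zeta>)\<close> is the element determined by \<open>w - P\<zeta>\<close>.
\<close>

lemma perp_product: "perp (L p) = L p"
proof (intro equalityI subsetI)
  fix z assume z: "z \<in> perp (L p)"
  obtain w \<zeta> where wz: "z = (w, \<zeta>)" by (cases z)
  define v where "v = w - bisharp \<pi> p \<zeta>"
  have "blinfun_apply \<zeta> x = \<omega> p v x" for x
  proof -
    have "pairing z (graph_product \<pi> \<omega> (\<lambda>_. x) p) = 0"
      using z unfolding perp_def cotangent_product_graphs by blast
    then have "\<zeta> x + \<zeta> (bisharp \<pi> p (\<omega> p x)) + \<omega> p x w = 0"
      by (simp add: pairing_def graph_product_def wz blinfun.add_right)
    moreover have "\<omega> p v x = - \<omega> p x w + \<omega> p x (bisharp \<pi> p \<zeta>)"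
      using two_form_skew[OF two_form, of p v x] by (simp add: v_def blinfun.diff_right)
    moreover have "\<omega> p x (bisharp \<pi> p \<zeta>) = - \<zeta> (bisharp \<pi> p (\<omega> p x))"
      by (rule bisharp_skew[OF bivector])
    ultimately show ?thesis by simp
  qed
  then have "\<zeta> = \<omega> p v" by (rule blinfun_eqI)
  then have "z = graph_product \<pi> \<omega> (\<lambda>_. v) p" by (simp add: graph_product_def wz v_def)
  then show "z \<in> L p" unfolding cotangent_product_graphs by blast
next
  fix z assume "z \<in> L p"
  then obtain v where v: "z = graph_product \<pi> \<omega> (\<lambda>_. v) p" unfolding cotangent_product_graphs by blast
  have "pairing z (graph_product \<pi> \<omega> (\<lambda>_. w) p) = 0" for w
    using two_form_skew[OF two_form, of p v w] bisharp_skew[OF bivector, of "\<omega> p v" p "\<omega> p w"]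
    by (simp add: pairing_def graph_product_def v blinfun.add_right)
  then show "z \<in> perp (L p)" unfolding perp_def cotangent_product_graphs by blast
qed

lemma section_graph_product:
  assumes "open W" "vector_field_on A W u"
  shows "section_on A W (graph_product \<pi> \<omega> u)"
proof -
  have \<xi>: "one_form_on A W (\<lambda>q. \<omega> q (u q))" by (rule one_form_flat_on[OF two_form assms])
  moreover have "vector_field_on A W (\<lambda>q. u q + bisharp \<pi> q (\<omega> q (u q)))"
    by (intro vector_field_add vector_field_sharp_on[OF bivector] assms \<xi>)
  ultimately show ?thesis by (simp add: section_on_def graph_product_def o_def)
qed

lemma graph_product_mem: "graph_product \<pi> \<omega> u q \<in> L q"
  unfolding cotangent_product_graphs by (auto simp: graph_product_def)

text \<open>
  The vector field is recovered from a section as \<open>u = pr\<^sub>T - P pr\<^sub>T\<^sub>*\<close>, which shows that it is smooth.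
\<close>

lemma sections_product: "sections A L = graph_product \<pi> \<omega> ` {u. vector_field A u}"
proof (intro equalityI subsetI)
  fix s assume "s \<in> sections A L"
  then have sec: "vector_field A (fst \<circ> s)" "one_form A (snd \<circ> s)" and mem: "\<And>q. s q \<in> L q"
    by (auto simp: sections_def section_on_def)
  define u where "u = (\<lambda>q. (fst \<circ> s) q - bisharp \<pi> q ((snd \<circ> s) q))"
  have "vector_field A u"
    unfolding u_def by (intro vector_field_diff vector_field_sharp_on[OF bivector] sec open_UNIV)
  moreover have "s = graph_product \<pi> \<omega> u"
  proof
    fix q
    obtain v where v: "s q = graph_product \<pi> \<omega> (\<lambda>_. v) q"
      using mem[of q] unfolding cotangent_product_graphs by blast
    then have "u q = v" by (simp add: u_def graph_product_def)
    then show "s q = graph_product \<pi> \<omega> u q" using v by (simp add: graph_product_def)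
  qed
  ultimately show "s \<in> graph_product \<pi> \<omega> ` {u. vector_field A u}" by blast
qed (auto simp: sections_def section_graph_product graph_product_mem)

text \<open>
  A coordinate frame of \<open>TM\<close> is carried to a frame of the product by the fibrewise injective linear map
  \<open>u \<mapsto> (u + P\<omega>u, \<omega>u)\<close>.
\<close>

lemma vector_subbundle_product: "vector_subbundle A L"
proof -
  obtain e where e: "bij_betw e {..<card E} E"
    using ex_bij_betw_nat_finite[OF finite_basis] by (auto simp: atLeast0LessThan)
  have "\<exists>W s. open W \<and> p \<in> W \<and> (\<forall>i<card E. section_on A W (s i)) \<and>
      (\<forall>q\<in>W. inj_on (\<lambda>i. s i q) {..<card E} \<and> independent ((\<lambda>i. s i q) ` {..<card E}) \<and>
        span ((\<lambda>i. s i q) ` {..<card E}) = L q)" for p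
  proof (intro exI)
    define c where "c = chart_at A p"
    have c: "c \<in> A" "p \<in> fst c" by (simp_all add: c_def chart_at_mem)
    define s where "s = (\<lambda>i. graph_product \<pi> \<omega> (\<lambda>q. from_coords A c q (e i)))"
    have "inj_on (\<lambda>i. s i q) {..<card E} \<and> independent ((\<lambda>i. s i q) ` {..<card E}) \<and>
        span ((\<lambda>i. s i q) ` {..<card E}) = L q" if q: "q \<in> fst c" for q
    proof -
      define T where "T = (\<lambda>v. graph_product \<pi> \<omega> (\<lambda>q. from_coords A c q v) q)"
      have T: "linear T"
        by (rule linearI) (simp_all add: T_def graph_product_def blinfun.add_right blinfun.scaleR_right
            scaleR_add_right)
      have "v = 0" if "T v = 0" for v
      proof -
        have "from_coords A c q v = 0"
          using that by (auto simp: T_def graph_product_def prod_eq_iff)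
        then have "to_coords A c q (from_coords A c q v) = 0" by simp
        then show ?thesis by (simp add: to_from_coords_apply c q)
      qed
      then have injT: "inj T" using T by (simp add: linear_injective_0)
      have sT: "(\<lambda>i. s i q) = T \<circ> e" by (auto simp: s_def T_def)
      have image: "(\<lambda>i. s i q) ` {..<card E} = T ` E"
        unfolding sT image_comp[symmetric] using e by (simp add: bij_betw_def)
      have "inj_on (\<lambda>i. s i q) {..<card E}"
        unfolding sT using e injT by (auto simp: bij_betw_def intro: comp_inj_on inj_on_subset)
      moreover have "independent (T ` E)"
        using independent_basis inj_on_subset[OF injT]
        by (intro linear_independent_injective_image T) auto
      moreover have "span (T ` E) = L q"
      proof -
        have "span (T ` E) = T ` UNIV" by (simp add: linear_span_image[OF T] span_basis)
        also have "\<dots> = L q"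
          unfolding cotangent_product_graphs
        proof (intro equalityI subsetI)
          fix z assume "z \<in> range (\<lambda>w. graph_product \<pi> \<omega> (\<lambda>_. w) q)"
          then obtain w where w: "z = graph_product \<pi> \<omega> (\<lambda>_. w) q" by blast
          then have "z = T (to_coords A c q w)"
            by (simp add: T_def graph_product_def from_to_coords_apply c q)
          then show "z \<in> T ` UNIV" by blast
        qed (auto simp: T_def graph_product_def)
        finally show ?thesis .
      qed
      ultimately show ?thesis unfolding image by blast
    qed
    moreover have "section_on A (fst c) (s i)" for i
      unfolding s_def by (intro section_graph_product vector_field_on_chart_frame chart_open c)
    ultimately show "open (fst c) \<and> p \<in> fst c \<and> (\<forall>i<card E. section_on A (fst c) (s i)) \<and>
        (\<forall>q\<in>fst c. inj_on (\<lambda>i. s i q) {..<card E} \<and> independent ((\<lambda>i. s i q) ` {..<card E}) \<and>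
          span ((\<lambda>i. s i q) ` {..<card E}) = L q)"
      using chart_open c by blast
  qed
  then show ?thesis unfolding vector_subbundle_def by blast
qed

end


section \<open>The obstruction to involutivity\<close>

text \<open>
  With \<open>\<xi> = \<omega>u\<close>, \<open>\<eta> = \<omega>v\<close>, \<open>\<zeta> = \<omega>w\<close> and \<open>X = u + P\<xi>\<close>, \<open>Y = v + P\<eta>\<close>, \<open>z = w + P\<zeta>\<close>, the derivatives of
  \<open>u\<close> and \<open>v\<close> cancel from the pairing and leave the cyclic sums of \<open>\<langle>\<zeta>, (D\<^sub>X P)\<eta>\<rangle>\<close> and \<open>(D\<^sub>X \<omega>)(v, w)\<close>. The
  direction \<open>X\<close> is then split into \<open>u\<close> and \<open>P\<xi>\<close>: the first sum contributes the Jacobi identity in the directions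
  \<open>P\<xi>\<close>, \<open>P\<eta>\<close>, \<open>P\<zeta>\<close>, the second one \<open>d\<omega>\<close> in the directions \<open>u\<close>, \<open>v\<close>, \<open>w\<close>, and the rest is \<open>-d\<theta>\<close>.
\<close>

lemma dorfman_obstruction:
  assumes \<pi>: "poisson_structure A \<pi>" and \<omega>: "two_form A \<omega>" "closed_form A \<omega>"
    and uv: "vector_field A u" "vector_field A v"
  shows "pairing (dorfman A (graph_product \<pi> \<omega> u) (graph_product \<pi> \<omega> v) p)
      (graph_product \<pi> \<omega> (\<lambda>_. w) p) = - d_form2 A (omega_pi_omega \<pi> \<omega>) p (u p) (v p) w"
proof -
  have bi: "bivector_field A \<pi>" using \<pi> by (simp add: poisson_structure_def)
  define P where "P = bisharp \<pi> p"
  define \<xi> \<eta> \<zeta> where "\<xi> = (\<lambda>q. \<omega> q (u q))" and "\<eta> = (\<lambda>q. \<omega> q (v q))" and "\<zeta> = \<omega> p w"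
  define X Y where "X = (\<lambda>q. u q + bisharp \<pi> q (\<xi> q))" and "Y = (\<lambda>q. v q + bisharp \<pi> q (\<eta> q))"
  define z where "z = w + P \<zeta>"
  have XY_p: "X p = u p + P (\<xi> p)" "Y p = v p + P (\<eta> p)" by (simp_all add: X_def Y_def P_def)
  have forms: "one_form A \<xi>" "one_form A \<eta>"
    unfolding \<xi>_def \<eta>_def by (intro one_form_flat_on \<omega>(1) open_UNIV uv)+
  have sharps: "vector_field A (\<lambda>q. bisharp \<pi> q (\<xi> q))" "vector_field A (\<lambda>q. bisharp \<pi> q (\<eta> q))"
    by (intro vector_field_sharp_on bi open_UNIV forms)+
  have XY: "vector_field A X" "vector_field A Y"
    unfolding X_def Y_def by (intro vector_field_add open_UNIV uv sharps)+
  have dX: "dvec X p h = dvec u p h + (P (dcov \<xi> p h) + dsharp \<pi> p h (\<xi> p))" for h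
    unfolding X_def by (simp add: dvec_add uv sharps dvec_sharp bi forms P_def)
  have dY: "dvec Y p h = dvec v p h + (P (dcov \<eta> p h) + dsharp \<pi> p h (\<eta> p))" for h
    unfolding Y_def by (simp add: dvec_add uv sharps dvec_sharp bi forms P_def)
  have d\<xi>: "dcov \<xi> p h = \<omega> p (dvec u p h) + dflat \<omega> p h (u p)" for h
    unfolding \<xi>_def by (rule dcov_flat[OF \<omega>(1) uv(1)])
  have d\<eta>: "dcov \<eta> p h = \<omega> p (dvec v p h) + dflat \<omega> p h (v p)" for h
    unfolding \<eta>_def by (rule dcov_flat[OF \<omega>(1) uv(2)])
  have \<eta>_p: "\<eta> p = \<omega> p (v p)" by (simp add: \<eta>_def)
  have skP: "blinfun_apply \<alpha> (P \<beta>) = - blinfun_apply \<beta> (P \<alpha>)" for \<alpha> \<beta>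
    unfolding P_def by (rule bisharp_skew[OF bi])
  have "fst \<circ> graph_product \<pi> \<omega> u = X" "snd \<circ> graph_product \<pi> \<omega> u = \<xi>"
    "fst \<circ> graph_product \<pi> \<omega> v = Y" "snd \<circ> graph_product \<pi> \<omega> v = \<eta>"
    by (auto simp: graph_product_def X_def Y_def \<xi>_def \<eta>_def)
  then have "pairing (dorfman A (graph_product \<pi> \<omega> u) (graph_product \<pi> \<omega> v) p)
      (graph_product \<pi> \<omega> (\<lambda>_. w) p)
    = \<zeta> (dvec Y p (X p)) - \<zeta> (dvec X p (Y p)) + (dcov \<eta> p (X p) z + \<eta> p (dvec X p z))
      - (dcov \<xi> p (Y p) z - dcov \<xi> p z (Y p))"
    by (simp add: pairing_def dorfman_def lie_bracket_def lie_deriv_apply d_form1_apply forms XY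
        graph_product_def blinfun.diff_left blinfun.diff_right z_def \<zeta>_def P_def)
  also have "\<dots> = \<zeta> (dsharp \<pi> p (X p) (\<eta> p)) - \<zeta> (dsharp \<pi> p (Y p) (\<xi> p)) + \<eta> p (dsharp \<pi> p z (\<xi> p))
      + dflat \<omega> p (X p) (v p) w - dflat \<omega> p (Y p) (u p) w + dflat \<omega> p z (u p) (v p)"
  proof -
    have "dcov \<eta> p (X p) z = dcov \<eta> p (X p) w + dcov \<eta> p (X p) (P \<zeta>)"
      "dcov \<xi> p (Y p) z = dcov \<xi> p (Y p) w + dcov \<xi> p (Y p) (P \<zeta>)"
      "dcov \<xi> p z (Y p) = dcov \<xi> p z (v p) + dcov \<xi> p z (P (\<eta> p))"
      by (simp_all add: z_def XY_p(2) blinfun.add_right)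
    \<comment> \<open>Skewness of \<open>P\<close> turns the summands with \<open>P\<close> applied to a derivative into the values on \<open>P\<zeta>\<close> and \<open>P\<eta>\<close> split off above.\<close>
    moreover have "\<zeta> (dvec Y p (X p)) = \<zeta> (dvec v p (X p)) - dcov \<eta> p (X p) (P \<zeta>) + \<zeta> (dsharp \<pi> p (X p) (\<eta> p))"
      "\<zeta> (dvec X p (Y p)) = \<zeta> (dvec u p (Y p)) - dcov \<xi> p (Y p) (P \<zeta>) + \<zeta> (dsharp \<pi> p (Y p) (\<xi> p))"
      "\<eta> p (dvec X p z) = \<eta> p (dvec u p z) - dcov \<xi> p z (P (\<eta> p)) + \<eta> p (dsharp \<pi> p z (\<xi> p))"
      using skP[of \<zeta> "dcov \<eta> p (X p)"] skP[of \<zeta> "dcov \<xi> p (Y p)"] skP[of "\<eta> p" "dcov \<xi> p z"]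
      by (simp_all add: dX dY blinfun.add_right)
    \<comment> \<open>What is left of the derivatives of the one-forms cancels the derivatives of \<open>u\<close> and \<open>v\<close>.\<close>
    moreover have "dcov \<eta> p (X p) w = - \<zeta> (dvec v p (X p)) + dflat \<omega> p (X p) (v p) w"
      "dcov \<xi> p (Y p) w = - \<zeta> (dvec u p (Y p)) + dflat \<omega> p (Y p) (u p) w"
      "dcov \<xi> p z (v p) = - \<eta> p (dvec u p z) + dflat \<omega> p z (u p) (v p)"
      using two_form_skew[OF \<omega>(1), of p "dvec v p (X p)" w] two_form_skew[OF \<omega>(1), of p "dvec u p (Y p)" w]
        two_form_skew[OF \<omega>(1), of p "dvec u p z" "v p"]
      by (simp_all add: d\<xi> d\<eta> \<zeta>_def \<eta>_p blinfun.add_left)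
    ultimately show ?thesis by linarith
  qed
  also have "\<dots> = - d_form2 A (omega_pi_omega \<pi> \<omega>) p (u p) (v p) w"
  proof -
    note add = linear_add[OF linear_dsharp[OF bi]] linear_add[OF linear_dflat[OF \<omega>(1)]]
    have "\<zeta> (dsharp \<pi> p (P (\<xi> p)) (\<eta> p)) + \<xi> p (dsharp \<pi> p (P (\<eta> p)) \<zeta>)
        + \<eta> p (dsharp \<pi> p (P \<zeta>) (\<xi> p)) = 0"
      unfolding P_def by (rule jacobi_dsharp[OF \<pi>])
    moreover have "dflat \<omega> p (u p) (v p) w - dflat \<omega> p (v p) (u p) w + dflat \<omega> p w (u p) (v p) = 0"
      using \<omega>(2) d_form2_apply[OF smooth_flat_rep[OF \<omega>(1) chart_at_mem(1)], of p "u p" "v p" w]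
      by (simp add: closed_form_def)
    moreover have "\<zeta> (dsharp \<pi> p h (\<xi> p)) = - \<xi> p (dsharp \<pi> p h \<zeta>)" for h
      by (rule dsharp_skew[OF bi])
    moreover have "dflat \<omega> p h (u p) w = - dflat \<omega> p h w (u p)" for h
      by (rule dflat_skew[OF \<omega>(1)])
    ultimately show ?thesis
      unfolding d_form2_omega_pi_omega[OF bi \<omega>] XY_p z_def
      by (simp add: add blinfun.add_left blinfun.add_right P_def \<xi>_def \<eta>_def \<zeta>_def)
  qed
  finally show ?thesis .
qed

text \<open>
  As the product equals its orthogonal, membership of the bracket is the vanishing of its pairing with all elements.
\<close>

lemma concur_iff_P_Omega:
  assumes \<pi>: "poisson_structure A \<pi>" and \<omega>: "two_form A \<omega>" "closed_form A \<omega>"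
  shows "concur A (graph_bivector \<pi>) (graph_form \<omega>) \<longleftrightarrow> P_Omega_structure A \<pi> \<omega>"
proof -
  have bi: "bivector_field A \<pi>" using \<pi> by (simp add: poisson_structure_def)
  let ?L = "cotangent_product (graph_bivector \<pi>) (graph_form \<omega>)"
  note sections = sections_product[OF bi \<omega>(1)]
  have mem_iff: "a \<in> ?L p \<longleftrightarrow> (\<forall>w. pairing a (graph_product \<pi> \<omega> (\<lambda>_. w) p) = 0)" for a p
    using perp_product[OF bi \<omega>(1), of p] unfolding perp_def cotangent_product_graphs by blast
  have "dirac_structure A ?L \<longleftrightarrow> (\<forall>u v. vector_field A u \<longrightarrow> vector_field A v \<longrightarrow>
      dorfman A (graph_product \<pi> \<omega> u) (graph_product \<pi> \<omega> v) \<in> sections A ?L)"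
    unfolding dirac_structure_def
    using vector_subbundle_product[OF bi \<omega>(1)] perp_product[OF bi \<omega>(1)] sections by auto
  also have "\<dots> \<longleftrightarrow> (\<forall>u v. vector_field A u \<longrightarrow> vector_field A v \<longrightarrow>
      (\<forall>p w. d_form2 A (omega_pi_omega \<pi> \<omega>) p (u p) (v p) w = 0))"
  proof -
    have "dorfman A (graph_product \<pi> \<omega> u) (graph_product \<pi> \<omega> v) \<in> sections A ?L \<longleftrightarrow>
        (\<forall>p w. d_form2 A (omega_pi_omega \<pi> \<omega>) p (u p) (v p) w = 0)"
      if uv: "vector_field A u" "vector_field A v" for u v
      using section_dorfman[OF section_graph_product[OF bi \<omega>(1) open_UNIV uv(1)]
          section_graph_product[OF bi \<omega>(1) open_UNIV uv(2)]]
      by (simp add: sections_def mem_iff dorfman_obstruction[OF \<pi> \<omega> uv])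
    then show ?thesis by blast
  qed
  also have "\<dots> \<longleftrightarrow> P_Omega_structure A \<pi> \<omega>"
    unfolding P_Omega_structure_def closed_form_def using vector_field_exists by metis
  finally show ?thesis unfolding concur_def .
qed


section \<open>Complementary two-forms\<close>

text \<open>
  The coordinate form of the Koszul bracket: skewness of \<open>P\<close> cancels the terms with the derivatives of
  \<open>\<xi>\<close> in the direction \<open>z\<close>.
\<close>

lemma koszul_bracket_apply:
  assumes \<pi>: "bivector_field A \<pi>" and \<xi>: "one_form A \<xi>" and \<eta>: "one_form A \<eta>"
  shows "koszul_bracket A \<pi> \<xi> \<eta> p z = dcov \<eta> p (bisharp \<pi> p (\<xi> p)) z
    - dcov \<xi> p (bisharp \<pi> p (\<eta> p)) z + \<eta> p (dsharp \<pi> p z (\<xi> p))"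
  using bisharp_skew[OF \<pi>, of "\<eta> p" p "dcov \<xi> p z"]
  by (simp add: koszul_bracket_def lie_deriv_apply vector_field_sharp_on[OF \<pi> open_UNIV \<xi>] \<eta>
      dvec_sharp[OF \<pi> \<xi>] d_form1_apply \<xi> blinfun.add_right blinfun.diff_left)

text \<open>
  In the defining expression all derivatives of the test one-form cancel, so that it is a linear functional of
  the value of the test form at \<open>p\<close>; this gives existence of the vector in the definition of the bracket.
  Uniqueness holds since every covector at \<open>p\<close> is the value of a global one-form.
\<close>

lemma cot_bracket_apply:
  assumes \<pi>: "bivector_field A \<pi>" and \<omega>: "two_form A \<omega>"
    and uv: "vector_field A u" "vector_field A v"
  fixes p :: 'a and \<alpha> :: "'e \<Rightarrow>\<^sub>L real"
  defines "P \<equiv> bisharp \<pi> p"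
  shows "blinfun_apply \<alpha> (cot_bracket A \<pi> \<omega> u v p) =
    \<alpha> (dvec v p (P (\<omega> p (u p))) - dvec u p (P (\<omega> p (v p)))) + dflat \<omega> p (P \<alpha>) (u p) (v p)
    + \<alpha> (dsharp \<pi> p (u p) (\<omega> p (v p))) - \<alpha> (dsharp \<pi> p (v p) (\<omega> p (u p)))"
proof -
  define \<xi> \<eta> where "\<xi> = (\<lambda>q. \<omega> q (u q))" and "\<eta> = (\<lambda>q. \<omega> q (v q))"
  have forms: "one_form A \<xi>" "one_form A \<eta>"
    unfolding \<xi>_def \<eta>_def by (intro one_form_flat_on \<omega> open_UNIV uv)+
  define \<Lambda> where "\<Lambda> = (\<lambda>\<alpha>. blinfun_apply \<alpha> (dvec v p (P (\<xi> p)) - dvec u p (P (\<eta> p)))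
    + dflat \<omega> p (P \<alpha>) (u p) (v p) + blinfun_apply \<alpha> (dsharp \<pi> p (u p) (\<eta> p))
    - blinfun_apply \<alpha> (dsharp \<pi> p (v p) (\<xi> p)))"
  have "linear \<Lambda>"
    by (rule linearI)
      (simp_all add: \<Lambda>_def blinfun.bilinear_simps linear_add[OF linear_dflat[OF \<omega>]]
        linear_scale[OF linear_dflat[OF \<omega>]] algebra_simps)
  then obtain x where x: "\<And>\<alpha>. blinfun_apply \<alpha> x = \<Lambda> \<alpha>"
    by (rule covector_functional_representation) blast
  have expr: "cot_lie A \<pi> \<xi> v \<zeta> p - cot_d A \<pi> u \<eta> \<zeta> p = \<Lambda> (\<zeta> p)" if \<zeta>: "one_form A \<zeta>" for \<zeta>
  proof -
    have "dcov \<xi> p (P (\<zeta> p)) (v p) = - \<eta> p (dvec u p (P (\<zeta> p))) + dflat \<omega> p (P (\<zeta> p)) (u p) (v p)"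
      using two_form_skew[OF \<omega>, of p "dvec u p (P (\<zeta> p))" "v p"] dcov_flat[OF \<omega> uv(1), of p]
      by (simp add: \<xi>_def \<eta>_def blinfun.add_left)
    then show ?thesis
      by (simp add: cot_lie_def cot_d_def anchor_der_def d_fun_contract \<zeta> uv forms
          koszul_bracket_apply[OF \<pi>] \<Lambda>_def P_def[symmetric] blinfun.diff_right)
  qed
  have "cot_bracket A \<pi> \<omega> u v p = x"
    unfolding cot_bracket_def \<xi>_def[symmetric] \<eta>_def[symmetric]
  proof (rule the_equality)
    show "\<forall>\<zeta>. one_form A \<zeta> \<longrightarrow> \<zeta> p x = cot_lie A \<pi> \<xi> v \<zeta> p - cot_d A \<pi> u \<eta> \<zeta> p"
      by (simp add: x expr)
  next
    fix y assume y: "\<forall>\<zeta>. one_form A \<zeta> \<longrightarrow> \<zeta> p y = cot_lie A \<pi> \<xi> v \<zeta> p - cot_d A \<pi> u \<eta> \<zeta> p"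
    show "y = x"
    proof (rule covector_separates)
      fix \<alpha> :: "'e \<Rightarrow>\<^sub>L real"
      obtain \<zeta> where \<zeta>: "one_form A \<zeta>" "\<zeta> p = \<alpha>" using one_form_exists by blast
      then have "blinfun_apply \<alpha> y = \<Lambda> \<alpha>" using y expr[OF \<zeta>(1)] by metis
      then show "blinfun_apply \<alpha> y = blinfun_apply \<alpha> x" by (simp add: x)
    qed
  qed
  then show ?thesis by (simp add: x \<Lambda>_def \<xi>_def \<eta>_def)
qed

text \<open>
  Moving \<open>\<omega>\<close> to the other side by skewness evaluates the bracket on the covector \<open>\<omega>w\<close>. The derivatives of \<open>u\<close>
  and \<open>v\<close> in the two brackets then cancel.
\<close>

lemma complementary_obstruction:
  assumes \<pi>: "bivector_field A \<pi>" and \<omega>: "two_form A \<omega>" "closed_form A \<omega>"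
    and uv: "vector_field A u" "vector_field A v"
  shows "koszul_bracket A \<pi> (\<lambda>q. \<omega> q (u q)) (\<lambda>q. \<omega> q (v q)) p w - \<omega> p (cot_bracket A \<pi> \<omega> u v p) w
    = - d_form2 A (omega_pi_omega \<pi> \<omega>) p (u p) (v p) w"
proof -
  define P where "P = bisharp \<pi> p"
  define \<xi> \<eta> where "\<xi> = (\<lambda>q. \<omega> q (u q))" and "\<eta> = (\<lambda>q. \<omega> q (v q))"
  have forms: "one_form A \<xi>" "one_form A \<eta>"
    unfolding \<xi>_def \<eta>_def by (intro one_form_flat_on \<omega> open_UNIV uv)+
  have "\<omega> p (cot_bracket A \<pi> \<omega> u v p) w = - \<omega> p w (cot_bracket A \<pi> \<omega> u v p)"
    by (rule two_form_skew[OF \<omega>(1)])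
  moreover have "\<omega> p w (cot_bracket A \<pi> \<omega> u v p) = \<omega> p w (dvec v p (P (\<xi> p))) - \<omega> p w (dvec u p (P (\<eta> p)))
      + dflat \<omega> p (P (\<omega> p w)) (u p) (v p) + \<omega> p w (dsharp \<pi> p (u p) (\<eta> p)) - \<omega> p w (dsharp \<pi> p (v p) (\<xi> p))"
    by (simp add: cot_bracket_apply[OF \<pi> \<omega>(1) uv] P_def \<xi>_def \<eta>_def blinfun.diff_right)
  moreover have "koszul_bracket A \<pi> \<xi> \<eta> p w = dcov \<eta> p (P (\<xi> p)) w - dcov \<xi> p (P (\<eta> p)) w
      + \<eta> p (dsharp \<pi> p w (\<xi> p))"
    by (simp add: koszul_bracket_apply[OF \<pi> forms] P_def)
  moreover have "dcov \<eta> p h w = - \<omega> p w (dvec v p h) + dflat \<omega> p h (v p) w" for h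
    using two_form_skew[OF \<omega>(1), of p "dvec v p h" w]
    by (simp add: \<eta>_def dcov_flat[OF \<omega>(1) uv(2)] blinfun.add_left)
  moreover have "dcov \<xi> p h w = - \<omega> p w (dvec u p h) - dflat \<omega> p h w (u p)" for h
    using two_form_skew[OF \<omega>(1), of p "dvec u p h" w] dflat_skew[OF \<omega>(1), of p h "u p" w]
    by (simp add: \<xi>_def dcov_flat[OF \<omega>(1) uv(1)] blinfun.add_left)
  moreover have "\<omega> p w (dsharp \<pi> p (v p) (\<xi> p)) = - \<xi> p (dsharp \<pi> p (v p) (\<omega> p w))"
    by (rule dsharp_skew[OF \<pi>])
  ultimately show ?thesis
    unfolding d_form2_omega_pi_omega[OF \<pi> \<omega>] by (simp add: P_def \<xi>_def \<eta>_def)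
qed

lemma P_Omega_iff_complementary:
  assumes \<pi>: "bivector_field A \<pi>" and \<omega>: "two_form A \<omega>" "closed_form A \<omega>"
  shows "P_Omega_structure A \<pi> \<omega> \<longleftrightarrow> complementary A \<pi> \<omega>"
proof -
  have "\<omega> p (cot_bracket A \<pi> \<omega> u v p) = koszul_bracket A \<pi> (\<lambda>q. \<omega> q (u q)) (\<lambda>q. \<omega> q (v q)) p \<longleftrightarrow>
      (\<forall>w. d_form2 A (omega_pi_omega \<pi> \<omega>) p (u p) (v p) w = 0)" (is "?l = ?r \<longleftrightarrow> _")
    if uv: "vector_field A u" "vector_field A v" for u v p
  proof -
    have "?l = ?r \<longleftrightarrow> (\<forall>w. ?r w - ?l w = 0)" by (auto intro: blinfun_eqI)
    then show ?thesis by (simp add: complementary_obstruction[OF \<pi> \<omega> uv])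
  qed
  then have "complementary A \<pi> \<omega> \<longleftrightarrow> (\<forall>u v. vector_field A u \<longrightarrow> vector_field A v \<longrightarrow>
      (\<forall>p w. d_form2 A (omega_pi_omega \<pi> \<omega>) p (u p) (v p) w = 0))"
    unfolding complementary_def by blast
  also have "\<dots> \<longleftrightarrow> P_Omega_structure A \<pi> \<omega>"
    unfolding P_Omega_structure_def closed_form_def using vector_field_exists by metis
  finally show ?thesis ..
qed

end

theorem theoremD:
  fixes A :: "('a::{t2_space,second_countable_topology}, 'e::real_inner) atlas"
    and \<pi> :: "'a \<Rightarrow> ('e \<Rightarrow>\<^sub>L real) \<Rightarrow>\<^sub>L ('e \<Rightarrow>\<^sub>L real) \<Rightarrow>\<^sub>L real"
    and \<omega> :: "'a \<Rightarrow> 'e \<Rightarrow>\<^sub>L 'e \<Rightarrow>\<^sub>L real"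
  assumes "smooth_atlas A"
    and "poisson_structure A \<pi>"
    and "two_form A \<omega>"
    and "closed_form A \<omega>"
  shows "(concur A (graph_bivector \<pi>) (graph_form \<omega>) \<longleftrightarrow> P_Omega_structure A \<pi> \<omega>) \<and>
         (P_Omega_structure A \<pi> \<omega> \<longleftrightarrow> complementary A \<pi> \<omega>)"
proof -
  obtain B :: "'e set" where "finite B" "span B = UNIV"
    using assms(1) unfolding smooth_atlas_def by blast
  then obtain E :: "'e set" where "orthonormal_basis E"
    using orthonormal_basis_exists by blast
  then interpret smooth_manifold E A
    using assms(1) by (simp add: smooth_manifold_def smooth_manifold_axioms_def)
  show ?thesis
    using concur_iff_P_Omega P_Omega_iff_complementary assms(2-4)
    unfolding poisson_structure_def by blast
qed

end
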